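(* The decision problem MDCWSP-D is NP-complete, where MDCWSP-D is: given a weighted graph $G$ and a positive integer $\alpha$, is there a shortest path between two vertices in $G$ whose degree centrality is greater than $\alpha$?
   Context: A weighted graph $G=(V,E)$ is a possibly directed graph whose edges carry positive weights (encoded as rationals in binary); in a directed graph an undirected edge is understood as a pair of oppositely directed edges. $G$ is assumed connected if undirected and weakly connected if directed. A path is a finite sequence of distinct vertices in which consecutive vertices are adjacent (a single vertex is allowed); its length is the sum of the weights of its edges, and a shortest path between two vertices is a path of minimum length from the first to the second. The neighbourhood of a path $P$ is $\mathcal{N}(P)=\{v:(u,v)\in E,\ u\in P\}\setminus P$, and its degree centrality is $C_d(P)=|\mathcal{N}(P)|$ (edge weights do not enter $C_d$). *)

theory Defs
  imports
    "HOL-Computational_Algebra.Polynomial"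
    "Graph_Theory.Digraph_Component"
    "Graph_Theory.Vertex_Walk"
begin

section \<open>Multi-tape Turing machines\<close>

text \<open>
  States and tape symbols are natural numbers. The states of \<open>M\<close> are \<open>0, \<dots>, halt M\<close>; \<open>0\<close> is the
  start state and \<open>halt M\<close> the only halting state. The symbols are the numbers below \<open>symbols M\<close>:
  \<open>0\<close> is the blank, \<open>1\<close> marks the left end of a tape, and \<open>2\<close> and \<open>3\<close> are the bits 0 and 1.
  Every tape is infinite to the right; a left move in cell \<open>0\<close> has no effect.
\<close>

datatype dir = Move_Left | Stay | Move_Right

record tm =
  tapes :: nat
  symbols :: nat
  halt :: nat
  delta :: "nat \<Rightarrow> nat list \<Rightarrow> nat \<times> (nat \<times> dir) list"

definition wf_tm :: "tm \<Rightarrow> bool" where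
  "wf_tm M \<longleftrightarrow> 2 \<le> tapes M \<and> 4 \<le> symbols M \<and>
     (\<forall>q as. q < halt M \<and> length as = tapes M \<and> set as \<subseteq> {..<symbols M} \<longrightarrow>
        (case delta M q as of (q', bs) \<Rightarrow>
           q' \<le> halt M \<and> length bs = tapes M \<and> fst ` set bs \<subseteq> {..<symbols M}))"

type_synonym tape = "(nat \<Rightarrow> nat) \<times> nat" \<comment> \<open>cell contents and head position\<close>
type_synonym config = "nat \<times> tape list"

fun head_symbol :: "tape \<Rightarrow> nat" where
  "head_symbol (f, h) = f h"

fun move_head :: "dir \<Rightarrow> nat \<Rightarrow> nat" where
  "move_head Move_Left h = h - 1"
| "move_head Stay h = h"
| "move_head Move_Right h = h + 1"

fun act :: "nat \<times> dir \<Rightarrow> tape \<Rightarrow> tape" where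
  "act (b, d) (f, h) = (f(h := b), move_head d h)"

fun step :: "tm \<Rightarrow> config \<Rightarrow> config" where
  "step M (q, ts) =
     (if q = halt M then (q, ts)
      else case delta M q (map head_symbol ts) of (q', bs) \<Rightarrow> (q', map2 act bs ts))"

definition word_cells :: "bool list \<Rightarrow> nat \<Rightarrow> nat" where
  "word_cells x i =
     (if i = 0 then 1 else if i \<le> length x then (if x ! (i - 1) then 3 else 2) else 0)"

definition start_config :: "tm \<Rightarrow> bool list \<Rightarrow> config" where
  "start_config M x =
     (0, (word_cells x, 0) # replicate (tapes M - 1) (word_cells [], 0))"

text \<open>
  The input is on tape \<open>0\<close>. The output is the word on tape \<open>1\<close> from cell \<open>1\<close> up to the first blank.
\<close>

definition output_is :: "config \<Rightarrow> bool list \<Rightarrow> bool" where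
  "output_is c y \<longleftrightarrow> (\<forall>i\<in>{1..length y + 1}. fst (snd c ! 1) i = word_cells y i)"

definition computes_in_time :: "tm \<Rightarrow> (bool list \<Rightarrow> bool list) \<Rightarrow> (nat \<Rightarrow> nat) \<Rightarrow> bool" where
  "computes_in_time M f T \<longleftrightarrow>
     (\<forall>x. \<exists>t \<le> T (length x). let c = (step M ^^ t) (start_config M x) in
        fst c = halt M \<and> output_is c (f x))"


section \<open>NP-completeness\<close>

definition polytime :: "(bool list \<Rightarrow> bool list) \<Rightarrow> bool" where
  "polytime f \<longleftrightarrow> (\<exists>M (p :: nat poly). wf_tm M \<and> computes_in_time M f (poly p))"

text \<open>A self-delimiting code: no \<open>delimit x\<close> is a proper prefix of another \<open>delimit y\<close>.\<close>

definition delimit :: "bool list \<Rightarrow> bool list" where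
  "delimit x = concat (map (\<lambda>b. [True, b]) x) @ [False]"

definition pair_word :: "bool list \<Rightarrow> bool list \<Rightarrow> bool list" where
  "pair_word x u = delimit x @ u"

text \<open>A language is in NP iff it has a polynomial-time verifier for certificates of polynomial length.\<close>

definition NP :: "bool list set set" where
  "NP = {L. \<exists>V (p :: nat poly). polytime V \<and>
     (\<forall>x. x \<in> L \<longleftrightarrow> (\<exists>u. length u \<le> poly p (length x) \<and> V (pair_word x u) = [True]))}"

definition poly_reducible :: "bool list set \<Rightarrow> bool list set \<Rightarrow> bool"  (infix "\<le>\<^sub>p" 50) where
  "L \<le>\<^sub>p L' \<longleftrightarrow> (\<exists>f. polytime f \<and> (\<forall>x. x \<in> L \<longleftrightarrow> f x \<in> L'))"

definition NP_hard :: "bool list set \<Rightarrow> bool" where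
  "NP_hard L \<longleftrightarrow> (\<forall>L'\<in>NP. L' \<le>\<^sub>p L)"

definition NP_complete :: "bool list set \<Rightarrow> bool" where
  "NP_complete L \<longleftrightarrow> L \<in> NP \<and> NP_hard L"


section \<open>Shortest paths and degree centrality\<close>

text \<open>
  An undirected edge is a pair of opposite arcs of equal weight, so \<open>Digraph_Component.connected\<close>
  (connectedness of the symmetric closure) is connectedness for undirected graphs and weak
  connectedness for directed ones. A path is the nonempty list of its vertices (\<open>vpath\<close>).
\<close>

definition weighted_graph :: "'a pair_pre_digraph \<Rightarrow> ('a \<times> 'a \<Rightarrow> rat) \<Rightarrow> bool" where
  "weighted_graph G w \<longleftrightarrow>
     pair_digraph G \<and> Digraph_Component.connected (with_proj G) \<and> (\<forall>e\<in>parcs G. 0 < w e)"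

definition path_between :: "'a pair_pre_digraph \<Rightarrow> 'a \<Rightarrow> 'a \<Rightarrow> 'a list \<Rightarrow> bool" where
  "path_between G s t P \<longleftrightarrow> vpath P (with_proj G) \<and> hd P = s \<and> last P = t"

definition path_length :: "('a \<times> 'a \<Rightarrow> rat) \<Rightarrow> 'a list \<Rightarrow> rat" where
  "path_length w P = (\<Sum>e\<leftarrow>vwalk_arcs P. w e)"

definition shortest_path ::
    "'a pair_pre_digraph \<Rightarrow> ('a \<times> 'a \<Rightarrow> rat) \<Rightarrow> 'a \<Rightarrow> 'a \<Rightarrow> 'a list \<Rightarrow> bool" where
  "shortest_path G w s t P \<longleftrightarrow> path_between G s t P \<and>
     (\<forall>Q. path_between G s t Q \<longrightarrow> path_length w P \<le> path_length w Q)"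

definition neighbourhood :: "'a pair_pre_digraph \<Rightarrow> 'a list \<Rightarrow> 'a set" where
  "neighbourhood G P = {v. \<exists>u\<in>set P. (u, v) \<in> parcs G} - set P"

definition degree_centrality :: "'a pair_pre_digraph \<Rightarrow> 'a list \<Rightarrow> nat" where
  "degree_centrality G P = card (neighbourhood G P)"


section \<open>The decision problem\<close>

text \<open>
  A description of a weighted graph on the vertices \<open>0, \<dots>, n - 1\<close>: an entry \<open>((u, v), (a, b))\<close> of the
  list is an edge from \<open>u\<close> to \<open>v\<close> of weight \<open>a / b\<close>, where the fraction need not be in lowest terms.
  An undirected graph lists each edge once, in either orientation.
\<close>

record wgraph =
  directed :: bool
  num_verts :: nat
  edges :: "((nat \<times> nat) \<times> (nat \<times> nat)) list"

definition arc_list :: "wgraph \<Rightarrow> ((nat \<times> nat) \<times> (nat \<times> nat)) list" where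
  "arc_list X = (if directed X then edges X
     else edges X @ map (\<lambda>((u, v), ab). ((v, u), ab)) (edges X))"

definition graph_of :: "wgraph \<Rightarrow> nat pair_pre_digraph" where
  "graph_of X = \<lparr>pverts = {..<num_verts X}, parcs = set (map fst (arc_list X))\<rparr>"

definition weight_of :: "wgraph \<Rightarrow> nat \<times> nat \<Rightarrow> rat" where
  "weight_of X e = (case the (map_of (arc_list X) e) of (a, b) \<Rightarrow> of_nat a / of_nat b)"

definition wf_wgraph :: "wgraph \<Rightarrow> bool" where
  "wf_wgraph X \<longleftrightarrow> distinct (map fst (arc_list X)) \<and> (\<forall>(e, (a, b))\<in>set (edges X). 0 < b) \<and>
     weighted_graph (graph_of X) (weight_of X)"

text \<open>Binary representation, least significant bit first, without leading zeros.\<close>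

fun bits :: "nat \<Rightarrow> bool list" where
  "bits n = (if n = 0 then [] else odd n # bits (n div 2))"

declare bits.simps [simp del]

definition encode_nats :: "nat list \<Rightarrow> bool list" where
  "encode_nats ns = concat (map (\<lambda>n. delimit (bits n)) ns)"

text \<open>
  By connectedness a graph with \<open>n\<close> vertices has at least \<open>n - 1\<close> edges, so although \<open>n\<close> is written
  in binary, the code of a well-formed instance is longer than its number of vertices.
\<close>

definition encode :: "wgraph \<Rightarrow> nat \<Rightarrow> bool list" where
  "encode X \<alpha> = encode_nats ([of_bool (directed X), num_verts X, \<alpha>] @
     concat (map (\<lambda>((u, v), (a, b)). [u, v, a, b]) (edges X)))"

definition MDCWSP_D :: "bool list set" where
  "MDCWSP_D = {encode X \<alpha> | X \<alpha>. wf_wgraph X \<and> 0 < \<alpha> \<and>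
     (\<exists>s t P. shortest_path (graph_of X) (weight_of X) s t P \<and>
        degree_centrality (graph_of X) P > \<alpha>)}"

text \<open>The encoding is unambiguous.\<close>

lemma delimit_append_eq: "delimit x @ r = delimit y @ s \<Longrightarrow> x = y \<and> r = s"
proof (induction x arbitrary: y)
  case Nil
  then show ?case by (cases y) (auto simp: delimit_def)
next
  case (Cons b x)
  then show ?case by (cases y) (auto simp: delimit_def)
qed

lemma bits_inject: "bits m = bits n \<Longrightarrow> m = n"
proof (induction m arbitrary: n rule: less_induct)
  case (less m)
  show ?case
  proof (cases "m = 0 \<or> n = 0")
    case True
    with less.prems show ?thesis
      by (subst (asm) (1 2) bits.simps) (auto split: if_splits)
  next
    case False
    with less.prems have "odd m = odd n" "bits (m div 2) = bits (n div 2)"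
      by (subst (asm) (1 2) bits.simps, simp)+
    moreover from this less.IH [of "m div 2"] False have "m div 2 = n div 2"
      by simp
    ultimately show ?thesis
      by (metis even_two_times_div_two odd_two_times_div_two_succ)
  qed
qed

lemma encode_nats_inject: "encode_nats ms = encode_nats ns \<Longrightarrow> ms = ns"
proof (induction ms arbitrary: ns)
  case Nil
  then show ?case by (cases ns) (auto simp: encode_nats_def delimit_def)
next
  case (Cons m ms)
  show ?case
  proof (cases ns)
    case Nil
    with Cons.prems show ?thesis by (auto simp: encode_nats_def delimit_def)
  next
    case (Cons n ns')
    with Cons.prems have "delimit (bits m) @ encode_nats ms = delimit (bits n) @ encode_nats ns'"
      by (simp add: encode_nats_def)
    from delimit_append_eq [OF this] Cons.IH bits_inject Cons show ?thesis by blast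
  qed
qed

lemma encode_inject: "encode X \<alpha> = encode Y \<beta> \<Longrightarrow> X = Y \<and> \<alpha> = \<beta>"
proof -
  have edges: "concat (map (\<lambda>((u, v), (a, b)). [u, v, a, b]) es) =
      concat (map (\<lambda>((u, v), (a, b)). [u, v, a, b]) fs) \<Longrightarrow> es = fs"
    for es fs :: "((nat \<times> nat) \<times> (nat \<times> nat)) list"
  proof (induction es arbitrary: fs)
    case Nil
    then show ?case by (cases fs) auto
  next
    case (Cons e es)
    then show ?case by (cases e; cases fs) (auto split: prod.splits)
  qed
  assume "encode X \<alpha> = encode Y \<beta>"
  from encode_nats_inject [OF this [unfolded encode_def]] show ?thesis
    by (cases X; cases Y) (auto simp: of_bool_def dest: edges split: if_splits)
qed

end

theory Submission
  imports Defs
begin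

text \<open>
  Membership in NP: a certificate consists of a path, of rational potentials (multiplied by a common
  denominator) that do not increase along any arc by more than its weight and increase by exactly the
  weight along the path, so that the path is shortest, and of levels certifying connectedness. Such
  potentials are the distances from the first vertex, truncated at the length of the path.

  Hardness: the computation tableau of a verifier becomes a directed graph with unit weights. The
  entries of the tableau are layers, and the possible contents of an entry are the vertices of its
  layer; consecutive layers are completely joined, so that a path through all layers is a shortest
  path and chooses a content for every entry. Every local constraint is a disjunction of choices and is
  represented by many sinks adjacent to the vertices that satisfy it. A path has large degree
  centrality iff it satisfies all constraints.

  That the verifier and the reduction run in polynomial time is shown for functions on data encoded as
  binary trees: the class of functions computed in polynomial time by structured multi-stack programs
  contains the basic operations and is closed under composition and under folds whose intermediate
  results have polynomial size.
\<close>


section \<open>A while language on tapes and its compilation to machines\<close>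

section \<open>Structured programs on tapes\<close>

text \<open>Shortest paths could be computed, but an algorithm would have to be programmed and timed
  on the machine model. Potentials replace it by linear programming duality: optimality becomes one
  inequality per arc, and levels do the same for connectedness. Binary numbers shape both halves. A
  range \<open>[0..<n]\<close> may be exponentially longer than the code of \<open>n\<close>, so
  programs iterate only over lists that are already there; the verifier recovers the vertices from
  the edges, and the reduction builds unary lists as long as its clocks and layers. The verifier
  never analyses malformed input: it decodes blindly, re-encodes and compares. The reduction starts
  from an arbitrary verifier rather than from satisfiability of formulas, because a layer can hold
  any fixed number of options and so takes a tableau entry as it is. Clauses need positive literals
  only: that an entry differs from a given option is the disjunction of all the others.\<close>

declare step.simps [simp del]

text \<open>\<open>Move\<close> keeps the scanned symbol, so a head can leave a cell whose content
  is not known in advance; \<open>push\<close> relies on this.\<close>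

datatype com =
    Put nat nat dir
  | Move nat dir
  | Seq com com (infixr ";;" 60)
  | Cond nat "nat set" com com
  | Loop nat "nat set" com

primrec wfc :: "nat \<Rightarrow> com \<Rightarrow> bool" where
  "wfc k (Put i b d) \<longleftrightarrow> i < k \<and> b < 4"
| "wfc k (Move i d) \<longleftrightarrow> i < k"
| "wfc k (c ;; d) \<longleftrightarrow> wfc k c \<and> wfc k d"
| "wfc k (Cond i S c d) \<longleftrightarrow> i < k \<and> wfc k c \<and> wfc k d"
| "wfc k (Loop i S c) \<longleftrightarrow> i < k \<and> wfc k c"

lemma wfc_mono: "wfc k c \<Longrightarrow> k \<le> l \<Longrightarrow> wfc l c"
  by (induction c) auto

text \<open>The counter charges one step to every construct, also to sequencing, tests and loop
  exits. It is thus the exact number of steps of the compiled machine, which spends one step on each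
  unfolding of a continuation.\<close>

inductive exec :: "com \<Rightarrow> (nat \<Rightarrow> tape) \<Rightarrow> nat \<Rightarrow> (nat \<Rightarrow> tape) \<Rightarrow> bool" where
  exec_Put: "exec (Put i b d) \<sigma> 1 (\<sigma>(i := act (b, d) (\<sigma> i)))"
| exec_Move: "exec (Move i d) \<sigma> 1 (\<sigma>(i := act (head_symbol (\<sigma> i), d) (\<sigma> i)))"
| exec_Seq: "exec c \<sigma> m \<tau> \<Longrightarrow> exec d \<tau> n \<upsilon> \<Longrightarrow> exec (c ;; d) \<sigma> (Suc (m + n)) \<upsilon>"
| exec_CondT: "head_symbol (\<sigma> i) \<in> S \<Longrightarrow> exec c \<sigma> n \<tau> \<Longrightarrow> exec (Cond i S c d) \<sigma> (Suc n) \<tau>"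
| exec_CondF: "head_symbol (\<sigma> i) \<notin> S \<Longrightarrow> exec d \<sigma> n \<tau> \<Longrightarrow> exec (Cond i S c d) \<sigma> (Suc n) \<tau>"
| exec_LoopT: "head_symbol (\<sigma> i) \<in> S \<Longrightarrow> exec c \<sigma> m \<tau> \<Longrightarrow> exec (Loop i S c) \<tau> n \<upsilon>
    \<Longrightarrow> exec (Loop i S c) \<sigma> (Suc (m + n)) \<upsilon>"
| exec_LoopF: "head_symbol (\<sigma> i) \<notin> S \<Longrightarrow> exec (Loop i S c) \<sigma> 1 \<sigma>"

text \<open>
  A program is compiled to a machine whose states are the continuations that can occur while it runs.
\<close>

fun next_cont :: "com list \<Rightarrow> (nat \<Rightarrow> nat) \<Rightarrow> com list" where
  "next_cont [] a = []"
| "next_cont ((c ;; d) # K) a = c # d # K"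
| "next_cont (Cond i S c d # K) a = (if a i \<in> S then c else d) # K"
| "next_cont (Loop i S c # K) a = (if a i \<in> S then c # Loop i S c # K else K)"
| "next_cont (_ # K) a = K"

fun next_act :: "com list \<Rightarrow> nat \<Rightarrow> nat \<Rightarrow> nat \<times> dir" where
  "next_act (Put i b d # K) j a = (if j = i then (b, d) else (a, Stay))"
| "next_act (Move i d # K) j a = (a, if j = i then d else Stay)"
| "next_act _ j a = (a, Stay)"

text \<open>The continuations met while \<open>c\<close> runs in front of \<open>K\<close>, before
  control returns to \<open>K\<close>. The body of a loop has the loop itself as its continuation,
  so the recursion is structural and the set finite.\<close>

primrec conts :: "com \<Rightarrow> com list \<Rightarrow> com list set" where
  "conts (Put i b d) K = {Put i b d # K}"
| "conts (Move i d) K = {Move i d # K}"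
| "conts (c ;; d) K = insert ((c ;; d) # K) (conts c (d # K) \<union> conts d K)"
| "conts (Cond i S c d) K = insert (Cond i S c d # K) (conts c K \<union> conts d K)"
| "conts (Loop i S c) K = insert (Loop i S c # K) (conts c (Loop i S c # K))"

lemma finite_conts: "finite (conts c K)"
  by (induction c arbitrary: K) auto

lemma self_in_conts: "c # K \<in> conts c K"
  by (cases c) auto

lemma next_cont_in_conts: "L \<in> conts c K \<Longrightarrow> next_cont L a \<in> insert K (conts c K)"
proof (induction c arbitrary: K)
  case (Seq c d)
  show ?case
    using Seq.prems Seq.IH(1)[of "d # K"] Seq.IH(2)[of K] self_in_conts[of d K] self_in_conts[of c "d # K"]
    by auto
next
  case (Cond i S c d)
  show ?case
    using Cond.prems Cond.IH(1)[of K] Cond.IH(2)[of K] self_in_conts[of c K] self_in_conts[of d K]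
    by auto
next
  case (Loop i S c)
  show ?case
    using Loop.prems Loop.IH[of "Loop i S c # K"] self_in_conts[of c "Loop i S c # K"]
    by (cases "a i \<in> S") auto
qed (auto split: if_splits)

lemma conts_wfc: "L \<in> conts c K \<Longrightarrow> wfc k c \<Longrightarrow> L \<noteq> [] \<and> wfc k (hd L)"
  by (induction c arbitrary: K) auto

lemma next_cont_cong:
  "L \<noteq> [] \<Longrightarrow> wfc k (hd L) \<Longrightarrow> (\<And>i. i < k \<Longrightarrow> a i = b i) \<Longrightarrow> next_cont L a = next_cont L b"
  by (cases "(L, a)" rule: next_cont.cases) auto

lemma act_stay: "act (head_symbol t, Stay) t = t"
  by (cases t) auto

lemma compile:
  assumes wf: "wfc k c" and k: "2 \<le> k"
  obtains M where "wf_tm M" "tapes M = k"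
    "\<And>\<sigma> n \<tau>. exec c \<sigma> n \<tau> \<Longrightarrow>
      (step M ^^ n) (0, map \<sigma> [0..<k]) = (halt M, map \<tau> [0..<k])"
proof -
  let ?Q = "conts c []"
  obtain qs where qs: "set qs = ?Q - {[c]}" "distinct qs"
    using finite_distinct_list finite_conts finite_Diff by metis
  \<comment> \<open>The start state is 0 and the halting state the last one, so the initial
    continuation \<open>[c]\<close> leads the enumeration and the empty one closes it.\<close>
  define L where "L = [c] # qs @ [[]]"
  have nn: "[] \<notin> ?Q"
    using conts_wfc[OF _ wf] by blast
  have dL: "distinct L" and sL: "set L = insert [] ?Q"
    using qs nn self_in_conts[of c "[]"] by (auto simp: L_def)
  define h where "h = Suc (length qs)"
  have lenL: "length L = Suc h" by (simp add: L_def h_def)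
  have "\<forall>K\<in>set L. \<exists>i. i < length L \<and> L ! i = K"
    by (auto simp: in_set_conv_nth)
  from bchoice[OF this] obtain e where "\<forall>K\<in>set L. e K < length L \<and> L ! e K = K"
    by (rule exE)
  then have e: "\<And>K. K \<in> set L \<Longrightarrow> e K < length L \<and> L ! e K = K"
    by (rule bspec)
  have eu: "e (L ! i) = i" if "i < length L" for i
    using e[of "L ! i"] that nth_eq_iff_index_eq[OF dL, of "e (L ! i)" i] by simp
  have e0: "e [c] = 0" using eu[of 0] by (simp add: L_def)
  have eh: "e [] = h" using eu[of h] by (simp add: L_def h_def nth_append)
  define M where "M = \<lparr>tapes = k, symbols = 4, halt = h,
    delta = (\<lambda>q as. (e (next_cont (L ! q) (\<lambda>i. as ! i)),
       map (\<lambda>j. next_act (L ! q) j (as ! j)) [0..<k]))\<rparr>"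
  have LQ: "L ! q \<in> ?Q" if "q < h" for q
  proof -
    have "L ! q \<in> set L" using that lenL by simp
    moreover have "L ! q \<noteq> L ! h" using that lenL dL by (simp add: nth_eq_iff_index_eq)
    moreover have "L ! h = []" by (simp add: L_def h_def nth_append)
    ultimately show ?thesis using sL by auto
  qed
  have na: "fst (next_act K j a) < 4" if "K \<noteq> []" "wfc k (hd K)" "a < 4" for K j a
    using that by (cases "(K, j, a)" rule: next_act.cases) auto
  have "wf_tm M"
    unfolding wf_tm_def
  proof (intro conjI allI impI)
    fix q as
    assume a: "q < halt M \<and> length as = tapes M \<and> set as \<subseteq> {..<symbols M}"
    then have q: "L ! q \<in> ?Q" using LQ by (simp add: M_def)
    have "next_cont (L ! q) (\<lambda>i. as ! i) \<in> set L"
      using next_cont_in_conts[OF q] sL by simp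
    then have "e (next_cont (L ! q) (\<lambda>i. as ! i)) \<le> h"
      using e lenL by fastforce
    moreover have "fst (next_act (L ! q) j (as ! j)) < 4" if "j < k" for j
      using conts_wfc[OF q wf] a that na by (simp add: M_def subset_iff)
    ultimately show "case delta M q as of (q', bs) \<Rightarrow>
        q' \<le> halt M \<and> length bs = tapes M \<and> fst ` set bs \<subseteq> {..<symbols M}"
      by (auto simp: M_def)
  qed (use k in \<open>auto simp: M_def\<close>)
  have one: "step M (e K, map \<sigma> [0..<k]) = (e (next_cont K (\<lambda>i. head_symbol (\<sigma> i))),
      map (\<lambda>j. act (next_act K j (head_symbol (\<sigma> j))) (\<sigma> j)) [0..<k])" if "K \<in> ?Q" for K \<sigma>
  proof -
    have KL: "K \<in> set L" using that sL by simp
    have "e K \<noteq> h"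
      using e[OF KL] that nn by (metis L_def append_Cons e eh in_set_conv_decomp insertCI sL)
    moreover have "next_cont K ((!) (map (\<lambda>x. head_symbol (\<sigma> x)) [0..<k]))
        = next_cont K (\<lambda>i. head_symbol (\<sigma> i))"
      by (rule next_cont_cong[of _ k]) (use conts_wfc[OF that wf] in auto)
    ultimately show ?thesis
      using e[OF KL]
      by (simp add: M_def map2_map_map comp_def step.simps cong: map_cong)
  qed
  \<comment> \<open>\<open>K\<close> is arbitrary, and the continuations need only lie among those
    of the whole program, so that the induction applies to subprograms that run with work
    pending.\<close>
  have main: "exec d \<sigma> n \<tau> \<Longrightarrow> conts d K \<subseteq> ?Q \<Longrightarrow>
     (step M ^^ n) (e (d # K), map \<sigma> [0..<k]) = (e K, map \<tau> [0..<k])" for d \<sigma> n \<tau> K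
  proof (induction arbitrary: K rule: exec.induct)
    case (exec_Put i b d \<sigma>)
    then show ?case
      by (auto simp: one act_stay)
  next
    case (exec_Move i d \<sigma>)
    then show ?case
      by (auto simp: one act_stay)
  next
    case (exec_Seq c \<sigma> m \<tau> d n \<upsilon>)
    then show ?case
      by (simp add: funpow_swap1 one act_stay self_in_conts funpow_add add.commute[of m] subset_iff)
  next
    case (exec_CondT \<sigma> i S c n \<tau> d)
    then show ?case
      by (simp add: funpow_swap1 one act_stay)
  next
    case (exec_CondF \<sigma> i S d n \<tau> c)
    then show ?case
      by (simp add: funpow_swap1 one act_stay)
  next
    case (exec_LoopT \<sigma> i S c m \<tau> n \<upsilon>)
    then show ?case
      by (simp add: funpow_swap1 one act_stay self_in_conts funpow_add add.commute[of m] subset_iff)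
  next
    case (exec_LoopF \<sigma> i S c)
    then show ?case
      by (simp add: one act_stay)
  qed
  show thesis
  proof (rule that[of M])
    show "(step M ^^ n) (0, map \<sigma> [0..<k]) = (halt M, map \<tau> [0..<k])"
      if "exec c \<sigma> n \<tau>" for \<sigma> n \<tau>
      using main[OF that, of "[]"] e0 eh by (simp add: M_def)
  qed (use \<open>wf_tm M\<close> in \<open>auto simp: M_def\<close>)
qed


section \<open>Words as stacks\<close>

section \<open>Stack programs\<close>

text \<open>A stack is stored with its bottom next to the left end marker, so that its top is below the head.\<close>

definition stk :: "bool list \<Rightarrow> tape" where
  "stk xs = (word_cells (rev xs), length xs)"

definition sym :: "bool \<Rightarrow> nat" where
  "sym b = (if b then 3 else 2)"

definition push :: "nat \<Rightarrow> bool \<Rightarrow> com" where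
  "push r b = Move r Move_Right ;; Put r (sym b) Stay"

definition pop :: "nat \<Rightarrow> com" where
  "pop r = Put r 0 Move_Left"

text \<open>All registers are present here, while a machine simulates those below the
  \<open>k\<close> of \<open>wfc\<close>. From here on times are upper bounds, which compose without
  exact bookkeeping.\<close>

definition run :: "com \<Rightarrow> (nat \<Rightarrow> bool list) \<Rightarrow> nat \<Rightarrow> (nat \<Rightarrow> bool list) \<Rightarrow> bool" where
  "run c s n s' \<longleftrightarrow> (\<exists>m\<le>n. exec c (stk \<circ> s) m (stk \<circ> s'))"

lemma head_stk [simp]: "head_symbol (stk []) = 1" "head_symbol (stk (b # xs)) = sym b"
  by (auto simp: stk_def word_cells_def sym_def nth_append)

lemma stk_push: "act (sym b, Stay) (act (head_symbol (stk xs), Move_Right) (stk xs)) = stk (b # xs)"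
  by (auto simp: stk_def word_cells_def sym_def fun_eq_iff nth_append)

lemma stk_pop: "act (0, Move_Left) (stk (b # xs)) = stk xs"
  by (auto simp: stk_def word_cells_def fun_eq_iff nth_append)

lemma run_mono: "run c s m t \<Longrightarrow> m \<le> n \<Longrightarrow> run c s n t"
  unfolding run_def using le_trans by blast

lemma run_push: "3 \<le> n \<Longrightarrow> run (push r b) s n (s(r := b # s r))"
proof -
  let ?t = "(stk \<circ> s)(r := act (head_symbol (stk (s r)), Move_Right) (stk (s r)))"
  have "exec (Move r Move_Right) (stk \<circ> s) 1 ?t"
    using exec_Move[of r Move_Right "stk \<circ> s"] by simp
  moreover have "exec (Put r (sym b) Stay) ?t 1 (stk \<circ> s(r := b # s r))"
    using exec_Put[of r "sym b" Stay ?t] by (simp add: stk_push fun_upd_comp)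
  ultimately have "exec (push r b) (stk \<circ> s) (Suc (1 + 1)) (stk \<circ> s(r := b # s r))"
    unfolding push_def by (rule exec_Seq)
  then show "3 \<le> n \<Longrightarrow> ?thesis"
    unfolding run_def by (intro exI[of _ "Suc (1 + 1)"]) auto
qed

lemma run_pop: "s r = b # xs \<Longrightarrow> 1 \<le> n \<Longrightarrow> run (pop r) s n (s(r := xs))"
  using exec_Put[of r 0 Move_Left "stk \<circ> s"]
  by (auto simp: run_def pop_def stk_pop fun_upd_comp intro!: exI[of _ "Suc 0"])

lemma run_seq: "run c s m t \<Longrightarrow> run d t n u \<Longrightarrow> Suc (m + n) \<le> k \<Longrightarrow> run (c ;; d) s k u"
  unfolding run_def by (meson Suc_le_mono add_mono_thms_linordered_semiring(1) exec_Seq le_trans)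

lemma run_CondT: "head_symbol (stk (s r)) \<in> S \<Longrightarrow> run c s n t \<Longrightarrow> Suc n \<le> k \<Longrightarrow> run (Cond r S c d) s k t"
  unfolding run_def by (metis Suc_le_mono comp_apply exec_CondT le_trans)

lemma run_CondF: "head_symbol (stk (s r)) \<notin> S \<Longrightarrow> run d s n t \<Longrightarrow> Suc n \<le> k \<Longrightarrow> run (Cond r S c d) s k t"
  unfolding run_def by (metis Suc_le_mono comp_apply exec_CondF le_trans)

lemma run_LoopT: "head_symbol (stk (s r)) \<in> S \<Longrightarrow> run c s m t \<Longrightarrow> run (Loop r S c) t n u \<Longrightarrow>
    Suc (m + n) \<le> k \<Longrightarrow> run (Loop r S c) s k u"
  unfolding run_def
  by (metis Suc_le_mono add_mono comp_apply exec_LoopT le_trans)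

lemma run_LoopF: "head_symbol (stk (s r)) \<notin> S \<Longrightarrow> 1 \<le> k \<Longrightarrow> run (Loop r S c) s k s"
  unfolding run_def by (metis comp_apply exec_LoopF)

section \<open>From the input tape to an input stack\<close>

lemma word_cells_cases:
  "word_cells x 0 = 1" "i < length x \<Longrightarrow> word_cells x (Suc i) = sym (x ! i)"
  "length x < i \<Longrightarrow> word_cells x i = 0"
  by (auto simp: word_cells_def sym_def)

lemma seek_loop:
  "i \<le> length x \<Longrightarrow> \<exists>m. m \<le> 2 * (length x - i) + 1 \<and>
    exec (Loop 0 {2, 3} (Move 0 Move_Right)) (\<sigma>(0 := (word_cells x, Suc i))) m
      (\<sigma>(0 := (word_cells x, Suc (length x))))"
proof (induction "length x - i" arbitrary: i)
  case 0
  have "exec (Loop 0 {2, 3} (Move 0 Move_Right)) (\<sigma>(0 := (word_cells x, Suc (length x)))) 1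
      (\<sigma>(0 := (word_cells x, Suc (length x))))"
    by (rule exec_LoopF) (simp add: word_cells_cases)
  moreover have "i = length x" using 0 by simp
  ultimately show ?case by (intro exI[of _ 1] conjI) (simp, blast)
next
  case (Suc d)
  then have i: "i < length x" "d = length x - Suc i" by auto
  from Suc(1)[OF i(2)] i obtain m where m: "m \<le> 2 * (length x - Suc i) + 1"
    "exec (Loop 0 {2, 3} (Move 0 Move_Right)) (\<sigma>(0 := (word_cells x, Suc (Suc i)))) m
      (\<sigma>(0 := (word_cells x, Suc (length x))))" by auto
  have "exec (Move 0 Move_Right) (\<sigma>(0 := (word_cells x, Suc i))) 1
      (\<sigma>(0 := (word_cells x, Suc (Suc i))))"
    using exec_Move[of 0 Move_Right "\<sigma>(0 := (word_cells x, Suc i))"] by simp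
  from exec_LoopT[OF _ this m(2)] i m(1) show ?case
    by (intro exI[of _ "Suc (1 + m)"]) (auto simp: word_cells_cases sym_def)
qed

text \<open>The head starts on the left marker. Walking to the end of the input makes the tape a
  stack that holds the input reversed.\<close>

definition seek_end :: com where
  "seek_end = Move 0 Move_Right ;; Loop 0 {2, 3} (Move 0 Move_Right) ;; Move 0 Move_Left"

lemma exec_seek_end:
  "\<exists>m. m \<le> 2 * length x + 5 \<and> exec seek_end (\<sigma>(0 := (word_cells x, 0))) m (\<sigma>(0 := stk (rev x)))"
proof -
  obtain m where m: "m \<le> 2 * length x + 1"
    "exec (Loop 0 {2, 3} (Move 0 Move_Right)) (\<sigma>(0 := (word_cells x, Suc 0))) m
      (\<sigma>(0 := (word_cells x, Suc (length x))))"
    using seek_loop[of 0 x \<sigma>] by auto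
  have a: "exec (Move 0 Move_Right) (\<sigma>(0 := (word_cells x, 0))) 1
      (\<sigma>(0 := (word_cells x, Suc 0)))"
    using exec_Move[of 0 Move_Right "\<sigma>(0 := (word_cells x, 0))"] by simp
  have b: "exec (Move 0 Move_Left) (\<sigma>(0 := (word_cells x, Suc (length x)))) 1
      (\<sigma>(0 := stk (rev x)))"
    using exec_Move[of 0 Move_Left "\<sigma>(0 := (word_cells x, Suc (length x)))"]
    by (simp add: stk_def)
  show ?thesis
    unfolding seek_end_def using exec_Seq[OF a exec_Seq[OF m(2) b]] m(1)
    by (intro exI[of _ "Suc (1 + Suc (m + 1))"]) auto
qed

text \<open>Input and output are reversed because the top of a stack is at the right end of the word
  on the tape. Register 1 is the output tape.\<close>

theorem polytime_run:
  assumes wf: "wfc k c" and k: "2 \<le> k"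
    and r: "\<And>x. run c ((\<lambda>_. [])(0 := rev x)) (poly p (length x)) (s x)"
    and out: "\<And>x. s x 1 = rev (f x)"
  shows "polytime f"
proof -
  have "wfc k (seek_end ;; c)" using wf k by (simp add: seek_end_def)
  from compile[OF this k] obtain M where M: "wf_tm M" "tapes M = k"
    "\<And>\<sigma> n \<tau>. exec (seek_end ;; c) \<sigma> n \<tau> \<Longrightarrow>
      (step M ^^ n) (0, map \<sigma> [0..<k]) = (halt M, map \<tau> [0..<k])" by blast
  \<comment> \<open>\<open>seek_end\<close> takes at most \<open>2 * length x + 5\<close> steps and
    the sequencing one more.\<close>
  define q :: "nat poly" where "q = p + [:6, 2:]"
  have "computes_in_time M f (poly q)"
    unfolding computes_in_time_def
  proof
    fix x
    let ?\<sigma> = "(\<lambda>_. stk [])(0 := (word_cells x, 0))"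
    obtain m where m: "m \<le> 2 * length x + 5" "exec seek_end ?\<sigma> m ((\<lambda>_. stk [])(0 := stk (rev x)))"
      using exec_seek_end by blast
    have start: "stk \<circ> (\<lambda>_. [])(0 := rev x) = (\<lambda>_. stk [])(0 := stk (rev x))" by auto
    obtain n where n: "n \<le> poly p (length x)"
      "exec c ((\<lambda>_. stk [])(0 := stk (rev x))) n (stk \<circ> s x)"
      using r[of x] unfolding run_def start by blast
    have "start_config M x = (0, map ?\<sigma> [0..<k])"
      using k M(2) by (auto simp: start_config_def stk_def upt_rec[of 0 k] map_replicate_trivial
          simp del: upt.simps intro!: nth_equalityI)
    moreover have "output_is (halt M, map (stk \<circ> s x) [0..<k]) (f x)"
      using k out[of x] by (auto simp: output_is_def stk_def)
    ultimately show "\<exists>t\<le>poly q (length x). let c = (step M ^^ t) (start_config M x) in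
        fst c = halt M \<and> output_is c (f x)"
      using M(3)[OF exec_Seq[OF m(2) n(2)]] m(1) n(1)
      by (intro exI[of _ "Suc (m + n)"]) (auto simp: q_def)
  qed
  then show ?thesis using M(1) unfolding polytime_def by blast
qed

section \<open>Moving, clearing and copying stacks\<close>

lemma run_seq': "run c s m t \<Longrightarrow> run d t n u \<Longrightarrow> run (c ;; d) s (Suc (m + n)) u"
  by (rule run_seq) auto

lemma run_cong: "run c s n t \<Longrightarrow> s = s' \<Longrightarrow> n \<le> n' \<Longrightarrow> t = t' \<Longrightarrow> run c s' n' t'"
  using run_mono by blast

lemma run_post: "run c s n t \<Longrightarrow> n \<le> n' \<Longrightarrow> t = t' \<Longrightarrow> run c s n' t'"
  using run_mono by blast

text \<open>Programs have no variables for symbols, so a letter is transferred by branching on its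
  value. One move reverses a word, and two moves restore it.\<close>

definition mv :: "nat \<Rightarrow> nat \<Rightarrow> com" where
  "mv a b = Loop a {2, 3} (Cond a {3} (pop a ;; push b True) (pop a ;; push b False))"

lemma sym_mem [simp]: "sym b \<in> {2, 3}" "sym b \<in> {3} \<longleftrightarrow> b" "sym b \<in> {2} \<longleftrightarrow> \<not> b"
  "sym b \<noteq> 1" "sym b = 3 \<longleftrightarrow> b" "sym b = 2 \<longleftrightarrow> \<not> b"
  by (auto simp: sym_def)

lemma run_mv:
  "a \<noteq> b \<Longrightarrow> run (mv a b) s (7 * length (s a) + 1) (s(a := [], b := rev (s a) @ s b))"
proof (induction "s a" arbitrary: s)
  case Nil
  have "run (mv a b) s 1 s"
    using Nil(1)[symmetric] unfolding mv_def by (intro run_LoopF) auto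
  then show ?case
    by (rule run_cong) (use Nil(1) in \<open>auto simp: fun_eq_iff\<close>)
next
  case (Cons x xs)
  let ?s = "s(a := xs, b := x # s b)"
  have p: "run (pop a) s 1 (s(a := xs))"
    using run_pop[of s a x xs 1] Cons(2) by simp
  have "run (push b x) (s(a := xs)) 3 ?s"
    using run_push[of 3 b x "s(a := xs)"] Cons by simp
  from run_seq'[OF p this] have "run (pop a ;; push b x) s 5 ?s" by simp
  then have b: "run (Cond a {3} (pop a ;; push b True) (pop a ;; push b False)) s 6 ?s"
    by (cases x) (auto intro: run_CondT run_CondF simp: Cons(2)[symmetric])
  have l: "run (mv a b) ?s (7 * length xs + 1) (s(a := [], b := rev (s a) @ s b))"
    using Cons(1)[of ?s] Cons(2)[symmetric] Cons(3)
    by (auto simp: fun_upd_twist)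
  show ?case
    unfolding mv_def
    by (rule run_LoopT[OF _ b l[unfolded mv_def]]) (auto simp: Cons(2)[symmetric])
qed

definition clear :: "nat \<Rightarrow> com" where
  "clear a = Loop a {2, 3} (pop a)"

lemma run_clear: "run (clear a) s (2 * length (s a) + 1) (s(a := []))"
proof (induction "s a" arbitrary: s)
  case Nil
  then have "s(a := []) = s" by auto
  then show ?case
    using Nil(1)[symmetric] run_LoopF[of s a "{2, 3}"] by (simp add: clear_def)
next
  case (Cons x xs)
  have p: "run (pop a) s 1 (s(a := xs))"
    using run_pop[of s a x xs 1] Cons(2) by simp
  have l: "run (clear a) (s(a := xs)) (2 * length xs + 1) (s(a := []))"
    using Cons(1)[of "s(a := xs)"] by simp
  show ?case
    unfolding clear_def
    by (rule run_LoopT[OF _ p l[unfolded clear_def]]) (auto simp: Cons(2)[symmetric])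
qed

text \<open>The detour through \<open>t\<close> reverses the word and the way back reverses it
  again, so both copies come out in order.\<close>

definition dup :: "nat \<Rightarrow> nat \<Rightarrow> nat \<Rightarrow> com" where
  "dup a b t = mv a t ;; Loop t {2, 3} (Cond t {3}
     (pop t ;; push a True ;; push b True) (pop t ;; push a False ;; push b False))"

lemma run_dup_loop:
  assumes "a \<noteq> b" "a \<noteq> t" "b \<noteq> t"
  shows "run (Loop t {2, 3} (Cond t {3}
     (pop t ;; push a True ;; push b True) (pop t ;; push a False ;; push b False))) s
     (11 * length (s t) + 1) (s(t := [], a := rev (s t) @ s a, b := rev (s t) @ s b))"
proof (induction "s t" arbitrary: s)
  case Nil
  show ?case
    by (rule run_cong[OF run_LoopF[where s = s and k = 1]])
      (use Nil(1)[symmetric] in \<open>auto simp: fun_eq_iff\<close>)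
next
  case (Cons x xs)
  let ?s = "s(t := xs, a := x # s a, b := x # s b)"
  have "run (pop t) s 1 (s(t := xs))"
    using run_pop[of s t x xs 1] Cons(2) by simp
  moreover have "run (push a x) (s(t := xs)) 3 (s(t := xs, a := x # s a))"
    using run_push[of 3 a x "s(t := xs)"] assms by simp
  moreover have "run (push b x) (s(t := xs, a := x # s a)) 3 ?s"
    using run_push[of 3 b x "s(t := xs, a := x # s a)"] assms by simp
  ultimately have "run (pop t ;; push a x ;; push b x) s (Suc (1 + Suc (3 + 3))) ?s"
    by (intro run_seq')
  then have b: "run (Cond t {3} (pop t ;; push a True ;; push b True)
      (pop t ;; push a False ;; push b False)) s 10 ?s"
    by (cases x) (auto intro: run_CondT run_CondF simp: Cons(2)[symmetric])
  have "?s(t := [], a := rev (?s t) @ ?s a, b := rev (?s t) @ ?s b)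
      = s(t := [], a := rev (s t) @ s a, b := rev (s t) @ s b)"
    using assms Cons(2)[symmetric] by (auto simp: fun_eq_iff)
  moreover have "?s t = xs" using assms by simp
  ultimately show ?case
    using Cons(1)[of ?s]
    by (intro run_LoopT[OF _ b, where n = "11 * length xs + 1"])
      (auto simp: Cons(2)[symmetric])
qed

lemma run_dup:
  assumes "a \<noteq> b" "a \<noteq> t" "b \<noteq> t" "s t = []"
  shows "run (dup a b t) s (18 * length (s a) + 3) (s(b := s a @ s b))"
proof -
  let ?s = "s(a := [], t := rev (s a))"
  have 1: "run (mv a t) s (7 * length (s a) + 1) ?s"
    using run_mv[of a t s] assms by simp
  have 2: "?s(t := [], a := rev (?s t) @ ?s a, b := rev (?s t) @ ?s b) = s(b := s a @ s b)"
    using assms by (auto simp: fun_eq_iff)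
  show ?thesis
    unfolding dup_def
    by (rule run_mono[OF run_seq'[OF 1 run_dup_loop[OF assms(1-3), of ?s, unfolded 2]]]) simp
qed


section \<open>Binary trees as a universal data type\<close>

datatype tree = Leaf | Node tree tree

text \<open>Polish notation, a prefix-free code: serialized trees can be concatenated without
  separators and parsed off again.\<close>

primrec ser :: "tree \<Rightarrow> bool list" where
  "ser Leaf = [False]"
| "ser (Node a b) = True # ser a @ ser b"

lemma ser_append_eq: "ser a @ r = ser b @ s \<longleftrightarrow> a = b \<and> r = s"
proof (induction a arbitrary: b r s)
  case Leaf
  then show ?case by (cases b) auto
next
  case (Node a1 a2)
  then show ?case by (cases b) auto
qed

lemma ser_inject [simp]: "ser a = ser b \<longleftrightarrow> a = b"
  using ser_append_eq[of a "[]" b "[]"] by simp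

lemma ser_neq_Nil [simp]: "ser a \<noteq> []"
  by (cases a) auto

text \<open>Moves a serialized tree from stack \<open>a\<close>, reversed, to stack \<open>b\<close>; stack \<open>t\<close> counts, in unary,
  the subtrees that are still to be read.\<close>

definition parse_loop :: "nat \<Rightarrow> nat \<Rightarrow> nat \<Rightarrow> com" where
  "parse_loop a b t = Loop t {3} (Cond a {3}
     (pop a ;; push b True ;; push t True) (pop a ;; push b False ;; pop t))"

definition parse :: "nat \<Rightarrow> nat \<Rightarrow> nat \<Rightarrow> com" where
  "parse a b t = push t True ;; parse_loop a b t"

text \<open>Stated in continuation form. The loop ends only when the counter is empty, so reading
  one subtree is in general not a complete run; its effect is put in front of an arbitrary further
  run of the loop.\<close>

lemma run_parse_loop:
  assumes "a \<noteq> b" "a \<noteq> t" "b \<noteq> t"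
  shows "s a = ser d @ r \<Longrightarrow> s t = True # u \<Longrightarrow>
    run (parse_loop a b t) (s(a := r, b := rev (ser d) @ s b, t := u)) n v \<Longrightarrow>
    run (parse_loop a b t) s (n + 11 * length (ser d)) v"
proof (induction d arbitrary: s r u n)
  case Leaf
  let ?s = "s(a := r, b := False # s b, t := u)"
  have "run (pop a) s 1 (s(a := r))"
    using Leaf by (intro run_pop) auto
  moreover have "run (push b False) (s(a := r)) 3 (s(a := r, b := False # s b))"
    using run_push[of 3 b False "s(a := r)"] assms by simp
  moreover have "run (pop t) (s(a := r, b := False # s b)) 1 ?s"
    using assms Leaf by (intro run_pop) auto
  ultimately have "run (pop a ;; push b False ;; pop t) s (Suc (1 + Suc (3 + 1))) ?s"
    by (intro run_seq')
  then have "run (Cond a {3} (pop a ;; push b True ;; push t True)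
      (pop a ;; push b False ;; pop t)) s 10 ?s"
    using Leaf by (intro run_CondF) (auto intro: run_mono)
  moreover have "run (parse_loop a b t) ?s n v"
    by (rule run_cong[OF Leaf.prems(3)]) (auto simp: fun_eq_iff)
  ultimately show ?case
    unfolding parse_loop_def by (rule run_LoopT[rotated]) (use Leaf in auto)
next
  case (Node d e)
  let ?s = "s(a := ser d @ ser e @ r, b := True # s b, t := True # s t)"
  have "run (pop a) s 1 (s(a := ser d @ ser e @ r))"
    using Node.prems by (intro run_pop) auto
  moreover have "run (push b True) (s(a := ser d @ ser e @ r)) 3
      (s(a := ser d @ ser e @ r, b := True # s b))"
    using run_push[of 3 b True "s(a := ser d @ ser e @ r)"] assms by simp
  moreover have "run (push t True) (s(a := ser d @ ser e @ r, b := True # s b)) 3 ?s"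
    using run_push[of 3 t True "s(a := ser d @ ser e @ r, b := True # s b)"] assms by simp
  ultimately have "run (pop a ;; push b True ;; push t True) s (Suc (1 + Suc (3 + 3))) ?s"
    by (intro run_seq')
  then have b: "run (Cond a {3} (pop a ;; push b True ;; push t True)
      (pop a ;; push b False ;; pop t)) s 10 ?s"
    using Node.prems by (intro run_CondT) auto
  let ?u = "?s(a := ser e @ r, b := rev (ser d) @ ?s b, t := s t)"
  have "run (parse_loop a b t) (?u(a := r, b := rev (ser e) @ ?u b, t := u)) n v"
    by (rule run_cong[OF Node.prems(3)]) (use assms in \<open>auto simp: fun_eq_iff\<close>)
  then have "run (parse_loop a b t) ?u (n + 11 * length (ser e)) v"
    by (rule Node.IH(2)[rotated -1]) (use assms Node.prems in auto)
  then have "run (parse_loop a b t) ?s (n + 11 * length (ser e) + 11 * length (ser d)) v"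
    by (rule Node.IH(1)[rotated -1]) (use assms in auto)
  with b show ?case
    unfolding parse_loop_def by (rule run_LoopT[rotated]) (use Node.prems in auto)
qed

lemma run_parse:
  assumes "a \<noteq> b" "a \<noteq> t" "b \<noteq> t" "s t = []" "s a = ser d @ r"
  shows "run (parse a b t) s (11 * length (ser d) + 5) (s(a := r, b := rev (ser d) @ s b))"
proof -
  let ?s = "s(t := True # s t)"
  have 1: "run (push t True) s 3 ?s" by (rule run_push) simp
  have "?s(a := r, b := rev (ser d) @ ?s b, t := []) = s(a := r, b := rev (ser d) @ s b)"
    using assms by (auto simp: fun_eq_iff)
  moreover have "run (parse_loop a b t) (?s(a := r, b := rev (ser d) @ ?s b, t := [])) 1
      (?s(a := r, b := rev (ser d) @ ?s b, t := []))"
    unfolding parse_loop_def by (rule run_LoopF) auto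
  ultimately have "run (parse_loop a b t) ?s (1 + 11 * length (ser d)) (s(a := r, b := rev (ser d) @ s b))"
    using assms by (intro run_parse_loop[where u = "[]"]) auto
  from run_seq'[OF 1 this] show ?thesis
    unfolding parse_def by (rule run_mono) simp
qed

section \<open>Encodable types and their sizes\<close>

class enc =
  fixes enc :: "'a \<Rightarrow> tree"
  assumes inj_enc: "enc x = enc y \<Longrightarrow> x = y"

lemma enc_eq_iff [simp]: "enc x = enc y \<longleftrightarrow> x = y"
  using inj_enc by auto

instantiation tree :: enc
begin
definition "enc_tree = (\<lambda>x::tree. x)"
instance by standard (simp add: enc_tree_def)
end

text \<open>\<open>True\<close> is a node and \<open>False\<close> a leaf, so a look at the top
  symbol of the serialization decides a condition.\<close>

instantiation bool :: enc
begin
definition "enc_bool b = (if b then Node Leaf Leaf else Leaf)"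
instance by standard (simp add: enc_bool_def split: if_splits)
end

instantiation prod :: (enc, enc) enc
begin
definition "enc_prod p = Node (enc (fst p)) (enc (snd p))"
instance by standard (auto simp: enc_prod_def prod_eq_iff)
end

text \<open>A nonempty list has the same tree as the pair of its head and its tail, so that the
  programs for pairs serve for lists.\<close>

instantiation list :: (enc) enc
begin
primrec enc_list where
  "enc_list [] = Leaf"
| "enc_list (x # xs) = Node (enc x) (enc_list xs)"
instance
proof
  fix xs ys :: "'a list"
  show "enc xs = enc ys \<Longrightarrow> xs = ys"
  proof (induction xs arbitrary: ys)
    case Nil
    then show ?case by (cases ys) auto
  next
    case (Cons x xs)
    then show ?case by (cases ys) auto
  qed
qed
end

definition sz :: "'a::enc \<Rightarrow> nat" where
  "sz x = length (ser (enc x))"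

lemma sz_simps [simp]:
  "sz Leaf = 1" "sz (Node a b) = 1 + sz a + sz b" "sz False = 1" "sz True = 3"
  "sz (x, y) = 1 + sz x + sz y" "sz [] = 1" "sz (x # xs) = 1 + sz x + sz xs"
  by (auto simp: sz_def enc_tree_def enc_bool_def enc_prod_def)

lemma sz_pos: "0 < sz x"
  by (simp add: sz_def)


section \<open>Closure of the class \<open>PT\<close> under composition, branching and bounded
  folds\<close>

section \<open>Polynomial-time functions on encodable types\<close>

text \<open>Bounds are polynomials with natural coefficients and therefore monotone. Composition
  needs this, since the size of an intermediate result is itself only bounded.\<close>

definition pbound :: "(nat \<Rightarrow> nat) \<Rightarrow> bool" where
  "pbound f \<longleftrightarrow> (\<exists>p. f = poly p)"

lemma pbound_const: "pbound (\<lambda>n. c)"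
  unfolding pbound_def by (rule exI[of _ "[:c:]"]) auto

lemma pbound_id: "pbound (\<lambda>n. n)"
  unfolding pbound_def by (rule exI[of _ "[:0, 1:]"]) auto

lemma pbound_add: "pbound f \<Longrightarrow> pbound g \<Longrightarrow> pbound (\<lambda>n. f n + g n)"
  unfolding pbound_def fun_eq_iff by (metis poly_add)

lemma pbound_mult: "pbound f \<Longrightarrow> pbound g \<Longrightarrow> pbound (\<lambda>n. f n * g n)"
  unfolding pbound_def fun_eq_iff by (metis poly_mult)

lemma pbound_comp: "pbound f \<Longrightarrow> pbound g \<Longrightarrow> pbound (\<lambda>n. f (g n))"
  unfolding pbound_def fun_eq_iff by (metis poly_pcompose)

lemma pbound_Suc: "pbound f \<Longrightarrow> pbound (\<lambda>n. Suc (f n))"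
  using pbound_add[OF pbound_const[of 1], of f] by simp

lemmas pbound_intros = pbound_const pbound_id pbound_add pbound_mult pbound_Suc

lemma poly_nat_mono: "m \<le> n \<Longrightarrow> poly p m \<le> poly p (n :: nat)"
  by (induction p) (auto intro!: add_mono mult_mono)

lemma pbound_mono: "pbound f \<Longrightarrow> m \<le> n \<Longrightarrow> f m \<le> f n"
  unfolding pbound_def using poly_nat_mono by blast

text \<open>
  The program may use the registers below \<open>k\<close>, which it leaves empty; all others may hold anything
  and are preserved. Programs are therefore combined by saving intermediate results in registers from
  \<open>k\<close> on.
\<close>

definition computes :: "com \<Rightarrow> nat \<Rightarrow> (nat \<Rightarrow> nat) \<Rightarrow> ('a::enc \<Rightarrow> 'b::enc) \<Rightarrow> bool" where
  "computes c k T f \<longleftrightarrow> pbound T \<and> 0 < k \<and> wfc k c \<and>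
     (\<forall>x. sz (f x) \<le> T (sz x) \<and>
       (\<forall>s. s 0 = ser (enc x) \<and> (\<forall>i\<in>{0<..<k}. s i = []) \<longrightarrow>
         run c s (T (sz x)) (s(0 := ser (enc (f x))))))"

definition PT :: "('a::enc \<Rightarrow> 'b::enc) \<Rightarrow> bool" where
  "PT f \<longleftrightarrow> (\<exists>c k T. computes c k T f)"

lemma computesD:
  assumes "computes c k T f"
  shows "pbound T" "0 < k" "wfc k c" "sz (f x) \<le> T (sz x)"
    "s 0 = ser (enc x) \<Longrightarrow> (\<And>i. 0 < i \<Longrightarrow> i < k \<Longrightarrow> s i = []) \<Longrightarrow>
       run c s (T (sz x)) (s(0 := ser (enc (f x))))"
  using assms unfolding computes_def by auto

lemma computesI:
  assumes "pbound T" "0 < k" "wfc k c" "\<And>x. sz (f x) \<le> T (sz x)"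
    "\<And>x s. s 0 = ser (enc x) \<Longrightarrow> (\<And>i. 0 < i \<Longrightarrow> i < k \<Longrightarrow> s i = []) \<Longrightarrow>
       run c s (T (sz x)) (s(0 := ser (enc (f x))))"
  shows "PT f"
  unfolding PT_def computes_def using assms
  by (intro exI[of _ c] exI[of _ k] exI[of _ T]) (auto simp: Ball_def)

lemma PT_size: "PT f \<Longrightarrow> \<exists>T. pbound T \<and> (\<forall>x. sz (f x) \<le> T (sz x))"
  unfolding PT_def computes_def by blast

text \<open>A program sees encodings only, so a function may be exchanged for one with the same
  encoded values, even if its result type is another.\<close>

lemma PT_cast: "PT f \<Longrightarrow> (\<And>x. enc (f x) = enc (g x)) \<Longrightarrow> PT g"
  unfolding PT_def computes_def sz_def by simp

lemma run_skip: "run (Move r Stay) s 1 s"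
proof -
  have "exec (Move r Stay) (stk \<circ> s) 1 (stk \<circ> s)"
    using exec_Move[of r Stay "stk \<circ> s"] by (simp only: act_stay fun_upd_triv)
  then show ?thesis unfolding run_def by blast
qed

lemma PT_enc: "PT (enc :: 'a::enc \<Rightarrow> tree)"
proof (rule computesI[where c = "Move 0 Stay" and k = 1 and T = "\<lambda>n. n + 1"])
  fix x :: 'a and s :: "nat \<Rightarrow> bool list"
  show "s 0 = ser (enc x) \<Longrightarrow> run (Move 0 Stay) s (sz x + 1) (s(0 := ser (enc (enc x))))"
    by (rule run_post[OF run_skip]) (auto simp: enc_tree_def fun_eq_iff)
qed (auto simp: enc_tree_def sz_def intro!: pbound_intros)

lemma PT_id: "PT (\<lambda>x. x)"
  by (rule PT_cast[OF PT_enc]) (simp add: enc_tree_def)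

lemma PT_comp:
  assumes "PT f" "PT g"
  shows "PT (\<lambda>x. f (g x))"
proof -
  obtain c k T where f: "computes c k T f" using assms(1) unfolding PT_def by blast
  obtain d l U where g: "computes d l U g" using assms(2) unfolding PT_def by blast
  note fD = computesD[OF f] note gD = computesD[OF g]
  show ?thesis
  proof (rule computesI[where c = "d ;; c" and k = "max k l" and T = "\<lambda>n. Suc (U n + T (U n))"])
    show "pbound (\<lambda>n. Suc (U n + T (U n)))"
      by (intro pbound_intros pbound_comp[OF fD(1)] gD(1))
    fix x
    \<comment> \<open>The size bound that is part of \<open>computes\<close> turns the time spent on
      \<open>g x\<close> into a polynomial in the size of \<open>x\<close>.\<close>
    have 1: "T (sz (g x)) \<le> T (U (sz x))"
      by (rule pbound_mono[OF fD(1) gD(4)])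
    then show "sz (f (g x)) \<le> Suc (U (sz x) + T (U (sz x)))"
      using fD(4)[of "g x"] by linarith
    fix s :: "nat \<Rightarrow> bool list"
    assume s: "s 0 = ser (enc x)" "\<And>i. 0 < i \<Longrightarrow> i < max k l \<Longrightarrow> s i = []"
    show "run (d ;; c) s (Suc (U (sz x) + T (U (sz x)))) (s(0 := ser (enc (f (g x)))))"
      by (rule run_post[OF run_seq'[OF gD(5)[of s x] fD(5)[of _ "g x"]]])
        (use s 1 in \<open>auto simp: fun_eq_iff\<close>)
  qed (use fD(2) gD(2) wfc_mono[OF fD(3), of "max k l"] wfc_mono[OF gD(3), of "max k l"] in auto)
qed

primrec push_list :: "nat \<Rightarrow> bool list \<Rightarrow> com" where
  "push_list r [] = Move r Stay"
| "push_list r (b # bs) = push_list r bs ;; push r b"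

lemma run_push_list: "run (push_list r bs) s (4 * length bs + 1) (s(r := bs @ s r))"
proof (induction bs)
  case Nil
  show ?case
    unfolding push_list.simps by (rule run_post[OF run_skip]) auto
next
  case (Cons b bs)
  show ?case
    by (rule run_post[OF run_seq'[OF Cons run_push[where n = 3 and r = r and b = b], folded push_list.simps]]) auto
qed

lemma wfc_push_list: "r < k \<Longrightarrow> wfc k (push_list r bs)"
  by (induction bs) (auto simp: push_def sym_def)

lemma wfc_basic [simp]:
  "wfc k (push r v) \<longleftrightarrow> r < k" "wfc k (pop r) \<longleftrightarrow> r < k" "wfc k (clear r) \<longleftrightarrow> r < k"
  "wfc k (mv a b) \<longleftrightarrow> a < k \<and> b < k" "wfc k (dup a b t) \<longleftrightarrow> a < k \<and> b < k \<and> t < k"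
  "wfc k (parse a b t) \<longleftrightarrow> a < k \<and> b < k \<and> t < k"
  by (auto simp: push_def pop_def clear_def mv_def dup_def parse_def parse_loop_def sym_def)

lemma PT_const: "PT (\<lambda>x::'a::enc. c)"
proof (rule computesI[where c = "clear 0 ;; push_list 0 (ser (enc c))" and k = 1 and
      T = "\<lambda>n. 2 * n + (4 * sz c + 3)"])
  fix x :: 'a and s :: "nat \<Rightarrow> bool list"
  assume "s 0 = ser (enc x)"
  then show "run (clear 0 ;; push_list 0 (ser (enc c))) s (2 * sz x + (4 * sz c + 3)) (s(0 := ser (enc c)))"
    by (intro run_post[OF run_seq'[OF run_clear run_push_list]]) (auto simp: sz_def)
qed (auto intro!: pbound_intros simp: wfc_push_list)

lemma PT_Pair:
  assumes "PT f" "PT g"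
  shows "PT (\<lambda>x. (f x, g x))"
proof -
  obtain c k T where f: "computes c k T f" using assms(1) unfolding PT_def by blast
  obtain d l U where g: "computes d l U g" using assms(2) unfolding PT_def by blast
  note fD = computesD[OF f] note gD = computesD[OF g]
  define m where "m = max k l"
  have m: "0 < m" "k \<le> m" "l \<le> m" using fD(2) by (auto simp: m_def)
  \<comment> \<open>The value \<open>f x\<close> waits reversed in register \<open>m + 1\<close>.
    The last move puts it in order on top of \<open>g x\<close>, and the pushed \<open>True\<close>
    joins the two into a node.\<close>
  let ?c = "dup 0 m (m + 1) ;; c ;; mv 0 (m + 1) ;; mv m (m + 2) ;; mv (m + 2) 0 ;; d ;;
    mv (m + 1) 0 ;; push 0 True"
  let ?T = "\<lambda>n. 32 * n + 15 * T n + U n + 25"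
  show ?thesis
  proof (rule computesI[where c = ?c and k = "m + 3" and T = ?T])
    show "pbound ?T"
      by (intro pbound_intros fD(1) gD(1))
    fix x
    note sz = fD(4)[of x] gD(4)[of x]
    then show "sz (f x, g x) \<le> ?T (sz x)" by simp
    fix s :: "nat \<Rightarrow> bool list"
    assume s: "s 0 = ser (enc x)" "\<And>i. 0 < i \<Longrightarrow> i < m + 3 \<Longrightarrow> s i = []"
    let ?X = "ser (enc x)" let ?F = "ser (enc (f x))" let ?G = "ser (enc (g x))"
    let ?s1 = "s(m := ?X)"
    let ?s2 = "?s1(0 := ?F)"
    let ?s3 = "?s2(0 := [], m + 1 := rev ?F)"
    let ?s4 = "?s3(m := [], m + 2 := rev ?X)"
    let ?s5 = "?s4(m + 2 := [], 0 := ?X)"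
    let ?s6 = "?s5(0 := ?G)"
    let ?s7 = "?s6(m + 1 := [], 0 := ?F @ ?G)"
    have 1: "run (dup 0 m (m + 1)) s (18 * sz x + 3) ?s1"
      by (rule run_post[OF run_dup]) (use s m in \<open>auto simp: sz_def\<close>)
    have 2: "run c ?s1 (T (sz x)) ?s2"
      by (rule fD(5)) (use s m in auto)
    have 3: "run (mv 0 (m + 1)) ?s2 (7 * sz (f x) + 1) ?s3"
      by (rule run_post[OF run_mv]) (use s m in \<open>auto simp: sz_def fun_eq_iff\<close>)
    have 4: "run (mv m (m + 2)) ?s3 (7 * sz x + 1) ?s4"
      by (rule run_post[OF run_mv]) (use s m in \<open>auto simp: sz_def fun_eq_iff\<close>)
    have 5: "run (mv (m + 2) 0) ?s4 (7 * sz x + 1) ?s5"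
      by (rule run_post[OF run_mv]) (use s m in \<open>auto simp: sz_def fun_eq_iff\<close>)
    have 6: "run d ?s5 (U (sz x)) ?s6"
      by (rule gD(5)) (use s m in auto)
    have 7: "run (mv (m + 1) 0) ?s6 (7 * sz (f x) + 1) ?s7"
      by (rule run_post[OF run_mv]) (use s m in \<open>auto simp: sz_def fun_eq_iff\<close>)
    have 8: "run (push 0 True) ?s7 3 (?s7(0 := True # ?s7 0))"
      by (rule run_push) simp
    show "run ?c s (?T (sz x)) (s(0 := ser (enc (f x, g x))))"
      by (rule run_post[OF run_seq'[OF 1 run_seq'[OF 2 run_seq'[OF 3 run_seq'[OF 4
          run_seq'[OF 5 run_seq'[OF 6 run_seq'[OF 7 8]]]]]]]])
        (use s m sz in \<open>auto simp: fun_eq_iff enc_prod_def\<close>)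
  qed (use m wfc_mono[OF fD(3), of "m + 3"] wfc_mono[OF gD(3), of "m + 3"] in auto)
qed

lemma PT_If:
  assumes "PT b" "PT f" "PT g"
  shows "PT (\<lambda>x. if b x then f x else g x)"
proof -
  obtain c k T where f: "computes c k T f" using assms(2) unfolding PT_def by blast
  obtain d l U where g: "computes d l U g" using assms(3) unfolding PT_def by blast
  obtain e j V where b: "computes e j V b" using assms(1) unfolding PT_def by blast
  note fD = computesD[OF f] note gD = computesD[OF g] note bD = computesD[OF b]
  define m where "m = max j (max k l)"
  have m: "0 < m" "k \<le> m" "l \<le> m" "j \<le> m" using bD(2) by (auto simp: m_def)
  \<comment> \<open>Discards the truth value and brings the saved argument back to register
    0.\<close>
  let ?r = "clear 0 ;; mv m (m + 1) ;; mv (m + 1) 0"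
  let ?c = "dup 0 m (m + 1) ;; e ;; Cond 0 {3} (?r ;; c) (?r ;; d)"
  let ?T = "\<lambda>n. 32 * n + T n + U n + V n + 25"
  show ?thesis
  proof (rule computesI[where c = ?c and k = "m + 3" and T = ?T])
    show "pbound ?T"
      by (intro pbound_intros fD(1) gD(1) bD(1))
    fix x
    show "sz (if b x then f x else g x) \<le> ?T (sz x)"
      using fD(4)[of x] gD(4)[of x] by simp
    fix s :: "nat \<Rightarrow> bool list"
    assume s: "s 0 = ser (enc x)" "\<And>i. 0 < i \<Longrightarrow> i < m + 3 \<Longrightarrow> s i = []"
    let ?X = "ser (enc x)"
    let ?s1 = "s(m := ?X)"
    let ?s2 = "?s1(0 := ser (enc (b x)))"
    let ?s3 = "?s2(0 := [])"
    let ?s4 = "?s3(m := [], m + 1 := rev ?X)"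
    let ?s5 = "?s4(m + 1 := [], 0 := ?X)"
    have 1: "run (dup 0 m (m + 1)) s (18 * sz x + 3) ?s1"
      by (rule run_post[OF run_dup]) (use s m in \<open>auto simp: sz_def\<close>)
    have 2: "run e ?s1 (V (sz x)) ?s2"
      by (rule bD(5)) (use s m in auto)
    have 3: "run (clear 0) ?s2 7 ?s3"
      by (rule run_post[OF run_clear]) (auto simp: enc_bool_def)
    have 4: "run (mv m (m + 1)) ?s3 (7 * sz x + 1) ?s4"
      by (rule run_post[OF run_mv]) (use s m in \<open>auto simp: sz_def fun_eq_iff\<close>)
    have 5: "run (mv (m + 1) 0) ?s4 (7 * sz x + 1) ?s5"
      by (rule run_post[OF run_mv]) (use s m in \<open>auto simp: sz_def fun_eq_iff\<close>)
    note r = run_seq'[OF 3 run_seq'[OF 4 5]]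
    let ?n = "14 * sz x + 11 + T (sz x) + U (sz x) + 3"
    have 6: "run (?r ;; c) ?s2 ?n (s(0 := ser (enc (f x))))"
      by (rule run_post[OF run_seq'[OF run_seq'[OF 3 run_seq'[OF 4 5]] fD(5)[of ?s5 x]]])
        (use s m in \<open>auto simp: fun_eq_iff\<close>)
    have 7: "run (?r ;; d) ?s2 ?n (s(0 := ser (enc (g x))))"
      by (rule run_post[OF run_seq'[OF run_seq'[OF 3 run_seq'[OF 4 5]] gD(5)[of ?s5 x]]])
        (use s m in \<open>auto simp: fun_eq_iff\<close>)
    have 8: "run (Cond 0 {3} (?r ;; c) (?r ;; d)) ?s2 (Suc ?n)
        (s(0 := ser (enc (if b x then f x else g x))))"
    proof (cases "b x")
      case True
      then show ?thesis
        unfolding if_P[OF True] by (intro run_CondT[OF _ 6]) (auto simp: enc_bool_def)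
    next
      case False
      then show ?thesis
        unfolding if_not_P[OF False] by (intro run_CondF[OF _ 7]) (auto simp: enc_bool_def)
    qed
    show "run ?c s (?T (sz x)) (s(0 := ser (enc (if b x then f x else g x))))"
      by (rule run_mono[OF run_seq'[OF 1 run_seq'[OF 2 8]]]) simp
  qed (use m wfc_mono[OF fD(3), of "m + 3"] wfc_mono[OF gD(3), of "m + 3"]
      wfc_mono[OF bD(3), of "m + 3"] in auto)
qed

primrec left :: "tree \<Rightarrow> tree" where
  "left Leaf = Leaf" | "left (Node a b) = a"

primrec right :: "tree \<Rightarrow> tree" where
  "right Leaf = Leaf" | "right (Node a b) = b"

lemma PT_left: "PT left"
proof (rule computesI[where c = "Cond 0 {3} (pop 0 ;; parse 0 1 2 ;; clear 0 ;; mv 1 0) (Move 0 Stay)"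
      and k = 3 and T = "\<lambda>n. 20 * n + 15"])
  fix x :: tree
  show "sz (left x) \<le> 20 * sz x + 15" by (cases x) auto
  fix s :: "nat \<Rightarrow> bool list"
  assume s: "s 0 = ser (enc x)" "\<And>i. 0 < i \<Longrightarrow> i < 3 \<Longrightarrow> s i = []"
  show "run (Cond 0 {3} (pop 0 ;; parse 0 1 2 ;; clear 0 ;; mv 1 0) (Move 0 Stay)) s (20 * sz x + 15)
          (s(0 := ser (enc (left x))))"
  proof (cases x)
    case Leaf
    show ?thesis
      by (rule run_CondF[OF _ run_post[OF run_skip le_refl]])
        (use Leaf s in \<open>auto simp: enc_tree_def fun_eq_iff\<close>)
  next
    case (Node a b)
    have 1: "run (pop 0) s 1 (s(0 := ser a @ ser b))"
      using run_pop[of s 0 True _ 1] s Node by (simp add: enc_tree_def)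
    have 2: "run (parse 0 1 2) (s(0 := ser a @ ser b)) (11 * length (ser a) + 5)
        (s(0 := ser b, 1 := rev (ser a)))"
      by (rule run_post[OF run_parse]) (use s in \<open>auto simp: fun_eq_iff\<close>)
    have 3: "run (clear 0) (s(0 := ser b, 1 := rev (ser a))) (2 * length (ser b) + 1)
        (s(0 := [], 1 := rev (ser a)))"
      by (rule run_post[OF run_clear]) (use s in \<open>auto simp: fun_eq_iff\<close>)
    have 4: "run (mv 1 0) (s(0 := [], 1 := rev (ser a))) (7 * length (ser a) + 1) (s(0 := ser a))"
      by (rule run_post[OF run_mv]) (use s in \<open>auto simp: fun_eq_iff\<close>)
    show ?thesis
      by (rule run_CondT[OF _ run_post[OF run_seq'[OF 1 run_seq'[OF 2 run_seq'[OF 3 4]]] le_refl]])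
        (use s Node in \<open>auto simp: enc_tree_def sz_def\<close>)
  qed
qed (auto intro!: pbound_intros)

lemma PT_right: "PT right"
proof (rule computesI[where c = "Cond 0 {3} (pop 0 ;; parse 0 1 2 ;; clear 1) (Move 0 Stay)"
      and k = 3 and T = "\<lambda>n. 20 * n + 15"])
  fix x :: tree
  show "sz (right x) \<le> 20 * sz x + 15" by (cases x) auto
  fix s :: "nat \<Rightarrow> bool list"
  assume s: "s 0 = ser (enc x)" "\<And>i. 0 < i \<Longrightarrow> i < 3 \<Longrightarrow> s i = []"
  show "run (Cond 0 {3} (pop 0 ;; parse 0 1 2 ;; clear 1) (Move 0 Stay)) s (20 * sz x + 15)
          (s(0 := ser (enc (right x))))"
  proof (cases x)
    case Leaf
    show ?thesis
      by (rule run_CondF[OF _ run_post[OF run_skip le_refl]])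
        (use Leaf s in \<open>auto simp: enc_tree_def fun_eq_iff\<close>)
  next
    case (Node a b)
    have 1: "run (pop 0) s 1 (s(0 := ser a @ ser b))"
      using run_pop[of s 0 True _ 1] s Node by (simp add: enc_tree_def)
    have 2: "run (parse 0 1 2) (s(0 := ser a @ ser b)) (11 * length (ser a) + 5)
        (s(0 := ser b, 1 := rev (ser a)))"
      by (rule run_post[OF run_parse]) (use s in \<open>auto simp: fun_eq_iff\<close>)
    have 3: "run (clear 1) (s(0 := ser b, 1 := rev (ser a))) (2 * length (ser a) + 1) (s(0 := ser b))"
      by (rule run_post[OF run_clear]) (use s in \<open>auto simp: fun_eq_iff\<close>)
    show ?thesis
      by (rule run_CondT[OF _ run_post[OF run_seq'[OF 1 run_seq'[OF 2 3]] le_refl]])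
        (use s Node in \<open>auto simp: enc_tree_def sz_def\<close>)
  qed
qed (auto intro!: pbound_intros)

lemma PT_fst: "PT f \<Longrightarrow> PT (\<lambda>x. fst (f x))"
  by (rule PT_cast[OF PT_comp[OF PT_left PT_comp[OF PT_enc]]]) (auto simp: enc_prod_def enc_tree_def)

lemma PT_snd: "PT f \<Longrightarrow> PT (\<lambda>x. snd (f x))"
  by (rule PT_cast[OF PT_comp[OF PT_right PT_comp[OF PT_enc]]]) (auto simp: enc_prod_def enc_tree_def)

lemma head_stk_eq_1 [simp]: "head_symbol (stk xs) = Suc 0 \<longleftrightarrow> xs = []"
  by (cases xs) (auto simp: sym_def)

text \<open>Each letter popped from register 0 either cancels an equal letter on top of register 2
  or leaves a mark in register 3. Marks are never removed, so the two words were equal iff registers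
  2 and 3 end empty, provided 3 was empty before.\<close>

definition eq_loop :: com where
  "eq_loop = Loop 0 {2, 3} (Cond 0 {3} (pop 0 ;; Cond 2 {3} (pop 2) (push 3 True))
     (pop 0 ;; Cond 2 {2} (pop 2) (push 3 True)))"

lemma run_eq_loop:
  "\<exists>y z. run eq_loop s (8 * length (s 0) + 1) (s(0 := [], 2 := y, 3 := z)) \<and>
     length y \<le> length (s 2) \<and> length z \<le> length (s 0) + length (s 3) \<and>
     (y = [] \<and> z = [] \<longleftrightarrow> s 0 = s 2 \<and> s 3 = [])"
proof (induction "s 0" arbitrary: s)
  case Nil
  have "run eq_loop s (8 * length (s 0) + 1) (s(0 := [], 2 := s 2, 3 := s 3))"
    unfolding eq_loop_def
    by (rule run_post[OF run_LoopF[where k = 1]])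
      (use Nil[symmetric] in \<open>auto simp: fun_eq_iff\<close>)
  moreover have "s 2 = [] \<and> s 3 = [] \<longleftrightarrow> s 0 = s 2 \<and> s 3 = []" using Nil by auto
  ultimately show ?case by (meson le_refl le_add2)
next
  case (Cons x xs)
  have p: "run (pop 0) s 1 (s(0 := xs))"
    using run_pop[of s 0 x xs 1] Cons(2) by simp
  define s' where "s' = (if (\<exists>ys. s 2 = x # ys) then s(0 := xs, 2 := tl (s 2))
    else s(0 := xs, 3 := True # s 3))"
  have *: "run (Cond 2 {sym x} (pop 2) (push 3 True)) (s(0 := xs)) 4 s'"
  proof (cases "\<exists>ys. s 2 = x # ys")
    case True
    then obtain ys where ys: "s 2 = x # ys" by blast
    then have "run (pop 2) (s(0 := xs)) 1 s'"
      using run_pop[of "s(0 := xs)" 2 x ys 1] by (simp add: s'_def)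
    then show ?thesis
      by (rule run_CondT[rotated]) (use ys in auto)
  next
    case False
    have "run (push 3 True) (s(0 := xs)) 3 s'"
      by (rule run_post[OF run_push]) (use False in \<open>auto simp: s'_def\<close>)
    then show ?thesis
      by (rule run_CondF[rotated]) (simp, use False in \<open>cases "s 2"; auto simp: sym_def split: if_splits\<close>)
  qed
  have b: "run (Cond 0 {3} (pop 0 ;; Cond 2 {3} (pop 2) (push 3 True))
     (pop 0 ;; Cond 2 {2} (pop 2) (push 3 True))) s 7 s'"
  proof (cases x)
    case True
    then show ?thesis using run_seq'[OF p *]
      by (intro run_CondT) (auto simp: sym_def simp flip: Cons(2))
  next
    case False
    then show ?thesis using run_seq'[OF p *]
      by (intro run_CondF) (auto simp: sym_def simp flip: Cons(2))
  qed
  have "xs = s' 0" by (auto simp: s'_def)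
  with Cons(1)[of s'] obtain y z where yz:
    "run eq_loop s' (8 * length (s' 0) + 1) (s'(0 := [], 2 := y, 3 := z))"
    "length y \<le> length (s' 2)" "length z \<le> length (s' 0) + length (s' 3)"
    "(y = [] \<and> z = []) = (s' 0 = s' 2 \<and> s' 3 = [])" by blast
  have "run eq_loop s (8 * length (s 0) + 1) (s'(0 := [], 2 := y, 3 := z))"
    unfolding eq_loop_def
    by (rule run_LoopT[OF _ b yz(1)[unfolded eq_loop_def]]) (auto simp: s'_def simp flip: Cons(2))
  moreover have "s'(0 := [], 2 := y, 3 := z) = s(0 := [], 2 := y, 3 := z)"
    by (auto simp: s'_def fun_eq_iff)
  moreover have "length y \<le> length (s 2)" "length z \<le> length (s 0) + length (s 3)"
    using yz(2,3) by (auto simp: s'_def simp flip: Cons(2) split: if_splits)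
  moreover have "(y = [] \<and> z = []) = (s 0 = s 2 \<and> s 3 = [])"
    unfolding yz(4) using Cons(2) by (cases "s 2") (auto simp: s'_def)
  ultimately show ?case by (intro exI[of _ y] exI[of _ z] conjI) (simp only:)+
qed

lemma PT_eq_pair: "PT (\<lambda>p. fst p = (snd p :: 'a::enc))"
proof -
  let ?e = "Cond 2 {1} (Cond 3 {1} (push 0 False ;; push 0 False ;; push 0 True)
      (clear 3 ;; push 0 False)) (clear 2 ;; clear 3 ;; push 0 False)"
  let ?c = "pop 0 ;; parse 0 1 2 ;; mv 1 2 ;; eq_loop ;; ?e"
  show ?thesis
  proof (rule computesI[where c = ?c and k = 4 and T = "\<lambda>n. 50 * n + 50"])
    fix p :: "'a \<times> 'a"
    show "sz (fst p = snd p) \<le> 50 * sz p + 50"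
      by (cases "fst p = snd p") auto
    fix s :: "nat \<Rightarrow> bool list"
    assume s: "s 0 = ser (enc p)" "\<And>i. 0 < i \<Longrightarrow> i < 4 \<Longrightarrow> s i = []"
    obtain a b where p: "p = (a, b)" by (cases p)
    let ?s1 = "s(0 := ser (enc a) @ ser (enc b))"
    let ?s2 = "s(0 := ser (enc b), 1 := rev (ser (enc a)))"
    let ?s3 = "s(0 := ser (enc b), 2 := ser (enc a))"
    have 1: "run (pop 0) s 1 ?s1"
      using run_pop[of s 0 True _ 1] s p by (simp add: enc_prod_def)
    have 2: "run (parse 0 1 2) ?s1 (11 * sz a + 5) ?s2"
      by (rule run_post[OF run_parse]) (use s in \<open>auto simp: fun_eq_iff sz_def\<close>)
    have 3: "run (mv 1 2) ?s2 (7 * sz a + 1) ?s3"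
      by (rule run_post[OF run_mv]) (use s in \<open>auto simp: fun_eq_iff sz_def\<close>)
    from run_eq_loop[of ?s3] s obtain y z where yz:
      "run eq_loop ?s3 (8 * sz b + 1) (?s3(0 := [], 2 := y, 3 := z))"
      "length y \<le> sz a" "length z \<le> sz b"
      "y = [] \<and> z = [] \<longleftrightarrow> a = b"
      by (auto simp: sz_def)
    let ?s4 = "?s3(0 := [], 2 := y, 3 := z)"
    let ?s5 = "s(0 := ser (enc (a = b)))"
    have 5: "run ?e ?s4 (2 * sz a + 2 * sz b + 20) ?s5"
    proof (cases "y = []")
      case y: True
      show ?thesis
      proof (cases "z = []")
        case True
        have "run (push 0 False ;; push 0 False ;; push 0 True) ?s4 11 ?s5"
          by (rule run_post[OF run_seq'[OF run_push[where n = 3]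
                run_seq'[OF run_push[where n = 3] run_push[where n = 3]]]])
            (use True y yz s in \<open>auto simp: fun_eq_iff enc_bool_def\<close>)
        then have "run (Cond 3 {1} (push 0 False ;; push 0 False ;; push 0 True)
            (clear 3 ;; push 0 False)) ?s4 12 ?s5"
          by (rule run_CondT[rotated]) (use True in auto)
        then show ?thesis
          by (rule run_CondT[rotated]) (use y in auto)
      next
        case False
        then have ab: "a \<noteq> b" using yz by blast
        have "run (clear 3 ;; push 0 False) ?s4 (Suc (2 * length (?s4 3) + 1 + 3)) ?s5"
          by (rule run_post[OF run_seq'[OF run_clear run_push[where n = 3]]])
            (use ab y s in \<open>auto simp: fun_eq_iff enc_bool_def\<close>)
        then have "run (Cond 3 {1} (push 0 False ;; push 0 False ;; push 0 True)
            (clear 3 ;; push 0 False)) ?s4 (2 * sz b + 6) ?s5"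
          by (rule run_CondF[rotated]) (use False yz(3) in auto)
        then show ?thesis
          by (rule run_CondT[rotated]) (use y in auto)
      qed
    next
      case False
      then have ab: "a \<noteq> b" using yz by blast
      have "run (clear 2 ;; clear 3 ;; push 0 False) ?s4 (2 * sz a + 2 * sz b + 10) ?s5"
        by (rule run_post[OF run_seq'[OF run_clear run_seq'[OF run_clear run_push[where n = 3]]]])
          (use ab s yz in \<open>auto simp: fun_eq_iff enc_bool_def\<close>)
      then show ?thesis
        by (rule run_CondF[rotated]) (use False in auto)
    qed
    show "run ?c s (50 * sz p + 50) (s(0 := ser (enc (fst p = snd p))))"
      by (rule run_post[OF run_seq'[OF 1 run_seq'[OF 2 run_seq'[OF 3 run_seq'[OF yz(1) 5]]]]])
        (auto simp: p)
  qed (auto intro!: pbound_intros simp: eq_loop_def)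
qed

lemma PT_eq:
  assumes "PT f" "PT g"
  shows "PT (\<lambda>x. f x = g x)"
  using PT_comp[OF PT_eq_pair PT_Pair[OF assms]] by simp

text \<open>The serialized rest of the list in register \<open>m + 1\<close> starts with
  \<open>True\<close> as long as it is nonempty. A round parses off its head and puts it in front of
  the accumulator in register 0, where the pushed \<open>True\<close> makes a pair of the
  two.\<close>

definition fold_loop :: "nat \<Rightarrow> com \<Rightarrow> com" where
  "fold_loop m c = Loop (m + 1) {3}
     (pop (m + 1) ;; parse (m + 1) m (m + 2) ;; mv m 0 ;; push 0 True ;; c)"

text \<open>\<open>B\<close> bounds the accumulator after every prefix, because the body runs on
  each of these values. As in Cobham's bounded recursion, this keeps iteration polynomial. Parsing
  and moving an element account for the factor 11 + 7 = 18.\<close>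

lemma run_fold_loop:
  assumes c: "computes c k T h" and m: "0 < m" "k \<le> m"
  shows "s 0 = ser (enc a) \<Longrightarrow> s (m + 1) = ser (enc xs) \<Longrightarrow>
    (\<And>i. 0 < i \<Longrightarrow> i < m + 3 \<Longrightarrow> i \<noteq> m + 1 \<Longrightarrow> s i = []) \<Longrightarrow>
    (\<And>ys zs. xs = ys @ zs \<Longrightarrow> sz (fold (\<lambda>e a. h (e, a)) ys a) \<le> B) \<Longrightarrow> sz xs \<le> N \<Longrightarrow>
    run (fold_loop m c) s (length xs * (18 * N + T (1 + N + B) + 30) + 1)
      (s(0 := ser (enc (fold (\<lambda>e a. h (e, a)) xs a)), m + 1 := [False]))"
proof (induction xs arbitrary: s a)
  case Nil
  show ?case unfolding fold_loop_def
    by (rule run_post[OF run_LoopF[where k = 1]]) (use Nil in \<open>auto simp: fun_eq_iff\<close>)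
next
  case (Cons x xs)
  let ?s1 = "s(m + 1 := ser (enc x) @ ser (enc xs))"
  let ?s2 = "s(m + 1 := ser (enc xs), m := rev (ser (enc x)))"
  let ?s3 = "s(m + 1 := ser (enc xs), 0 := ser (enc x) @ ser (enc a))"
  let ?s4 = "s(m + 1 := ser (enc xs), 0 := ser (enc (x, a)))"
  let ?s5 = "s(m + 1 := ser (enc xs), 0 := ser (enc (h (x, a))))"
  have sm: "s m = []" "s (m + 2) = []" using Cons.prems(3) m by auto
  have 1: "run (pop (m + 1)) s 1 ?s1"
    by (rule run_post[OF run_pop[of _ _ True]]) (use Cons.prems(2) in auto)
  have 2: "run (parse (m + 1) m (m + 2)) ?s1 (11 * sz x + 5) ?s2"
    by (rule run_post[OF run_parse]) (use sm in \<open>auto simp: fun_eq_iff sz_def\<close>)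
  have 3: "run (mv m 0) ?s2 (7 * sz x + 1) ?s3"
    by (rule run_post[OF run_mv]) (use sm m Cons.prems in \<open>auto simp: fun_eq_iff sz_def\<close>)
  have 4: "run (push 0 True) ?s3 3 ?s4"
    by (rule run_post[OF run_push]) (use m in \<open>auto simp: fun_eq_iff enc_prod_def\<close>)
  have 5: "run c ?s4 (T (sz (x, a))) ?s5"
    by (rule run_post[OF computesD(5)[OF c, of _ "(x, a)"]])
      (use m Cons.prems in \<open>auto simp: fun_eq_iff\<close>)
  have a: "sz a \<le> B" using Cons.prems(4)[of "[]"] by simp
  have N: "1 + sz x + sz xs \<le> N" using Cons.prems(5) by simp
  have T: "T (sz (x, a)) \<le> T (1 + N + B)"
    by (rule pbound_mono[OF computesD(1)[OF c]]) (use a N in simp)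
  have 6: "run (fold_loop m c) ?s5 (length xs * (18 * N + T (1 + N + B) + 30) + 1)
      (?s5(0 := ser (enc (fold (\<lambda>e a. h (e, a)) xs (h (x, a)))), m + 1 := [False]))"
  proof (rule Cons.IH)
    fix ys zs assume "xs = ys @ zs"
    then show "sz (fold (\<lambda>e a. h (e, a)) ys (h (x, a))) \<le> B"
      using Cons.prems(4)[of "x # ys" zs] by simp
  qed (use Cons.prems N m in auto)
  show ?case
    by (rule run_post[OF run_LoopT[OF _ run_seq'[OF 1 run_seq'[OF 2 run_seq'[OF 3 run_seq'[OF 4 5]]]]
            6[unfolded fold_loop_def] le_refl, folded fold_loop_def]])
      (use Cons.prems N T in \<open>auto simp: fun_eq_iff algebra_simps\<close>)
qed

lemma PT_fold_pair:
  assumes "PT h" "PT g" "pbound B"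
    and B: "\<And>x ys zs. fst (g x) = ys @ zs \<Longrightarrow> sz (fold (\<lambda>e a. h (e, a)) ys (snd (g x))) \<le> B (sz x)"
  shows "PT (\<lambda>x. fold (\<lambda>e a. h (e, a)) (fst (g x)) (snd (g x)))"
proof -
  obtain c k T where h: "computes c k T h" using assms(1) unfolding PT_def by blast
  obtain d l U where g: "computes d l U g" using assms(2) unfolding PT_def by blast
  note hD = computesD[OF h] note gD = computesD[OF g]
  define m where "m = max k l"
  have m: "0 < m" "k \<le> m" "l \<le> m" using hD(2) by (auto simp: m_def)
  let ?c = "d ;; pop 0 ;; parse 0 m (m + 2) ;; mv m (m + 1) ;; fold_loop m c ;; pop (m + 1)"
  let ?T = "\<lambda>n. U n + 18 * U n + (U n * (18 * U n + T (1 + U n + B n) + 30)) + B n + 30"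
  show ?thesis
  proof (rule computesI[where c = ?c and k = "m + 3" and T = ?T])
    show "pbound ?T"
      by (intro pbound_intros pbound_comp[OF hD(1)] gD(1) assms(3))
    fix x
    show "sz (fold (\<lambda>e a. h (e, a)) (fst (g x)) (snd (g x))) \<le> ?T (sz x)"
      using B[of x "fst (g x)" "[]"] by simp
    fix s :: "nat \<Rightarrow> bool list"
    assume s: "s 0 = ser (enc x)" "\<And>i. 0 < i \<Longrightarrow> i < m + 3 \<Longrightarrow> s i = []"
    obtain xs a where gx: "g x = (xs, a)" by (cases "g x")
    have U: "1 + sz xs + sz a \<le> U (sz x)" using gD(4)[of x] gx by simp
    have len: "length xs \<le> U (sz x)"
    proof -
      have "length xs \<le> sz xs" by (induction xs) auto
      then show ?thesis using U by simp
    qed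
    let ?s1 = "s(0 := ser (enc (g x)))"
    let ?s2 = "s(0 := ser (enc xs) @ ser (enc a))"
    let ?s3 = "s(0 := ser (enc a), m := rev (ser (enc xs)))"
    let ?s4 = "s(0 := ser (enc a), m + 1 := ser (enc xs))"
    let ?r = "fold (\<lambda>e a. h (e, a)) xs a"
    let ?s5 = "s(0 := ser (enc ?r), m + 1 := [False])"
    have 1: "run d s (U (sz x)) ?s1"
      by (rule gD(5)) (use s m in auto)
    have 2: "run (pop 0) ?s1 1 ?s2"
      by (rule run_post[OF run_pop[of _ _ True]]) (auto simp: gx enc_prod_def)
    have 3: "run (parse 0 m (m + 2)) ?s2 (11 * sz xs + 5) ?s3"
      by (rule run_post[OF run_parse]) (use s m in \<open>auto simp: fun_eq_iff sz_def\<close>)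
    have 4: "run (mv m (m + 1)) ?s3 (7 * sz xs + 1) ?s4"
      by (rule run_post[OF run_mv]) (use s m in \<open>auto simp: fun_eq_iff sz_def\<close>)
    have 5: "run (fold_loop m c) ?s4
        (length xs * (18 * U (sz x) + T (1 + U (sz x) + B (sz x)) + 30) + 1)
        (?s4(0 := ser (enc ?r), m + 1 := [False]))"
    proof (rule run_fold_loop[OF h m(1,2)])
      fix ys zs assume "xs = ys @ zs"
      then show "sz (fold (\<lambda>e a. h (e, a)) ys a) \<le> B (sz x)"
        using B[of x ys zs] gx by simp
    qed (use s m U in auto)
    have 6: "run (pop (m + 1)) (?s4(0 := ser (enc ?r), m + 1 := [False])) 1 (s(0 := ser (enc ?r)))"
      by (rule run_post[OF run_pop[of _ _ False]]) (use s m in \<open>auto simp: fun_eq_iff\<close>)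
    have "length xs * (18 * U (sz x) + T (1 + U (sz x) + B (sz x)) + 30) \<le>
        U (sz x) * (18 * U (sz x) + T (1 + U (sz x) + B (sz x)) + 30)"
      using len by (rule mult_right_mono) simp
    then show "run ?c s (?T (sz x)) (s(0 := ser (enc (fold (\<lambda>e a. h (e, a)) (fst (g x)) (snd (g x))))))"
      by (intro run_post[OF run_seq'[OF 1 run_seq'[OF 2 run_seq'[OF 3 run_seq'[OF 4 run_seq'[OF 5 6]]]]]])
        (use U in linarith, simp add: gx)
  qed (use m wfc_mono[OF hD(3), of "m + 3"] wfc_mono[OF gD(3), of "m + 3"] in \<open>auto simp: fold_loop_def\<close>)
qed

text \<open>The program for the body sees only an element and the accumulator. The argument
  \<open>x\<close> therefore travels inside the accumulator, which adds \<open>1 + n\<close> to its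
  bound.\<close>

lemma PT_fold:
  fixes h :: "'x::enc \<Rightarrow> 'e::enc \<Rightarrow> 'a::enc \<Rightarrow> 'a"
  assumes h: "PT (\<lambda>p. h (fst p) (fst (snd p)) (snd (snd p)))" and l: "PT l" and a: "PT a"
    and B: "pbound B" "\<And>x ys zs. l x = ys @ zs \<Longrightarrow> sz (fold (h x) ys (a x)) \<le> B (sz x)"
  shows "PT (\<lambda>x. fold (h x) (l x) (a x))"
proof -
  define h' :: "'e \<times> 'x \<times> 'a \<Rightarrow> 'x \<times> 'a" where
    "h' = (\<lambda>p. (fst (snd p), h (fst (snd p)) (fst p) (snd (snd p))))"
  have "PT (\<lambda>p::'e \<times> 'x \<times> 'a. (fst (snd p), fst p, snd (snd p)))"
    by (intro PT_Pair PT_fst PT_snd PT_id)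
  from PT_comp[OF h this] have h': "PT h'"
    unfolding h'_def by (intro PT_Pair PT_fst PT_snd PT_id) simp
  have f: "fold (\<lambda>e a. h' (e, a)) ys (x, b) = (x, fold (h x) ys b)" for ys x b
    by (induction ys arbitrary: b) (auto simp: h'_def)
  have "PT (\<lambda>x. fold (\<lambda>e a. h' (e, a)) (fst (l x, x, a x)) (snd (l x, x, a x)))"
    by (rule PT_fold_pair[OF h', where B = "\<lambda>n. 1 + n + B n"])
      (use B l a in \<open>auto simp: f intro!: PT_Pair PT_id pbound_intros\<close>)
  then have "PT (\<lambda>x. (x, fold (h x) (l x) (a x)))" by (simp add: f)
  from PT_snd[OF this] show ?thesis by simp
qed


section \<open>From encodable types to words\<close>

text \<open>The letters are popped last first, so the list is serialized from its closing leaf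
  backwards. The two final moves bring it to register 0 in the same order.\<close>

definition read_input :: com where
  "read_input = push 1 False ;; Loop 0 {2, 3} (Cond 0 {3}
      (pop 0 ;; push_list 1 (True # ser (enc True))) (pop 0 ;; push_list 1 (True # ser (enc False)))) ;;
    mv 1 2 ;; mv 2 0"

lemma run_read_loop:
  "run (Loop 0 {2, 3} (Cond 0 {3}
      (pop 0 ;; push_list 1 (True # ser (enc True))) (pop 0 ;; push_list 1 (True # ser (enc False)))))
    s (25 * length (s 0) + 1)
    (s(0 := [], 1 := concat (map (\<lambda>b. True # ser (enc b)) (rev (s 0))) @ s 1))"
proof (induction "s 0" arbitrary: s)
  case Nil
  show ?case
    by (rule run_post[OF run_LoopF[where k = 1]]) (use Nil[symmetric] in \<open>auto simp: fun_eq_iff\<close>)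
next
  case (Cons x xs)
  let ?s = "s(0 := xs, 1 := (True # ser (enc x)) @ s 1)"
  have 1: "run (pop 0) s 1 (s(0 := xs))"
    using run_pop[of s 0 x xs 1] Cons(2) by simp
  have 2: "run (push_list 1 (True # ser (enc x))) (s(0 := xs)) 17 ?s"
    by (rule run_post[OF run_push_list]) (auto simp: enc_bool_def)
  have b: "run (Cond 0 {3}
      (pop 0 ;; push_list 1 (True # ser (enc True))) (pop 0 ;; push_list 1 (True # ser (enc False))))
     s 20 ?s"
  proof (cases x)
    case True
    then show ?thesis
      using run_seq'[OF 1 2] by (intro run_CondT) (auto simp: sym_def simp flip: Cons(2))
  next
    case False
    then show ?thesis
      using run_seq'[OF 1 2] by (intro run_CondF) (auto simp: sym_def simp flip: Cons(2))
  qed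
  show ?case
    by (rule run_post[OF run_LoopT[OF _ b Cons(1) le_refl]])
      (use Cons(2)[symmetric] in \<open>auto simp: fun_eq_iff\<close>)
qed

lemma enc_list_ser: "ser (enc xs) = concat (map (\<lambda>b. True # ser (enc b)) xs) @ [False]"
  by (induction xs) auto

lemma sz_bool_list: "sz (x :: bool list) \<le> 4 * length x + 1" "length x \<le> sz x"
  by (induction x) (auto simp: sz_def enc_bool_def)

lemma run_read_input:
  "run read_input ((\<lambda>_. [])(0 := rev x)) (81 * length x + 30) ((\<lambda>_. [])(0 := ser (enc x)))"
proof -
  let ?s0 = "(\<lambda>_. [])(0 := rev x)"
  let ?s1 = "?s0(1 := [False])"
  let ?s2 = "(\<lambda>_. [])(1 := ser (enc x))"
  let ?s3 = "(\<lambda>_. [])(2 := rev (ser (enc x)))"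
  have 1: "run (push 1 False) ?s0 3 ?s1"
    by (rule run_post[OF run_push]) auto
  note 2 = run_post[OF run_read_loop[of ?s1], where n' = "25 * length x + 1" and t' = ?s2]
  have 3: "run (mv 1 2) ?s2 (7 * sz x + 1) ?s3"
    by (rule run_post[OF run_mv]) (auto simp: sz_def fun_eq_iff)
  have 4: "run (mv 2 0) ?s3 (7 * sz x + 1) ((\<lambda>_. [])(0 := ser (enc x)))"
    by (rule run_post[OF run_mv]) (auto simp: sz_def fun_eq_iff)
  show ?thesis
    unfolding read_input_def
    by (rule run_post[OF run_seq'[OF 1 run_seq'[OF 2 run_seq'[OF 3 4]]]])
      (use sz_bool_list(1)[of x] in \<open>auto simp: fun_eq_iff enc_list_ser\<close>)
qed

definition write_output :: com where
  "write_output = Loop 0 {3} (pop 0 ;; Cond 0 {3}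
     (pop 0 ;; pop 0 ;; pop 0 ;; push 1 True) (pop 0 ;; push 1 False))"

lemma run_write_output:
  "s 0 = ser (enc y) \<Longrightarrow> run write_output s (20 * length y + 1) (s(0 := [False], 1 := rev y @ s 1))"
proof (induction y arbitrary: s)
  case Nil
  show ?case unfolding write_output_def
    by (rule run_post[OF run_LoopF[where k = 1]]) (use Nil in \<open>auto simp: fun_eq_iff\<close>)
next
  case (Cons b y)
  let ?s1 = "s(0 := ser (enc b) @ ser (enc y))"
  let ?s = "s(0 := ser (enc y), 1 := b # s 1)"
  have 1: "run (pop 0) s 1 ?s1"
    by (rule run_post[OF run_pop[of _ _ True]]) (use Cons.prems in auto)
  have 2: "run (Cond 0 {3} (pop 0 ;; pop 0 ;; pop 0 ;; push 1 True) (pop 0 ;; push 1 False)) ?s1 12 ?s"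
  proof (cases b)
    case True
    have "run (pop 0 ;; pop 0 ;; pop 0 ;; push 1 True) ?s1 (Suc (1 + Suc (1 + Suc (1 + 3)))) ?s"
    proof (intro run_seq')
      show "run (pop 0) ?s1 1 (s(0 := False # False # ser (enc y)))"
        by (rule run_post[OF run_pop[of _ _ True]]) (auto simp: True enc_bool_def)
      show "run (pop 0) (s(0 := False # False # ser (enc y))) 1 (s(0 := False # ser (enc y)))"
        by (rule run_post[OF run_pop[of _ _ False]]) auto
      show "run (pop 0) (s(0 := False # ser (enc y))) 1 (s(0 := ser (enc y)))"
        by (rule run_post[OF run_pop[of _ _ False]]) auto
      show "run (push 1 True) (s(0 := ser (enc y))) 3 ?s"
        by (rule run_post[OF run_push]) (auto simp: True)
    qed
    then show ?thesis
      by (intro run_CondT) (auto simp: True enc_bool_def)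
  next
    case False
    have "run (pop 0 ;; push 1 False) ?s1 (Suc (1 + 3)) ?s"
    proof (intro run_seq')
      show "run (pop 0) ?s1 1 (s(0 := ser (enc y)))"
        by (rule run_post[OF run_pop[of _ _ False]]) (auto simp: False enc_bool_def)
      show "run (push 1 False) (s(0 := ser (enc y))) 3 ?s"
        by (rule run_post[OF run_push]) (auto simp: False)
    qed
    then show ?thesis
      by (intro run_CondF) (auto simp: False enc_bool_def)
  qed
  show ?case unfolding write_output_def
    by (rule run_post[OF run_LoopT[OF _ run_seq'[OF 1 2] Cons.IH[of ?s, unfolded write_output_def] le_refl]])
      (use Cons.prems in \<open>auto simp: fun_eq_iff\<close>)
qed

theorem polytime_PT:
  assumes "PT f"
  shows "polytime f"
proof -
  obtain c k T where c: "computes c k T f" using assms unfolding PT_def by blast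
  note cD = computesD[OF c]
  \<comment> \<open>A word of length \<open>n\<close> has size at most \<open>4 * n + 1\<close> as a
    list of booleans.\<close>
  let ?T = "\<lambda>n. T (4 * n + 1) + 20 * T (4 * n + 1) + 81 * n + 33"
  have "pbound ?T"
    by (intro pbound_intros pbound_comp[OF cD(1)])
  then obtain p where p: "?T = poly p" unfolding pbound_def by blast
  show ?thesis
  proof (rule polytime_run[where c = "read_input ;; c ;; write_output" and k = "max 3 k" and p = p])
    fix x :: "bool list"
    have T: "T (sz x) \<le> T (4 * length x + 1)"
      by (rule pbound_mono[OF cD(1) sz_bool_list(1)])
    have "length (f x) \<le> T (sz x)"
      using sz_bool_list(2)[of "f x"] cD(4)[of x] by simp
    then show "run (read_input ;; c ;; write_output) ((\<lambda>_. [])(0 := rev x)) (poly p (length x))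
        ((\<lambda>_. [])(0 := [False], 1 := rev (f x)))"
      unfolding p[symmetric] using T
      by (intro run_post[OF run_seq'[OF run_read_input run_seq'[OF cD(5)[of _ x] run_write_output[of _ "f x"]]]])
        (simp_all add: fun_eq_iff)
  qed (use wfc_mono[OF cD(3), of "max 3 k"] in
      \<open>auto simp: read_input_def write_output_def wfc_push_list simp del: push_list.simps\<close>)
qed

section \<open>Size bounds\<close>

definition bnd :: "('a::enc \<Rightarrow> nat) \<Rightarrow> bool" where
  "bnd f \<longleftrightarrow> (\<exists>T. pbound T \<and> (\<forall>x. f x \<le> T (sz x)))"

lemma bnd_le: "bnd g \<Longrightarrow> (\<And>x. f x \<le> g x) \<Longrightarrow> bnd f"
  unfolding bnd_def by (meson le_trans)

lemma bnd_const: "bnd (\<lambda>x. c)"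
  unfolding bnd_def using pbound_const by blast

lemma bnd_add: "bnd f \<Longrightarrow> bnd g \<Longrightarrow> bnd (\<lambda>x. f x + g x)"
  unfolding bnd_def by (blast intro: pbound_add add_mono)

lemma bnd_mult: "bnd f \<Longrightarrow> bnd g \<Longrightarrow> bnd (\<lambda>x. f x * g x)"
  unfolding bnd_def by (blast intro: pbound_mult mult_le_mono)

lemma bnd_sz: "PT f \<Longrightarrow> bnd (\<lambda>x. sz (f x))"
  unfolding bnd_def by (rule PT_size)

lemma bnd_pbound: "pbound T \<Longrightarrow> bnd f \<Longrightarrow> bnd (\<lambda>x. T (f x))"
  unfolding bnd_def by (blast intro: pbound_comp le_trans pbound_mono)

lemma bnd_sz_self: "bnd sz"
  using bnd_sz[OF PT_id] .

lemma length_le_sz: "length l \<le> sz l"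
  by (induction l) auto

lemma bnd_length: "PT l \<Longrightarrow> bnd (\<lambda>x. length (l x))"
  by (rule bnd_le[OF bnd_sz length_le_sz])

lemma bnd_Suc: "bnd f \<Longrightarrow> bnd (\<lambda>x. Suc (f x))"
  using bnd_add[OF bnd_const[of 1]] by simp

lemmas bnd_intros = bnd_const bnd_add bnd_mult bnd_Suc

lemma sz_append: "Suc (sz (xs @ ys)) = sz xs + sz ys"
  by (induction xs) auto

lemma sz_rev [simp]: "sz (rev xs) = sz xs"
proof (induction xs)
  case (Cons x xs)
  then show ?case using sz_append[of "rev xs" "[x]"] by simp
qed simp

lemma sz_mem: "e \<in> set l \<Longrightarrow> sz e < sz l"
  by (induction l) auto

lemma sz_bool: "sz (b :: bool) \<le> 3"
  by (cases b) auto

lemma sz_list_le: "(\<And>x. x \<in> set xs \<Longrightarrow> sz x \<le> c) \<Longrightarrow> sz xs \<le> length xs * Suc c + 1"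
  by (induction xs) fastforce+

lemma PT_fold_bnd:
  fixes h :: "'x::enc \<Rightarrow> 'e::enc \<Rightarrow> 'a::enc \<Rightarrow> 'a"
  assumes "PT (\<lambda>p. h (fst p) (fst (snd p)) (snd (snd p)))" "PT l" "PT a"
    and b: "bnd b" "\<And>x ys zs. l x = ys @ zs \<Longrightarrow> sz (fold (h x) ys (a x)) \<le> b x"
  shows "PT (\<lambda>x. fold (h x) (l x) (a x))"
proof -
  obtain T where "pbound T" "\<And>x. b x \<le> T (sz x)" using b(1) unfolding bnd_def by blast
  then show ?thesis
    using assms(1-3) b(2) by (intro PT_fold[where B = T]) (blast intro: le_trans)+
qed

text \<open>Increments that are bounded in terms of \<open>x\<close> alone add up to a polynomial
  over the list. This covers most folds below; a step that could double the size of the accumulator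
  does not fit.\<close>

lemma PT_fold_inc:
  fixes h :: "'x::enc \<Rightarrow> 'e::enc \<Rightarrow> 'a::enc \<Rightarrow> 'a"
  assumes h: "PT (\<lambda>p. h (fst p) (fst (snd p)) (snd (snd p)))" "PT l" "PT a"
    and b: "bnd b" "\<And>x e c. e \<in> set (l x) \<Longrightarrow> sz (h x e c) \<le> sz c + b x"
  shows "PT (\<lambda>x. fold (h x) (l x) (a x))"
proof (rule PT_fold_bnd[OF h])
  show "bnd (\<lambda>x. sz (a x) + length (l x) * b x)"
    by (intro bnd_intros bnd_sz bnd_length h b)
  fix x ys zs assume l: "l x = ys @ zs"
  have "set ys \<subseteq> set (l x) \<Longrightarrow> sz (fold (h x) ys c) \<le> sz c + length ys * b x" for c
  proof (induction ys arbitrary: c)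
    case (Cons e ys)
    then have "sz (fold (h x) ys (h x e c)) \<le> sz (h x e c) + length ys * b x" by simp
    also have "sz (h x e c) \<le> sz c + b x" using Cons b(2) by simp
    finally show ?case by simp
  qed simp
  then show "sz (fold (h x) ys (a x)) \<le> sz (a x) + length (l x) * b x"
    using l by (fastforce intro: order_trans)
qed


section \<open>Booleans, pairs and lists\<close>

text \<open>
  The rules \<open>pt\<close> follow the syntax of the function body; under binders the argument and the bound
  variables are collected in nested pairs.
\<close>

named_theorems pt

declare PT_id [pt] PT_const [pt] PT_Pair [pt] PT_fst [pt] PT_snd [pt] PT_If [pt] PT_eq [pt]

lemma PT2:
  assumes "PT (\<lambda>p. f (fst p) (snd p))" "PT a" "PT b"
  shows "PT (\<lambda>x. f (a x) (b x))"
  using PT_comp[OF assms(1) PT_Pair[OF assms(2,3)]] by simp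

lemma PT_not [pt]: "PT b \<Longrightarrow> PT (\<lambda>x. \<not> b x)"
  using PT_If[OF _ PT_const[of False] PT_const[of True], of b] by (rule PT_cast) auto

lemma PT_conj [pt]: "PT a \<Longrightarrow> PT b \<Longrightarrow> PT (\<lambda>x. a x \<and> b x)"
  using PT_If[OF _ _ PT_const[of False], of a b] by (rule PT_cast) auto

lemma PT_disj [pt]: "PT a \<Longrightarrow> PT b \<Longrightarrow> PT (\<lambda>x. a x \<or> b x)"
  using PT_If[OF _ PT_const[of True], of a b] by (rule PT_cast) auto

lemma PT_Cons [pt]: "PT f \<Longrightarrow> PT g \<Longrightarrow> PT (\<lambda>x. f x # g x)"
  by (rule PT_cast[OF PT_Pair[of f g]]) (auto simp: enc_prod_def)

lemma PT_tl [pt]: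
  assumes "PT f"
  shows "PT (\<lambda>x. tl (f x))"
proof (rule PT_cast[OF PT_comp[OF PT_right PT_comp[OF PT_enc assms]]])
  show "enc (right (enc (f x))) = enc (tl (f x))" for x
    by (cases "f x") (auto simp: enc_tree_def)
qed

lemma PT_hd [pt]:
  assumes "PT f"
  shows "PT (\<lambda>x. hd (f x) :: 'a::enc)"
proof -
  \<comment> \<open>\<open>hd []\<close> is an unspecified but fixed value, so a constant program
    can return it.\<close>
  have "PT (\<lambda>x. if f x = [] then enc (hd [] :: 'a) else left (enc (f x)))"
    by (intro pt assms PT_comp[OF PT_left] PT_comp[OF PT_enc])
  then show ?thesis
  proof (rule PT_cast)
    show "enc (if f x = [] then enc (hd [] :: 'a) else left (enc (f x))) = enc (hd (f x))" for x
      by (cases "f x") (auto simp: enc_tree_def)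
  qed
qed

lemma PT_rev [pt]: "PT f \<Longrightarrow> PT (\<lambda>x. rev (f x))"
proof -
  assume f: "PT f"
  have "PT (\<lambda>x. fold (\<lambda>e c. e # c) (f x) [])"
  proof (rule PT_fold_inc)
    show "bnd (\<lambda>x. 1 + sz (f x))" by (intro bnd_intros bnd_sz f)
    show "e \<in> set (f x) \<Longrightarrow> sz (e # c) \<le> sz c + (1 + sz (f x))" for e x c
      using sz_mem[of e "f x"] by simp
  qed (intro pt f)+
  then show ?thesis by (simp add: fold_Cons_rev)
qed

lemma PT_append [pt]: "PT f \<Longrightarrow> PT g \<Longrightarrow> PT (\<lambda>x. f x @ g x)"
proof -
  assume f: "PT f" "PT g"
  have "PT (\<lambda>x. fold (\<lambda>e c. e # c) (rev (f x)) (g x))"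
  proof (rule PT_fold_inc)
    show "bnd (\<lambda>x. 1 + sz (f x))" by (intro bnd_intros bnd_sz f)
    show "e \<in> set (rev (f x)) \<Longrightarrow> sz (e # c) \<le> sz c + (1 + sz (f x))" for e x c
      using sz_mem[of e "f x"] by simp
  qed (intro pt f)+
  then show ?thesis by (simp add: fold_Cons_rev)
qed

lemma PT_map [pt]:
  assumes h: "PT (\<lambda>p. h (fst p) (snd p))" and l: "PT l"
  shows "PT (\<lambda>x. map (h x) (l x))"
proof -
  obtain T where T: "pbound T" "\<And>p. sz (h (fst p) (snd p)) \<le> T (sz p)"
    using PT_size[OF h] by blast
  have "PT (\<lambda>x. fold (\<lambda>e c. h x e # c) (l x) [])"
  proof (rule PT_fold_inc)
    show "PT (\<lambda>p. h (fst p) (fst (snd p)) # snd (snd p))"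
      by (intro pt PT2[OF h])
    show "bnd (\<lambda>x. 1 + T (1 + sz x + sz (l x)))"
      by (intro bnd_intros bnd_pbound[OF T(1)] bnd_sz_self bnd_sz l)
    show "sz (h x e # c) \<le> sz c + (1 + T (1 + sz x + sz (l x)))" if "e \<in> set (l x)" for e x c
    proof -
      have "sz (h x e) \<le> T (1 + sz x + sz e)" using T(2)[of "(x, e)"] by simp
      also have "\<dots> \<le> T (1 + sz x + sz (l x))"
        by (rule pbound_mono[OF T(1)]) (use sz_mem[OF that] in simp)
      finally show ?thesis by simp
    qed
  qed (intro pt l)+
  moreover have "fold (\<lambda>e c. h x e # c) xs ys = rev (map (h x) xs) @ ys" for x xs ys
    by (induction xs arbitrary: ys) auto
  ultimately have "PT (\<lambda>x. rev (map (h x) (l x)))" by simp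
  from PT_rev[OF this] show ?thesis by simp
qed

lemma PT_filter [pt]:
  assumes h: "PT (\<lambda>p. h (fst p) (snd p))" and l: "PT l"
  shows "PT (\<lambda>x. filter (h x) (l x))"
proof -
  have "PT (\<lambda>x. fold (\<lambda>e c. if h x e then e # c else c) (l x) [])"
  proof (rule PT_fold_inc)
    show "PT (\<lambda>p. if h (fst p) (fst (snd p)) then fst (snd p) # snd (snd p) else snd (snd p))"
      by (intro pt PT2[OF h])
    show "bnd (\<lambda>x. 1 + sz (l x))"
      by (intro bnd_intros bnd_sz l)
    show "sz (if h x e then e # c else c) \<le> sz c + (1 + sz (l x))" if "e \<in> set (l x)" for e x c
      using sz_mem[OF that] by simp
  qed (intro pt l)+
  moreover have "fold (\<lambda>e c. if h x e then e # c else c) xs ys = rev (filter (h x) xs) @ ys" for x xs ys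
    by (induction xs arbitrary: ys) auto
  ultimately have "PT (\<lambda>x. rev (filter (h x) (l x)))" by simp
  from PT_rev[OF this] show ?thesis by simp
qed

lemma PT_concat [pt]:
  assumes l: "PT l"
  shows "PT (\<lambda>x. concat (l x))"
proof -
  have "PT (\<lambda>x. fold (\<lambda>e c. c @ e) (l x) [])"
  proof (rule PT_fold_inc)
    show "bnd (\<lambda>x. sz (l x))" by (intro bnd_sz l)
    show "sz (c @ e) \<le> sz c + sz (l x)" if "e \<in> set (l x)" for e x c
      using sz_mem[OF that] sz_append[of c e] by simp
  qed (intro pt l)+
  moreover have "fold (\<lambda>e c. c @ e) xs ys = ys @ concat xs" for xs and ys :: "'b list"
    by (induction xs arbitrary: ys) auto
  ultimately show ?thesis by simp
qed

lemma PT_Ball [pt]: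
  assumes h: "PT (\<lambda>p. h (fst p) (snd p))" and l: "PT l"
  shows "PT (\<lambda>x. \<forall>e\<in>set (l x). h x e)"
proof -
  have "PT (\<lambda>x. fold (\<lambda>e c. h x e \<and> c) (l x) True)"
  proof (rule PT_fold_inc)
    show "bnd (\<lambda>x. 3)" by (intro bnd_const)
    show "sz (h x e \<and> c) \<le> sz c + 3" for e x c
      using sz_bool le_add2 le_trans by blast
  qed (intro pt PT2[OF h] l)+
  moreover have "fold (\<lambda>e c. h x e \<and> c) xs c \<longleftrightarrow> (\<forall>e\<in>set xs. h x e) \<and> c" for x xs c
    by (induction xs arbitrary: c) auto
  ultimately show ?thesis by simp
qed

lemma PT_Bex [pt]:
  assumes h: "PT (\<lambda>p. h (fst p) (snd p))" and l: "PT l"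
  shows "PT (\<lambda>x. \<exists>e\<in>set (l x). h x e)"
  using PT_not[OF PT_Ball[where h = "\<lambda>x e. \<not> h x e", OF PT_not[OF h] l]] by simp

lemma PT_mem [pt]:
  assumes "PT e" "PT l"
  shows "PT (\<lambda>x. e x \<in> set (l x))"
proof -
  have "PT (\<lambda>x. \<exists>y\<in>set (l x). y = e x)"
    by (intro pt assms PT_comp[OF assms(1)])
  then show ?thesis by simp
qed

lemma PT_zip [pt]:
  fixes f :: "'x::enc \<Rightarrow> 'e::enc list" and g :: "'x \<Rightarrow> 'f::enc list"
  assumes "PT f" "PT g"
  shows "PT (\<lambda>x. zip (f x) (g x))"
proof -
  let ?h = "\<lambda>e c. if fst c = [] then c else (tl (fst c), (e, hd (fst c)) # snd c)"
  have "PT (\<lambda>x. fold ?h (f x) (g x, []))"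
  proof (rule PT_fold_inc)
    show "bnd (\<lambda>x. 2 + sz (f x))" by (intro bnd_intros bnd_sz assms)
    show "sz (?h e c) \<le> sz c + (2 + sz (f x))" if "e \<in> set (f x)" for e x c
      using sz_mem[OF that] by (cases c; cases "fst c") auto
  qed (intro pt assms)+
  moreover have "rev (snd (fold ?h xs (ys, zs))) = rev zs @ zip xs ys"
    for xs :: "'e list" and ys :: "'f list" and zs
    by (induction xs arbitrary: ys zs) (auto simp: zip_Cons1 split: list.split)
  ultimately show ?thesis
    using PT_rev[OF PT_snd, of "\<lambda>x. fold ?h (f x) (g x, [])"] by simp
qed

text \<open>A left fold, to which \<open>PT_fold_inc\<close> applies directly. It turns
  cardinalities into lengths of lists.\<close>

definition dedup :: "'a list \<Rightarrow> 'a list" where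
  "dedup xs = fold (\<lambda>e c. if e \<in> set c then c else e # c) xs []"

lemma dedup_aux: "distinct ys \<Longrightarrow> distinct (fold (\<lambda>e c. if e \<in> set c then c else e # c) xs ys) \<and>
    set (fold (\<lambda>e c. if e \<in> set c then c else e # c) xs ys) = set xs \<union> set ys"
  by (induction xs arbitrary: ys) auto

lemma set_dedup [simp]: "set (dedup xs) = set xs"
  and distinct_dedup [simp]: "distinct (dedup xs)"
  using dedup_aux[of "[]" xs] by (auto simp: dedup_def)

lemma PT_dedup [pt]:
  assumes "PT f"
  shows "PT (\<lambda>x. dedup (f x))"
  unfolding dedup_def
proof (rule PT_fold_inc)
  show "bnd (\<lambda>x. 1 + sz (f x))" by (intro bnd_intros bnd_sz assms)
  show "sz (if e \<in> set c then c else e # c) \<le> sz c + (1 + sz (f x))" if "e \<in> set (f x)" for e x c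
    using sz_mem[OF that] by auto
qed (intro pt assms)+


section \<open>Natural numbers in binary\<close>

instantiation nat :: enc
begin
definition "enc_nat n = enc (bits n)"
instance by standard (auto simp: enc_nat_def dest: bits_inject)
end

primrec val :: "bool list \<Rightarrow> nat" where
  "val [] = 0"
| "val (b # bs) = of_bool b + 2 * val bs"

lemma bits_0 [simp]: "bits 0 = []"
  by (simp add: bits.simps)

lemma bits_pos: "0 < n \<Longrightarrow> bits n = odd n # bits (n div 2)"
  by (subst bits.simps) simp

lemma val_bits [simp]: "val (bits n) = n"
proof (induction n rule: less_induct)
  case (less n)
  show ?case
  proof (cases "n = 0")
    case False
    then show ?thesis using less[of "n div 2"] by (auto simp: bits_pos)
  qed simp
qed

text \<open>Numbers are encoded by their canonical digits, so computing \<open>val\<close> amounts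
  to removing the zeros at the most significant end.\<close>

definition trim :: "bool list \<Rightarrow> bool list" where
  "trim bs = foldr (\<lambda>b c. if b \<or> c \<noteq> [] then b # c else []) bs []"

lemma bits_val: "bits (val bs) = trim bs"
proof (induction bs)
  case (Cons b bs)
  have "trim bs = [] \<longleftrightarrow> val bs = 0"
    unfolding Cons[symmetric] by (metis bits_0 bits_pos list.distinct(1) neq0_conv)
  then show ?case
    using Cons by (auto simp: trim_def bits_pos)
qed (simp add: trim_def)

lemma val_less: "val bs < 2 ^ length bs"
  by (induction bs) auto

lemma length_bits_le: "n < 2 ^ k \<Longrightarrow> length (bits n) \<le> k"
proof (induction k arbitrary: n)
  case (Suc k)
  then show ?case by (cases "n = 0") (auto simp: bits_pos)
qed simp

lemma length_bits_bound: "n < 2 ^ length (bits n)"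
  using val_less[of "bits n"] by simp

lemma length_bits_mono: "m \<le> n \<Longrightarrow> length (bits m) \<le> length (bits n)"
  using length_bits_bound[of n] by (intro length_bits_le) simp

lemma length_bits_self: "length (bits n) \<le> n"
  by (intro length_bits_le) simp

lemma length_bits_mult: "length (bits (m * n)) \<le> length (bits m) + length (bits n)"
  using length_bits_bound[of m] length_bits_bound[of n]
  by (intro length_bits_le) (auto simp: power_add intro: mult_strict_mono)

lemma sz_nat: "sz (n :: nat) = sz (bits n)"
  by (simp add: sz_def enc_nat_def)

lemma sz_nat_le: "sz (n :: nat) \<le> 4 * length (bits n) + 1" "length (bits n) \<le> sz n"
  using sz_bool_list[of "bits n"] by (auto simp: sz_nat)

lemma sz_nat_self: "sz (n :: nat) \<le> 4 * n + 1"
  using sz_nat_le(1)[of n] length_bits_self[of n] by linarith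

lemma PT_bits [pt]: "PT f \<Longrightarrow> PT (\<lambda>x. bits (f x))"
  by (rule PT_cast[of f]) (simp_all add: enc_nat_def)

lemma PT_val [pt]:
  assumes "PT f"
  shows "PT (\<lambda>x. val (f x))"
proof -
  have "PT (\<lambda>x. fold (\<lambda>b c. if b \<or> c \<noteq> [] then b # c else []) (rev (f x)) [])"
  proof (rule PT_fold_inc)
    show "bnd (\<lambda>x. 4)" by (rule bnd_const)
    show "sz (if b \<or> c \<noteq> [] then b # c else []) \<le> sz c + 4" for b and c :: "bool list"
      using sz_bool[of b] by auto
  qed (intro pt assms)+
  then have "PT (\<lambda>x. trim (f x))" by (simp add: trim_def foldr_conv_fold)
  then show ?thesis
    by (rule PT_cast) (simp add: enc_nat_def bits_val)
qed

text \<open>Ripple-carry addition: \<open>(b = d) = c\<close> is the parity of the three bits, and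
  the conditional is their majority. Digits missing from \<open>r\<close> count as zeros.\<close>

definition add_step :: "bool \<Rightarrow> bool list \<times> bool \<times> bool list \<Rightarrow> bool list \<times> bool \<times> bool list" where
  "add_step b = (\<lambda>(r, c, out). let d = (r \<noteq> [] \<and> hd r) in
     (tl r, if b = d then b else c, ((b = d) = c) # out))"

lemma val_append: "val (xs @ ys) = val xs + 2 ^ length xs * val ys"
  by (induction xs) auto

lemma val_Cons_hd_tl: "val r = of_bool (r \<noteq> [] \<and> hd r) + 2 * val (tl r)"
  by (cases r) auto

text \<open>Written digits keep their weight while the carry and the pending digits are shifted past
  them; each step preserves the weighted total.\<close>

lemma add_fold:
  "fold add_step as (r, c, out) = (r', c', out') \<Longrightarrow> r' = drop (length as) r \<and>
     val (rev out') + 2 ^ length out' * (val r' + of_bool c')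
       = val (rev out) + 2 ^ length out * (val as + val r + of_bool c)"
proof (induction as arbitrary: r c out)
  case (Cons b as)
  define d where "d = (r \<noteq> [] \<and> hd r)"
  have "add_step b (r, c, out) = (tl r, if b = d then b else c, ((b = d) = c) # out)"
    by (simp only: add_step_def d_def Let_def prod.case)
  with Cons.prems
  have "fold add_step as (tl r, if b = d then b else c, ((b = d) = c) # out) = (r', c', out')"
    by simp
  from Cons.IH[OF this] show ?case
    using val_Cons_hd_tl[of r, folded d_def]
    by (auto simp: val_append drop_Suc algebra_simps split: if_splits)
qed simp

lemma PT_plus [pt]:
  assumes "PT f" "PT g"
  shows "PT (\<lambda>x. f x + g x :: nat)"
proof -
  \<comment> \<open>The zeros appended to the first summand make the fold long enough to use up all
    digits of the second. The final carry becomes the top digit of the result.\<close>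
  let ?F = "\<lambda>x. fold add_step (bits (f x) @ map (\<lambda>_. False) (bits (g x))) (bits (g x), False, [])"
  have "PT ?F"
    unfolding add_step_def case_prod_beta Let_def
  proof (rule PT_fold_inc)
    show "bnd (\<lambda>x. 7)" by (rule bnd_const)
    fix b and c :: "bool list \<times> bool \<times> bool list"
    obtain r c' out where c: "c = (r, c', out)" by (cases c)
    have "sz (tl r) \<le> sz r" by (cases r) auto
    then have "sz (tl r, u, v # out) \<le> sz (r, c', out) + 7" for u v :: bool
      using sz_bool[of u] sz_bool[of v] by simp
    then show "sz (tl (fst c), if b = (fst c \<noteq> [] \<and> hd (fst c)) then b else fst (snd c),
        ((b = (fst c \<noteq> [] \<and> hd (fst c))) = fst (snd c)) # snd (snd c)) \<le> sz c + 7"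
      unfolding c fst_conv snd_conv .
  qed (intro pt assms)+
  then have "PT (\<lambda>x. val (rev (snd (snd (?F x))) @ [fst (snd (?F x))]))"
    by (intro pt)
  moreover have "val (rev (snd (snd (?F x))) @ [fst (snd (?F x))]) = f x + g x" for x
  proof -
    obtain r c out where F: "?F x = (r, c, out)" by (cases "?F x")
    have "val (map (\<lambda>_. False) bs) = 0" for bs :: "bool list" by (induction bs) auto
    with add_fold[OF F] show ?thesis unfolding F fst_conv snd_conv by (auto simp: val_append)
  qed
  ultimately show ?thesis by simp
qed

lemma PT_Suc [pt]: "PT f \<Longrightarrow> PT (\<lambda>x. Suc (f x))"
  using PT_plus[OF _ PT_const[of 1], of f] by simp

text \<open>Digits come least significant first, so a pair of different digits overrides the verdict
  on the lower ones and equal digits keep it.\<close>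

definition le_step :: "bool \<Rightarrow> bool list \<times> bool \<Rightarrow> bool list \<times> bool" where
  "le_step b = (\<lambda>(r, c). let d = (r \<noteq> [] \<and> hd r) in (tl r, if b = d then c else d))"

lemma le_fold:
  "length r \<le> length as \<Longrightarrow>
     snd (fold le_step as (r, c)) \<longleftrightarrow> val as < val r \<or> val as = val r \<and> c"
proof (induction as arbitrary: r c)
  case (Cons b as)
  then show ?case
    by (cases r) (auto simp: le_step_def Let_def)
qed simp

lemma PT_le [pt]:
  assumes "PT f" "PT g"
  shows "PT (\<lambda>x. f x \<le> (g x :: nat))"
proof -
  let ?F = "\<lambda>x. fold le_step (bits (f x) @ map (\<lambda>_. False) (bits (g x))) (bits (g x), True)"
  have "PT ?F"
    unfolding le_step_def case_prod_beta Let_def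
  proof (rule PT_fold_inc)
    show "bnd (\<lambda>x. 3)" by (rule bnd_const)
    fix b and c :: "bool list \<times> bool"
    obtain r c' where c: "c = (r, c')" by (cases c)
    have "sz (tl r) \<le> sz r" by (cases r) auto
    then have "sz (tl r, u) \<le> sz (r, c') + 3" for u :: bool
      using sz_bool[of u] by simp
    then show "sz (tl (fst c), if b = (fst c \<noteq> [] \<and> hd (fst c)) then snd c
        else (fst c \<noteq> [] \<and> hd (fst c))) \<le> sz c + 3"
      unfolding c fst_conv snd_conv .
  qed (intro pt assms)+
  then have "PT (\<lambda>x. snd (?F x))"
    by (intro pt)
  moreover have "snd (?F x) \<longleftrightarrow> f x \<le> g x" for x
  proof -
    have "val (map (\<lambda>_. False) bs) = 0" for bs :: "bool list" by (induction bs) auto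
    then show ?thesis by (subst le_fold) (auto simp: val_append)
  qed
  ultimately show ?thesis by simp
qed

lemma PT_less [pt]: "PT f \<Longrightarrow> PT g \<Longrightarrow> PT (\<lambda>x. f x < (g x :: nat))"
  using PT_not[OF PT_le[of g f]] by (simp add: not_le)

text \<open>Horner's scheme from the most significant digit. Every intermediate value is the product
  of \<open>g x\<close> with a leading part of \<open>f x\<close>, hence at most the final product,
  and this bounds its length.\<close>

lemma PT_times [pt]:
  assumes "PT f" "PT g"
  shows "PT (\<lambda>x. f x * g x :: nat)"
proof -
  let ?h = "\<lambda>x b c. c + c + (if b then g x else 0)"
  have v: "fold (?h x) ys c = val (rev ys) * g x + 2 ^ length ys * c" for x ys c
    by (induction ys arbitrary: c) (auto simp: val_append algebra_simps)
  have "PT (\<lambda>x. fold (?h x) (rev (bits (f x))) 0)"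
  proof (rule PT_fold_bnd)
    show "bnd (\<lambda>x. 4 * (sz (f x) + sz (g x)) + 1)"
      by (intro bnd_intros bnd_sz assms)
    fix x ys zs assume "rev (bits (f x)) = ys @ zs"
    then have "bits (f x) = rev zs @ rev ys" by (metis rev_append rev_rev_ident)
    then have "f x = val (rev zs) + 2 ^ length zs * val (rev ys)"
      using val_bits[of "f x"] by (simp add: val_append)
    then have "val (rev ys) \<le> f x" by (metis mult_le_mono1 nat_mult_1 one_le_numeral one_le_power trans_le_add2)
    then have "length (bits (val (rev ys) * g x)) \<le> length (bits (f x * g x))"
      by (intro length_bits_mono) simp
    also have "\<dots> \<le> sz (f x) + sz (g x)"
      using length_bits_mult[of "f x" "g x"] sz_nat_le(2)[of "f x"] sz_nat_le(2)[of "g x"] by linarith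
    finally show "sz (fold (?h x) ys 0) \<le> 4 * (sz (f x) + sz (g x)) + 1"
      using sz_nat_le(1)[of "val (rev ys) * g x"] by (simp add: v)
  qed (intro pt assms PT_comp[OF assms(2)])+
  then show ?thesis by (simp add: v)
qed

lemma PT_of_bool [pt]: "PT b \<Longrightarrow> PT (\<lambda>x. of_bool (b x) :: nat)"
  unfolding of_bool_def by (intro pt)

lemma PT_length [pt]:
  assumes "PT f"
  shows "PT (\<lambda>x. length (f x))"
proof -
  have l: "fold (\<lambda>_. Suc) xs n = n + length xs" for xs :: "'b list" and n
    by (induction xs arbitrary: n) auto
  have "PT (\<lambda>x. fold (\<lambda>_. Suc) (f x) 0)"
  proof (rule PT_fold_bnd)
    show "bnd (\<lambda>x. 4 * length (f x) + 1)" by (intro bnd_intros bnd_length assms)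
    show "sz (fold (\<lambda>_. Suc) ys 0) \<le> 4 * length (f x) + 1" if "f x = ys @ zs" for x ys zs
      using sz_nat_self[of "length ys"] that by (simp add: l)
  qed (intro pt assms)+
  then show ?thesis by (simp add: l)
qed

text \<open>The only rule for ranges: in terms of a binary \<open>n\<close>, the list
  \<open>[0..<n]\<close> has exponential size, but up to the length of a given list it is
  harmless.\<close>

lemma PT_upt_length [pt]:
  assumes "PT f"
  shows "PT (\<lambda>x. [0..<length (f x)])"
proof -
  let ?h = "\<lambda>_ c. (Suc (fst c), fst c # snd c)"
  have l: "fold ?h xs (0, []) = (length xs, rev [0..<length xs])" for xs :: "'b list"
    by (induction xs rule: rev_induct) auto
  have "PT (\<lambda>x. fold ?h (f x) (0, []))"
  proof (rule PT_fold_bnd)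
    show "bnd (\<lambda>x. 1 + (4 * length (f x) + 1) + (length (f x) * Suc (4 * length (f x) + 1) + 1))"
      by (intro bnd_intros bnd_length assms)
    fix x ys zs assume f: "f x = ys @ zs"
    have "sz [0..<length ys] \<le> length [0..<length ys] * Suc (4 * length (f x) + 1) + 1"
    proof (rule sz_list_le)
      fix n assume "n \<in> set [0..<length ys]"
      then show "sz n \<le> 4 * length (f x) + 1" using sz_nat_self[of n] f by simp
    qed
    also have "\<dots> \<le> length (f x) * Suc (4 * length (f x) + 1) + 1"
      using f by (intro add_right_mono mult_right_mono) auto
    finally show "sz (fold ?h ys (0, []))
        \<le> 1 + (4 * length (f x) + 1) + (length (f x) * Suc (4 * length (f x) + 1) + 1)"
      using sz_nat_self[of "length ys"] f unfolding l by simp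
  qed (intro pt assms)+
  then have "PT (\<lambda>x. rev (snd (fold ?h (f x) (0, []))))" by (intro pt)
  then show ?thesis by (simp add: l)
qed

lemma PT_distinct [pt]:
  assumes "PT f"
  shows "PT (\<lambda>x. distinct (f x))"
proof -
  have "PT (\<lambda>x. length (dedup (f x)) = length (f x))" by (intro pt assms)
  moreover have "length (dedup xs) = length xs \<longleftrightarrow> distinct xs" for xs :: "'b list"
    by (metis card_distinct distinct_card distinct_dedup set_dedup)
  ultimately show ?thesis by simp
qed

text \<open>Indices may come from untrusted data; the default keeps an access beyond the end
  specified.\<close>

definition nth_or :: "'a \<Rightarrow> 'a list \<Rightarrow> nat \<Rightarrow> 'a" where
  "nth_or d xs n = (if n < length xs then xs ! n else d)"

lemma filter_zip_upt:
  "map snd (filter (\<lambda>p. fst p = n) (zip [0..<length xs] xs)) = (if n < length xs then [xs ! n] else [])"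
  by (induction xs rule: rev_induct) (auto simp: nth_append)

lemma PT_nth_or [pt]:
  assumes "PT d" "PT f" "PT g"
  shows "PT (\<lambda>x. nth_or (d x) (f x) (g x))"
proof -
  have "PT (\<lambda>x. hd (map snd (filter (\<lambda>p. fst p = g x) (zip [0..<length (f x)] (f x))) @ [d x]))"
    by (intro pt assms PT_comp[OF assms(3)])
  then show ?thesis unfolding filter_zip_upt nth_or_def by (rule PT_cast) auto
qed


section \<open>Codes of words\<close>

text \<open>A transducer with two states: the flag says that a continuation bit has just been read,
  so that the next bit is data. The other components hold the current token and the finished ones,
  both reversed. An unfinished token at the end is dropped.\<close>

definition token_step :: "bool \<Rightarrow> bool \<times> bool list \<times> bool list list \<Rightarrow> bool \<times> bool list \<times> bool list list" where
  "token_step b s = (if fst s then (False, b # fst (snd s), snd (snd s))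
     else if b then (True, snd s) else (False, [], rev (fst (snd s)) # snd (snd s)))"

definition tokens :: "bool list \<Rightarrow> bool list list" where
  "tokens w = rev (snd (snd (fold token_step w (False, [], []))))"

lemma token_delimit:
  "fold token_step (delimit x) (False, c, ts) = (False, [], (rev c @ x) # ts)"
  by (induction x arbitrary: c) (auto simp: delimit_def token_step_def)

lemma token_rest: "snd (snd (fold token_step w (b, c, ts))) = snd (snd (fold token_step w (b, c, []))) @ ts"
proof (induction w arbitrary: b c ts)
  case (Cons a w)
  have "token_step a (b, c, ts) = (if b then (False, a # c, ts) else if a then (True, c, ts)
      else (False, [], rev c # ts))" for ts
    by (simp add: token_step_def)
  then show ?case
    using Cons[of False "a # c" ts] Cons[of True c ts] Cons[of False "[]" "[rev c]"]
      Cons[of False "[]" "rev c # ts"] by simp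
qed simp

lemma tokens_delimit: "tokens (delimit x @ w) = x # tokens w"
  unfolding tokens_def fold_append comp_apply token_delimit by (subst token_rest) simp

lemma tokens_Nil [simp]: "tokens [] = []"
  by (simp add: tokens_def)

lemma tokens_concat_delimit: "tokens (concat (map delimit ws)) = ws"
  by (induction ws) (auto simp: tokens_delimit)

lemma PT_tokens [pt]:
  assumes "PT f"
  shows "PT (\<lambda>x. tokens (f x))"
proof -
  have "PT (\<lambda>x. fold token_step (f x) (False, [], []))"
    unfolding token_step_def
  proof (rule PT_fold_inc)
    show "bnd (\<lambda>x. 8)" by (rule bnd_const)
    fix b :: bool and s :: "bool \<times> bool list \<times> bool list list"
    obtain m c ts where s: "s = (m, c, ts)" by (cases s)
    show "sz (if fst s then (False, b # fst (snd s), snd (snd s))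
       else if b then (True, snd s) else (False, [], rev (fst (snd s)) # snd (snd s))) \<le> sz s + 8"
      using sz_bool[of b] sz_pos[of m] by (simp add: s)
  qed (intro pt assms)+
  then show ?thesis unfolding tokens_def by (intro pt)
qed

lemma PT_delimit [pt]: "PT f \<Longrightarrow> PT (\<lambda>x. delimit (f x))"
  unfolding delimit_def by (intro pt)

lemma PT_encode_nats [pt]: "PT f \<Longrightarrow> PT (\<lambda>x. encode_nats (f x))"
  unfolding encode_nats_def by (intro pt)

section \<open>Levels as certificates of connectedness\<close>

section \<open>Connectedness\<close>

lemma connected_iff:
  "Digraph_Component.connected (with_proj G) \<longleftrightarrow> pverts G \<noteq> {} \<and>
    (\<forall>u\<in>pverts G. \<forall>v\<in>pverts G. (u, v) \<in> rtrancl_on (pverts G) (parcs G \<union> (parcs G)\<inverse>))"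
proof -
  have "parcs (mk_symmetric (with_proj G)) = parcs G \<union> (parcs G)\<inverse>"
    by (auto simp: parcs_mk_symmetric)
  then show ?thesis
    by (simp add: Digraph_Component.connected_def strongly_connected_def reachable_def)
qed

lemma rtrancl_on_sym:
  assumes "(u, v) \<in> rtrancl_on V (R \<union> R\<inverse>)"
  shows "(v, u) \<in> rtrancl_on V (R \<union> R\<inverse>)"
proof -
  have "(R \<union> R\<inverse>)\<inverse> = R \<union> R\<inverse>" by auto
  with rtrancl_on_converseI[OF assms] show ?thesis by simp
qed

text \<open>
  Connectedness is certified by a function that decreases, from every vertex other than the root,
  along some edge.
\<close>

lemma connected_of_levels:
  assumes "r \<in> pverts G"
    and lev: "\<And>v. v \<in> pverts G \<Longrightarrow> v \<noteq> r \<Longrightarrow>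
      \<exists>u\<in>pverts G. (u, v) \<in> parcs G \<union> (parcs G)\<inverse> \<and> lev u < (lev v :: nat)"
  shows "Digraph_Component.connected (with_proj G)"
proof -
  let ?R = "rtrancl_on (pverts G) (parcs G \<union> (parcs G)\<inverse>)"
  have *: "(r, v) \<in> ?R" if "v \<in> pverts G" for v
    using that
  proof (induction "lev v" arbitrary: v rule: less_induct)
    case less
    show ?case
    proof (cases "v = r")
      case False
      from lev[OF less.prems this] obtain u where u: "u \<in> pverts G"
        "(u, v) \<in> parcs G \<union> (parcs G)\<inverse>" "lev u < lev v" by blast
      from rtrancl_on_into_rtrancl_on[OF less.hyps[OF u(3,1)] u(2) less.prems] show ?thesis .
    qed (use assms(1) in simp)
  qed
  show ?thesis
    unfolding connected_iff
    using assms(1) * rtrancl_on_sym rtrancl_on_trans by (metis empty_iff)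
qed

lemma levels_of_connected:
  assumes "Digraph_Component.connected (with_proj G)" "finite (pverts G)" "r \<in> pverts G"
  obtains lev :: "'a \<Rightarrow> nat" where "\<And>v. lev v \<le> card (pverts G)"
    "\<And>v. v \<in> pverts G \<Longrightarrow> v \<noteq> r \<Longrightarrow>
      \<exists>u\<in>pverts G. (u, v) \<in> parcs G \<union> (parcs G)\<inverse> \<and> lev u < lev v"
proof -
  define R where "R = (parcs G \<union> (parcs G)\<inverse>) \<inter> pverts G \<times> pverts G"
  have "(u, v) \<in> rtrancl_on (pverts G) (parcs G \<union> (parcs G)\<inverse>) \<Longrightarrow> (u, v) \<in> R\<^sup>*" for u v
  proof (induction rule: rtrancl_on_induct)
    case (step y z)
    then have "(y, z) \<in> R" by (simp add: R_def)
    with step show ?case by simp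
  qed simp
  then have reach: "\<exists>k. (r, v) \<in> R ^^ k" if "v \<in> pverts G" for v
    using assms(1,3) that unfolding connected_iff by (meson rtrancl_power)
  define d where "d v = (LEAST k. (r, v) \<in> R ^^ k)" for v
  have d: "(r, v) \<in> R ^^ d v" if "v \<in> pverts G" for v
    unfolding d_def using reach[OF that] by (rule LeastI_ex)
  \<comment> \<open>Counting the vertices nearer to the root, instead of taking the distance itself,
    makes the bound by the number of vertices immediate for every argument.\<close>
  define lev where "lev v = card {u \<in> pverts G. d u < d v}" for v
  show thesis
  proof (rule that[of lev])
    show "lev v \<le> card (pverts G)" for v
      unfolding lev_def using assms(2) by (intro card_mono) auto
    fix v assume v: "v \<in> pverts G" "v \<noteq> r"
    have "d v \<noteq> 0" using d[OF v(1)] v(2) by (metis relpow_0_E)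
    then obtain k where k: "d v = Suc k" using not0_implies_Suc by blast
    with d[OF v(1)] obtain u where u: "(r, u) \<in> R ^^ k" "(u, v) \<in> R" by auto
    have "d u \<le> k" unfolding d_def by (rule Least_le) (rule u)
    then have lt: "d u < d v" using k by simp
    have uV: "u \<in> pverts G" using u(2) by (simp add: R_def)
    have "{w \<in> pverts G. d w < d u} \<subset> {w \<in> pverts G. d w < d v}"
      using lt uV by auto
    then have "lev u < lev v" unfolding lev_def using assms(2) by (intro psubset_card_mono) auto
    with u(2) uV show "\<exists>u\<in>pverts G. (u, v) \<in> parcs G \<union> (parcs G)\<inverse> \<and> lev u < lev v"
      by (auto simp: R_def)
  qed
qed


section \<open>Potentials and shortest paths as dual problems\<close>

section \<open>Potentials\<close>

lemma vwalk_arcs_zip: "vwalk_arcs P = zip P (tl P)"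
  by (induction P rule: vwalk_arcs.induct) auto

lemma path_length_simps [simp]:
  "path_length w [] = 0" "path_length w [x] = 0"
  "path_length w (x # y # P) = w (x, y) + path_length w (y # P)"
  by (auto simp: path_length_def)

lemma potential_le_path_length:
  assumes "P \<noteq> []" "\<And>u v. (u, v) \<in> set (vwalk_arcs P) \<Longrightarrow> \<pi> v \<le> \<pi> u + w (u, v)"
  shows "\<pi> (last P) \<le> \<pi> (hd P) + path_length w P"
  using assms
proof (induction P rule: vwalk_arcs.induct)
  case (3 x y P)
  then have "\<pi> (last (y # P)) \<le> \<pi> y + path_length w (y # P)" "\<pi> y \<le> \<pi> x + w (x, y)"
    by simp_all
  then show ?case by (simp del: last.simps add: last_ConsR)
qed auto

lemma potential_eq_path_length:
  assumes "P \<noteq> []" "\<And>u v. (u, v) \<in> set (vwalk_arcs P) \<Longrightarrow> \<pi> v = \<pi> u + w (u, v)"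
  shows "\<pi> (last P) = \<pi> (hd P) + path_length w P"
  using assms
proof (induction P rule: vwalk_arcs.induct)
  case (3 x y P)
  then have "\<pi> (last (y # P)) = \<pi> y + path_length w (y # P)" "\<pi> y = \<pi> x + w (x, y)"
    by simp_all
  then show ?case by (simp del: last.simps add: last_ConsR)
qed auto

text \<open>The slacks of the arc inequalities are nonnegative and their sum along \<open>P\<close>
  is at most zero, so each of them vanishes.\<close>

lemma potential_tight:
  assumes "P \<noteq> []" "\<And>u v. (u, v) \<in> set (vwalk_arcs P) \<Longrightarrow> \<pi> v \<le> \<pi> u + w (u, v)"
    "\<pi> (hd P) + path_length w P \<le> \<pi> (last P)" "(u, v) \<in> set (vwalk_arcs P)"
  shows "\<pi> v = \<pi> u + w (u, v)"
  using assms
proof (induction P rule: vwalk_arcs.induct)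
  case (3 x y P)
  have 1: "\<pi> y \<le> \<pi> x + w (x, y)" using "3.prems" by simp
  have 2: "\<pi> (last (y # P)) \<le> \<pi> y + path_length w (y # P)"
    using potential_le_path_length[of "y # P" \<pi> w] "3.prems" by simp
  have 3: "\<pi> x + (w (x, y) + path_length w (y # P)) \<le> \<pi> (last (y # P))"
    using "3.prems"(3) by (simp del: last.simps add: last_ConsR)
  show ?case
  proof (cases "(u, v) = (x, y)")
    case True
    then show ?thesis using 1 2 3 by auto
  next
    case False
    have "\<pi> y + path_length w (y # P) \<le> \<pi> (last (y # P))" using 1 3 by linarith
    then show ?thesis
      by (intro "3.IH") (use "3.prems" False in \<open>auto simp del: last.simps simp: last_ConsR\<close>)
  qed
qed auto

lemma path_between_iff:
  "path_between G s t P \<longleftrightarrow> P \<noteq> [] \<and> set P \<subseteq> pverts G \<and> set (vwalk_arcs P) \<subseteq> parcs G \<and>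
     distinct P \<and> hd P = s \<and> last P = t"
  by (auto simp: path_between_def vpath_def vwalk_def)

text \<open>Weak duality: the difference of the potentials at the ends is a lower bound for the
  length of every path, and \<open>P\<close> attains it.\<close>

lemma shortest_of_potential:
  assumes "path_between G s t P"
    and "\<And>u v. (u, v) \<in> parcs G \<Longrightarrow> \<pi> v \<le> \<pi> u + w (u, v)"
    and "\<And>u v. (u, v) \<in> set (vwalk_arcs P) \<Longrightarrow> \<pi> v = \<pi> u + w (u, v)"
  shows "shortest_path G w s t P"
  unfolding shortest_path_def
proof (intro conjI allI impI assms(1))
  fix Q assume Q: "path_between G s t Q"
  have "\<pi> (last P) = \<pi> (hd P) + path_length w P"
    using assms(1,3) by (intro potential_eq_path_length) (auto simp: path_between_iff)
  moreover have "\<pi> (last Q) \<le> \<pi> (hd Q) + path_length w Q"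
    using Q assms(2) by (intro potential_le_path_length) (auto simp: path_between_iff)
  ultimately show "path_length w P \<le> path_length w Q"
    using Q assms(1) by (simp add: path_between_iff)
qed

lemma path_length_append:
  "P \<noteq> [] \<Longrightarrow> Q \<noteq> [] \<Longrightarrow> path_length w (P @ Q) = path_length w P + w (last P, hd Q) + path_length w Q"
  by (simp add: path_length_def vwalk_arcs_append)

lemma path_length_nonneg:
  "(\<And>e. e \<in> set (vwalk_arcs P) \<Longrightarrow> 0 \<le> w e) \<Longrightarrow> 0 \<le> path_length w P"
  unfolding path_length_def by (rule sum_list_nonneg) fastforce

text \<open>If \<open>v\<close> already lies on \<open>P\<close>, appending it would repeat a
  vertex. The part of \<open>P\<close> up to \<open>v\<close> serves instead and is no longer,
  because weights are nonnegative.\<close>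

lemma path_between_extend:
  assumes w: "\<And>e. e \<in> parcs G \<Longrightarrow> 0 \<le> w e" and P: "path_between G s u P"
    and uv: "(u, v) \<in> parcs G" "v \<in> pverts G"
  obtains Q where "path_between G s v Q" "path_length w Q \<le> path_length w P + w (u, v)"
proof (cases "v \<in> set P")
  case False
  have "path_between G s v (P @ [v])"
    using P uv False by (auto simp: path_between_iff vwalk_arcs_append)
  moreover have "path_length w (P @ [v]) = path_length w P + w (u, v)"
    using P by (simp add: path_length_append path_between_iff)
  ultimately show thesis using that by simp
next
  case True
  then obtain A B where AB: "P = A @ v # B" by (meson split_list)
  let ?Q = "A @ [v]"
  have sub: "set (vwalk_arcs ?Q) \<subseteq> parcs G"
    using P set_vwalk_arcs_append1[of ?Q B] by (auto simp: AB path_between_iff)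
  have 1: "path_between G s v ?Q"
    using P sub by (cases A) (auto simp: AB path_between_iff)
  have "path_length w ?Q \<le> path_length w P"
  proof (cases "B = []")
    case False
    have "P = ?Q @ B" by (simp add: AB)
    then have "path_length w P = path_length w ?Q + w (v, hd B) + path_length w B"
      using path_length_append[of ?Q B w] False by simp
    moreover have "set (vwalk_arcs B) \<subseteq> parcs G" "(v, hd B) \<in> parcs G"
      using P False vwalk_arcs_append[of ?Q B] by (auto simp: AB path_between_iff)
    moreover from this have "0 \<le> w (v, hd B)" "0 \<le> path_length w B"
      using w by (auto intro!: path_length_nonneg)
    ultimately show ?thesis by linarith
  qed (simp add: AB)
  with 1 w[OF uv(1)] show thesis using that by fastforce
qed

lemma finite_paths: "finite (pverts G) \<Longrightarrow> finite {Q. path_between G s v Q}"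
  by (rule finite_subset[OF _ finite_subset_distinct]) (auto simp: path_between_iff)

text \<open>Truncating the distances from \<open>s\<close> at the distance of \<open>t\<close> keeps them finite.\<close>

definition cut_dist :: "'a pair_pre_digraph \<Rightarrow> ('a \<times> 'a \<Rightarrow> rat) \<Rightarrow> 'a \<Rightarrow> rat \<Rightarrow> 'a \<Rightarrow> rat" where
  "cut_dist G w s B v = Min (insert B (path_length w ` {Q. path_between G s v Q}))"

text \<open>Every value is the length of some path, which later yields a common denominator. The
  last two facts are the feasibility of a dual solution and complementary slackness along
  \<open>P\<close>.\<close>

lemma cut_dist_props:
  assumes fin: "finite (pverts G)" and w: "\<And>e. e \<in> parcs G \<Longrightarrow> 0 \<le> w e"
    and ends: "parcs G \<subseteq> pverts G \<times> pverts G"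
    and P: "shortest_path G w s t P" and B: "B = path_length w P"
  shows "cut_dist G w s B v = B \<or> (\<exists>Q. path_between G s v Q \<and> cut_dist G w s B v = path_length w Q)"
    "cut_dist G w s B v \<le> B"
    "(u, v) \<in> parcs G \<Longrightarrow> cut_dist G w s B v \<le> cut_dist G w s B u + w (u, v)"
    "(u, v) \<in> set (vwalk_arcs P) \<Longrightarrow> cut_dist G w s B v = cut_dist G w s B u + w (u, v)"
proof -
  let ?S = "\<lambda>v. insert B (path_length w ` {Q. path_between G s v Q})"
  let ?d = "cut_dist G w s B"
  have fS: "finite (?S v)" for v
    using finite_paths[OF fin] by simp
  have mem: "?d v \<in> ?S v" for v
    unfolding cut_dist_def using Min_in[OF fS] by blast
  then show 1: "?d v = B \<or> (\<exists>Q. path_between G s v Q \<and> ?d v = path_length w Q)" for v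
    by auto
  have le: "x \<in> ?S v \<Longrightarrow> ?d v \<le> x" for x v
    unfolding cut_dist_def using Min_le[OF fS] by blast
  show 2: "?d v \<le> B" for v
    by (rule le) simp
  show 3: "?d v \<le> ?d u + w (u, v)" if uv: "(u, v) \<in> parcs G" for u v
    using 1[of u]
  proof
    assume "?d u = B"
    then show ?thesis using 2[of v] w[OF uv] by simp
  next
    assume "\<exists>Q. path_between G s u Q \<and> ?d u = path_length w Q"
    then obtain Q where Q: "path_between G s u Q" "?d u = path_length w Q" by blast
    obtain Q' where "path_between G s v Q'" "path_length w Q' \<le> path_length w Q + w (u, v)"
      using path_between_extend[of G w s u Q v, OF w Q(1) uv] ends uv by blast
    then show ?thesis using le[of "path_length w Q'" v] Q(2) by fastforce
  qed
  assume uv: "(u, v) \<in> set (vwalk_arcs P)"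
  have P': "path_between G s t P" using P by (simp add: shortest_path_def)
  have "path_between G s s [s]"
    using P' by (auto simp: path_between_iff)
  then have "?d s \<le> 0" using le[of "path_length w [s]" s] by (simp add: image_iff) (metis path_length_simps(2))
  \<comment> \<open>\<open>P\<close> is shortest, so no path length undercuts \<open>B\<close> at
    \<open>t\<close>. With a value of at most 0 at \<open>s\<close> this leaves no slack along
    \<open>P\<close>.\<close>
  moreover have "?d t = B"
    using 1[of t] 2[of t] P unfolding shortest_path_def B by force
  ultimately have "?d (hd P) + path_length w P \<le> ?d (last P)"
    using P' by (simp add: path_between_iff B)
  then show "?d v = ?d u + w (u, v)"
    using P' 3 uv by (intro potential_tight[where P = P]) (auto simp: path_between_iff)
qed


section \<open>Soundness and completeness of the certificate\<close>

section \<open>Checking a certificate\<close>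

type_synonym edge = "(nat \<times> nat) \<times> (nat \<times> nat)"

text \<open>\<open>arc_list\<close> on bare components and with projections, since the
  \<open>pt\<close> rules follow projections and not pattern matching.\<close>

definition arcs_of :: "bool \<Rightarrow> edge list \<Rightarrow> edge list" where
  "arcs_of d es = (if d then es else es @ map (\<lambda>e. ((snd (fst e), fst (fst e)), snd e)) es)"

text \<open>With \<open>n\<close> in binary the vertices cannot be counted off, so they are
  collected from the edges. In a connected graph this misses at most the vertex of a one-vertex
  graph, for which 0 is added.\<close>

definition vert_list :: "edge list \<Rightarrow> nat list" where
  "vert_list es = dedup (0 # map (\<lambda>e. fst (fst e)) es @ map (\<lambda>e. snd (fst e)) es)"

definition graph_ok :: "bool \<Rightarrow> nat \<Rightarrow> edge list \<Rightarrow> bool" where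
  "graph_ok d n es \<longleftrightarrow> distinct (map fst (arcs_of d es)) \<and>
     (\<forall>e\<in>set es. fst (fst e) \<noteq> snd (fst e) \<and> 0 < fst (snd e) \<and> 0 < snd (snd e)) \<and>
     (\<forall>v\<in>set (vert_list es). v < n) \<and> length (vert_list es) = n"

text \<open>A level missing from the list counts as 0. This is sound, because
  \<open>connected_of_levels\<close> accepts any function to the natural numbers.\<close>

definition levels_ok :: "edge list \<Rightarrow> nat list \<Rightarrow> bool" where
  "levels_ok es l \<longleftrightarrow> (\<forall>v\<in>set (vert_list es). v = 0 \<or>
     (\<exists>e\<in>set es. (snd (fst e) = v \<and> nth_or 0 l (fst (fst e)) < nth_or 0 l v) \<or>
        (fst (fst e) = v \<and> nth_or 0 l (snd (fst e)) < nth_or 0 l v)))"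

text \<open>The potential of \<open>v\<close> is \<open>a\<^sub>v / m\<close>; the inequalities are multiplied out.\<close>

definition path_ok :: "bool \<Rightarrow> edge list \<Rightarrow> nat list \<Rightarrow> nat \<Rightarrow> nat list \<Rightarrow> bool" where
  "path_ok d es P m a \<longleftrightarrow> P \<noteq> [] \<and> distinct P \<and> (\<forall>v\<in>set P. v \<in> set (vert_list es)) \<and> 0 < m \<and>
     (\<forall>e\<in>set (arcs_of d es). nth_or 0 a (snd (fst e)) * snd (snd e) \<le>
        nth_or 0 a (fst (fst e)) * snd (snd e) + fst (snd e) * m) \<and>
     (\<forall>q\<in>set (zip P (tl P)). \<exists>e\<in>set (arcs_of d es). fst e = q \<and>
        nth_or 0 a (snd q) * snd (snd e) = nth_or 0 a (fst q) * snd (snd e) + fst (snd e) * m)"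

definition neighbour_list :: "bool \<Rightarrow> edge list \<Rightarrow> nat list \<Rightarrow> nat list" where
  "neighbour_list d es P = filter (\<lambda>v. v \<notin> set P \<and> (\<exists>e\<in>set (arcs_of d es). fst (fst e) \<in> set P \<and> snd (fst e) = v))
     (vert_list es)"

lemma arc_list_arcs: "arc_list X = arcs_of (directed X) (edges X)"
  by (simp add: arc_list_def arcs_of_def case_prod_beta)

lemma set_vert_list: "set (vert_list es) = insert 0 ((\<lambda>e. fst (fst e)) ` set es \<union> (\<lambda>e. snd (fst e)) ` set es)"
  by (auto simp: vert_list_def)

lemma distinct_vert_list: "distinct (vert_list es)"
  by (simp add: vert_list_def)

lemma graph_of_simps [simp]:
  "pverts (graph_of X) = {..<num_verts X}" "parcs (graph_of X) = fst ` set (arc_list X)"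
  by (auto simp: graph_of_def)

text \<open>Weak connectedness depends on the symmetric closure only, so levels can be checked on
  the edge list of either kind of graph.\<close>

lemma arcs_sym: "fst ` set (arcs_of d es) \<union> (fst ` set (arcs_of d es))\<inverse> = fst ` set es \<union> (fst ` set es)\<inverse>"
  by (force simp: arcs_of_def image_iff)

lemma arcs_edges: "e \<in> set (arcs_of d es) \<Longrightarrow>
    \<exists>e'\<in>set es. snd e' = snd e \<and> (fst e' = fst e \<or> fst e' = (snd (fst e), fst (fst e)))"
  by (force simp: arcs_of_def split: if_splits)

lemma weight_of_arc:
  "distinct (map fst (arc_list X)) \<Longrightarrow> (e, (a, b)) \<in> set (arc_list X) \<Longrightarrow>
     weight_of X e = of_nat a / of_nat b"
  by (simp add: weight_of_def)

text \<open>There are only \<open>n\<close> numbers below \<open>n\<close>, so \<open>n\<close>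
  distinct ones exhaust them.\<close>

lemma graph_ok_verts:
  assumes "graph_ok d n es"
  shows "set (vert_list es) = {..<n}"
proof (rule card_subset_eq)
  show "card (set (vert_list es)) = card {..<n}"
    using assms distinct_card[OF distinct_vert_list, of es] by (simp add: graph_ok_def)
qed (use assms in \<open>auto simp: graph_ok_def\<close>)

lemma pair_digraph_iff:
  "pair_digraph G \<longleftrightarrow> finite (pverts G) \<and> finite (parcs G) \<and>
     (\<forall>(u, v)\<in>parcs G. u \<in> pverts G \<and> v \<in> pverts G \<and> u \<noteq> v)"
  by (auto simp: pair_digraph_def pair_fin_digraph_def pair_fin_digraph_axioms_def
      pair_wf_digraph_def pair_loopfree_digraph_def pair_loopfree_digraph_axioms_def)

lemma wf_wgraphI:
  assumes ok: "graph_ok (directed X) (num_verts X) (edges X)" and l: "levels_ok (edges X) l"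
  shows "wf_wgraph X"
proof -
  let ?es = "edges X" and ?G = "graph_of X" and ?A = "arcs_of (directed X) (edges X)"
  note V = graph_ok_verts[OF ok]
  have e: "fst (fst e) \<noteq> snd (fst e) \<and> 0 < fst (snd e) \<and> 0 < snd (snd e) \<and>
      fst (fst e) < num_verts X \<and> snd (fst e) < num_verts X" if "e \<in> set ?es" for e
    using that ok unfolding graph_ok_def by (auto simp: set_vert_list)
  have a: "fst (fst e) \<noteq> snd (fst e) \<and> 0 < fst (snd e) \<and> 0 < snd (snd e) \<and>
      fst (fst e) < num_verts X \<and> snd (fst e) < num_verts X" if eA: "e \<in> set ?A" for e
  proof -
    obtain e' where e': "e' \<in> set ?es" "snd e' = snd e" "fst e' = fst e \<or> fst e' = (snd (fst e), fst (fst e))"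
      using arcs_edges[OF eA] by blast
    from e[OF e'(1)] e'(2,3) show ?thesis by (cases "fst e' = fst e") auto
  qed
  have d: "distinct (map fst (arc_list X))"
    using ok by (simp add: graph_ok_def arc_list_arcs)
  have "pair_digraph ?G"
  proof -
    have "u < num_verts X \<and> v < num_verts X \<and> u \<noteq> v" if uv: "(u, v) \<in> parcs ?G" for u v
    proof -
      obtain ab where "((u, v), ab) \<in> set ?A" using uv by (auto simp: arc_list_arcs)
      from a[OF this] show ?thesis by simp
    qed
    then show ?thesis unfolding pair_digraph_iff by (auto simp del: graph_of_simps(2)) simp
  qed
  moreover have "Digraph_Component.connected (with_proj ?G)"
  proof (rule connected_of_levels[where r = 0 and lev = "nth_or 0 l"])
    show "0 \<in> pverts ?G" using V by (auto simp: set_vert_list)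
    fix v assume v: "v \<in> pverts ?G" "v \<noteq> 0"
    then have "v \<in> set (vert_list ?es)" using V by simp
    from bspec[OF l[unfolded levels_ok_def] this] v(2) obtain e where es: "e \<in> set ?es" "(snd (fst e) = v \<and> nth_or 0 l (fst (fst e)) < nth_or 0 l v) \<or>
        (fst (fst e) = v \<and> nth_or 0 l (snd (fst e)) < nth_or 0 l v)"
      by blast
    have R: "parcs ?G \<union> (parcs ?G)\<inverse> = fst ` set ?es \<union> (fst ` set ?es)\<inverse>"
      by (simp add: arc_list_arcs arcs_sym)
    obtain x y where xy: "fst e = (x, y)" by (cases "fst e")
    then have "(x, y) \<in> fst ` set ?es" using es(1) by force
    then have "(x, y) \<in> parcs ?G \<union> (parcs ?G)\<inverse>" "(y, x) \<in> parcs ?G \<union> (parcs ?G)\<inverse>"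
      unfolding R by simp_all
    then show "\<exists>u\<in>pverts ?G. (u, v) \<in> parcs ?G \<union> (parcs ?G)\<inverse> \<and> nth_or 0 l u < nth_or 0 l v"
      using es(2) e[OF es(1)] xy by (auto simp del: graph_of_simps(2))
  qed
  moreover have "0 < weight_of X q" if "q \<in> parcs ?G" for q
  proof -
    obtain a' b where ab: "(q, (a', b)) \<in> set (arc_list X)" using \<open>q \<in> parcs ?G\<close> by auto
    then show ?thesis
      using weight_of_arc[OF d ab] a[of "(q, (a', b))"] by (simp add: arc_list_arcs)
  qed
  ultimately show ?thesis
    unfolding wf_wgraph_def weighted_graph_def using d e by auto
qed

lemma wf_wgraphD:
  assumes "wf_wgraph X"
  shows "distinct (map fst (arc_list X))"
    and "e \<in> set (arc_list X) \<Longrightarrow> fst (fst e) \<noteq> snd (fst e) \<and> 0 < fst (snd e) \<and> 0 < snd (snd e) \<and>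
      fst (fst e) < num_verts X \<and> snd (fst e) < num_verts X"
    and "Digraph_Component.connected (with_proj (graph_of X))"
proof -
  show d: "distinct (map fst (arc_list X))" "Digraph_Component.connected (with_proj (graph_of X))"
    using assms by (auto simp: wf_wgraph_def weighted_graph_def)
  assume e: "e \<in> set (arc_list X)"
  obtain u v a b where uv: "e = ((u, v), (a, b))" by (cases e) auto
  have b: "0 < b"
  proof -
    obtain e' where e': "e' \<in> set (edges X)" "snd e' = snd e"
      using arcs_edges e by (metis arc_list_arcs)
    moreover have "case e' of (q, (a, b)) \<Rightarrow> 0 < b"
      using assms e'(1) unfolding wf_wgraph_def by blast
    ultimately show ?thesis using uv by (cases e') auto
  qed
  have "(u, v) \<in> parcs (graph_of X)"
    using e uv by force
  then have "u < num_verts X" "v < num_verts X" "u \<noteq> v" "0 < weight_of X (u, v)"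
    using assms unfolding wf_wgraph_def weighted_graph_def pair_digraph_iff by auto
  then show "fst (fst e) \<noteq> snd (fst e) \<and> 0 < fst (snd e) \<and> 0 < snd (snd e) \<and>
      fst (fst e) < num_verts X \<and> snd (fst e) < num_verts X"
    using weight_of_arc[OF d(1) e[unfolded uv]] b by (simp add: uv zero_less_divide_iff)
qed

lemma wf_wgraph_levels:
  assumes wf: "wf_wgraph X"
  obtains l where "length l = num_verts X" "\<And>k. k \<in> set l \<Longrightarrow> k \<le> num_verts X"
    "levels_ok (edges X) l" "graph_ok (directed X) (num_verts X) (edges X)"
proof -
  let ?es = "edges X" and ?G = "graph_of X"
  note D = wf_wgraphD[OF wf]
  have n0: "0 \<in> pverts ?G"
    using D(3) by (auto simp: connected_iff)
  have fin: "finite (pverts ?G)" by simp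
  obtain lev :: "nat \<Rightarrow> nat" where lev0: "\<And>v. lev v \<le> card (pverts ?G)"
    "\<And>v. v \<in> pverts ?G \<Longrightarrow> v \<noteq> 0 \<Longrightarrow>
      \<exists>u\<in>pverts ?G. (u, v) \<in> parcs ?G \<union> (parcs ?G)\<inverse> \<and> lev u < lev v"
    by (rule levels_of_connected[OF D(3) fin n0]) (rule that)
  have lev: "lev v \<le> num_verts X" for v using lev0(1) by simp
  have R: "parcs ?G \<union> (parcs ?G)\<inverse> = fst ` set ?es \<union> (fst ` set ?es)\<inverse>"
    by (simp add: arc_list_arcs arcs_sym)
  have es: "e \<in> set ?es \<Longrightarrow> e \<in> set (arc_list X)" for e
    by (auto simp: arc_list_def)
  define l where "l = map lev [0..<num_verts X]"
  have l: "nth_or 0 l v = lev v" if "v < num_verts X" for v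
    using that by (simp add: nth_or_def l_def)
  have step: "\<exists>e\<in>set ?es. (snd (fst e) = v \<and> lev (fst (fst e)) < lev v) \<or>
        (fst (fst e) = v \<and> lev (snd (fst e)) < lev v)" if v: "v < num_verts X" "v \<noteq> 0" for v
  proof -
    from lev0(2)[of v] v obtain u where u: "(u, v) \<in> fst ` set ?es \<union> (fst ` set ?es)\<inverse>"
      "lev u < lev v" unfolding R[symmetric] by (auto simp del: graph_of_simps(2))
    then obtain e where "e \<in> set ?es" "fst e = (u, v) \<or> fst e = (v, u)" by auto
    then show ?thesis using u(2) by (intro bexI[of _ e]) auto
  qed
  \<comment> \<open>A vertex other than 0 has a neighbour of lower level, so it is an end of some
    edge.\<close>
  have V: "set (vert_list ?es) = {..<num_verts X}"
  proof
    show "set (vert_list ?es) \<subseteq> {..<num_verts X}"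
      using D(2)[OF es] n0 by (auto simp: set_vert_list)
    show "{..<num_verts X} \<subseteq> set (vert_list ?es)"
    proof
      fix v assume "v \<in> {..<num_verts X}"
      then show "v \<in> set (vert_list ?es)"
        using step[of v] by (cases "v = 0") (auto simp: set_vert_list)
    qed
  qed
  show thesis
  proof (rule that)
    show "length l = num_verts X" by (simp add: l_def)
    show "\<And>k. k \<in> set l \<Longrightarrow> k \<le> num_verts X" using lev by (auto simp: l_def)
    have ends: "fst (fst e) < num_verts X" "snd (fst e) < num_verts X" if "e \<in> set ?es" for e
      using D(2)[OF es[OF that]] by auto
    show "levels_ok ?es l"
      unfolding levels_ok_def V
    proof
      fix v assume "v \<in> {..<num_verts X}"
      then have v: "v < num_verts X" by simp
      show "v = 0 \<or> (\<exists>e\<in>set ?es. (snd (fst e) = v \<and> nth_or 0 l (fst (fst e)) < nth_or 0 l v) \<or>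
          (fst (fst e) = v \<and> nth_or 0 l (snd (fst e)) < nth_or 0 l v))"
      proof (cases "v = 0")
        case False
        with step[OF v] obtain e where "e \<in> set ?es" "(snd (fst e) = v \<and> lev (fst (fst e)) < lev v) \<or>
          (fst (fst e) = v \<and> lev (snd (fst e)) < lev v)" by blast
        then show ?thesis using l[OF v] l[OF ends(1)[of e]] l[OF ends(2)[of e]] by auto
      qed simp
    qed
    show "graph_ok (directed X) (num_verts X) ?es"
      using D(1) D(2)[OF es] distinct_card[OF distinct_vert_list, of ?es]
      by (auto simp: graph_ok_def V arc_list_arcs)
  qed
qed

lemma path_ok_shortest:
  assumes wf: "wf_wgraph X" and ok: "path_ok (directed X) (edges X) P m a"
    and V: "set (vert_list (edges X)) = {..<num_verts X}"
  shows "shortest_path (graph_of X) (weight_of X) (hd P) (last P) P"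
proof (rule shortest_of_potential[where \<pi> = "\<lambda>v. of_nat (nth_or 0 a v) / of_nat m"])
  let ?A = "arcs_of (directed X) (edges X)"
  note D = wf_wgraphD[OF wf]
  have m: "0 < m" using ok by (simp add: path_ok_def)
  have P: "\<exists>e\<in>set ?A. fst e = q \<and>
        nth_or 0 a (snd q) * snd (snd e) = nth_or 0 a (fst q) * snd (snd e) + fst (snd e) * m"
    if "q \<in> set (vwalk_arcs P)" for q
    using ok that by (simp add: path_ok_def vwalk_arcs_zip)
  show "path_between (graph_of X) (hd P) (last P) P"
  proof -
    have "q \<in> parcs (graph_of X)" if q: "q \<in> set (vwalk_arcs P)" for q
      using P[OF q] by (auto simp: arc_list_arcs)
    then show ?thesis
      using ok V unfolding path_between_iff path_ok_def by (auto simp del: graph_of_simps(2))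
  qed
  fix u v
  \<comment> \<open>Over the common denominator \<open>m * b\<close> the rational conditions become
    those of \<open>path_ok\<close>.\<close>
  have frac: "of_nat x / of_nat m \<le> of_nat y / of_nat m + (of_nat k / of_nat b :: rat) \<longleftrightarrow>
      x * b \<le> y * b + k * m" "of_nat x / of_nat m = of_nat y / of_nat m + (of_nat k / of_nat b :: rat) \<longleftrightarrow>
      x * b = y * b + k * m" if "0 < b" for x y k b
  proof -
    have "of_nat x / of_nat m = (of_nat (x * b) / of_nat (m * b) :: rat)"
      "of_nat y / of_nat m + of_nat k / of_nat b = (of_nat (y * b + k * m) / of_nat (m * b) :: rat)"
      using m that by (simp_all add: field_simps)
    moreover have "0 < (of_nat (m * b) :: rat)" using m that by simp
    ultimately show "of_nat x / of_nat m \<le> of_nat y / of_nat m + (of_nat k / of_nat b :: rat) \<longleftrightarrow>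
      x * b \<le> y * b + k * m" "of_nat x / of_nat m = of_nat y / of_nat m + (of_nat k / of_nat b :: rat) \<longleftrightarrow>
      x * b = y * b + k * m"
      by (simp_all only: divide_le_cancel divide_cancel_right of_nat_le_iff of_nat_eq_iff) auto
  qed
  show "of_nat (nth_or 0 a v) / of_nat m \<le> of_nat (nth_or 0 a u) / of_nat m + weight_of X (u, v)"
    if uv: "(u, v) \<in> parcs (graph_of X)"
  proof -
    obtain k b where kb: "((u, v), (k, b)) \<in> set (arc_list X)" using uv by auto
    have "nth_or 0 a v * b \<le> nth_or 0 a u * b + k * m"
      using bspec[OF conjunct1[OF conjunct2[OF conjunct2[OF conjunct2[OF conjunct2[OF
            ok[unfolded path_ok_def]]]]]] kb[unfolded arc_list_arcs]] by simp
    then show ?thesis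
      using weight_of_arc[OF D(1) kb] D(2)[OF kb] by (simp add: frac)
  qed
  show "of_nat (nth_or 0 a v) / of_nat m = of_nat (nth_or 0 a u) / of_nat m + weight_of X (u, v)"
    if uv: "(u, v) \<in> set (vwalk_arcs P)"
  proof -
    obtain k b where kb: "((u, v), (k, b)) \<in> set (arc_list X)"
      "nth_or 0 a v * b = nth_or 0 a u * b + k * m" using P[OF uv] by (auto simp: arc_list_arcs)
    then show ?thesis
      using weight_of_arc[OF D(1) kb(1)] D(2)[OF kb(1)] by (simp add: frac)
  qed
qed

lemma degree_centrality_neighbour_list:
  assumes "set (vert_list (edges X)) = {..<num_verts X}" "wf_wgraph X"
  shows "degree_centrality (graph_of X) P = length (neighbour_list (directed X) (edges X) P)"
proof -
  have "neighbourhood (graph_of X) P = set (neighbour_list (directed X) (edges X) P)"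
  proof (intro set_eqI iffI)
    fix v assume "v \<in> neighbourhood (graph_of X) P"
    then obtain u ab where u: "u \<in> set P" "v \<notin> set P" "((u, v), ab) \<in> set (arc_list X)"
      by (auto simp: neighbourhood_def)
    then show "v \<in> set (neighbour_list (directed X) (edges X) P)"
      using wf_wgraphD(2)[OF assms(2) u(3)]
      by (auto simp: neighbour_list_def assms(1) arc_list_arcs intro!: bexI[of _ "((u, v), ab)"])
  next
    fix v assume "v \<in> set (neighbour_list (directed X) (edges X) P)"
    then obtain e where e: "e \<in> set (arc_list X)" "fst (fst e) \<in> set P" "snd (fst e) = v" "v \<notin> set P"
      by (auto simp: neighbour_list_def arc_list_arcs)
    have "(fst (fst e), v) \<in> parcs (graph_of X)"
      using imageI[OF e(1), of fst] e(3) by (cases "fst e") simp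
    then show "v \<in> neighbourhood (graph_of X) P"
      using e(2,4) unfolding neighbourhood_def by blast
  qed
  then show ?thesis
    unfolding degree_centrality_def
    using distinct_card[of "neighbour_list (directed X) (edges X) P"]
    by (simp add: neighbour_list_def distinct_vert_list)
qed

lemma dvd_prod_list_nat: "x \<in> set xs \<Longrightarrow> (x :: nat) dvd prod_list xs"
  by (induction xs) auto

text \<open>The product \<open>m\<close> of all denominators clears every path length and hence
  every value of the truncated distance. Truncation also bounds the values by the length of
  \<open>P\<close>, at most \<open>num_verts X * M\<close>, so that the certificate stays
  short.\<close>

lemma path_ok_exists:
  assumes wf: "wf_wgraph X" and P: "shortest_path (graph_of X) (weight_of X) s t P"
    and V: "set (vert_list (edges X)) = {..<num_verts X}"
    and M: "\<And>e. e \<in> set (edges X) \<Longrightarrow> fst (snd e) \<le> M"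
    and m: "m = prod_list (map (\<lambda>e. snd (snd e)) (edges X))"
  obtains a where "path_ok (directed X) (edges X) P m a" "length a = num_verts X"
    "\<And>k. k \<in> set a \<Longrightarrow> k \<le> m * (num_verts X * M)"
proof -
  let ?G = "graph_of X" and ?w = "weight_of X" and ?n = "num_verts X"
  note D = wf_wgraphD[OF wf]
  have b: "snd (snd e) dvd m \<and> fst (snd e) \<le> M" if e: "e \<in> set (arc_list X)" for e
  proof -
    obtain e' where "e' \<in> set (edges X)" "snd e' = snd e"
      using arcs_edges e by (metis arc_list_arcs)
    then show ?thesis
      using M[of e'] dvd_prod_list_nat[of "snd (snd e)" "map (\<lambda>e. snd (snd e)) (edges X)"]
      unfolding m by (metis image_eqI list.set_map)
  qed
  have m0: "0 < m"
  proof -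
    have "0 < snd (snd e)" if "e \<in> set (edges X)" for e
      using D(2)[of e] that by (auto simp: arc_list_def)
    then have "0 \<notin> set (map (\<lambda>e. snd (snd e)) (edges X))" by fastforce
    then show ?thesis unfolding m by (metis gr0I prod_list_zero_iff)
  qed
  have w: "of_nat m * ?w q \<in> \<nat> \<and> 0 \<le> ?w q \<and> ?w q \<le> of_nat M" if q: "q \<in> parcs ?G" for q
  proof -
    obtain k d where kd: "(q, (k, d)) \<in> set (arc_list X)" using q by auto
    have d: "0 < d" "d dvd m" "k \<le> M" using D(2)[OF kd] b[OF kd] by auto
    then obtain c where "m = d * c" by (elim dvdE)
    then have "of_nat m * ?w q = of_nat (c * k)"
      using weight_of_arc[OF D(1) kd] d(1) by simp
    then have "of_nat m * ?w q \<in> \<nat>" by (metis of_nat_in_Nats)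
    \<comment> \<open>Denominators are at least 1, so no weight exceeds the bound on the
      numerators.\<close>
    moreover have "of_nat k \<le> of_nat M * (of_nat d :: rat)"
    proof -
      have "k \<le> M * d" using d(1,3) by (metis Suc_leI le_trans mult_le_mono2 nat_mult_1_right One_nat_def)
      then show ?thesis by (metis of_nat_le_iff of_nat_mult)
    qed
    ultimately show ?thesis
      using weight_of_arc[OF D(1) kd] d(1) by (simp add: divide_le_eq)
  qed
  have len: "of_nat m * path_length ?w Q \<in> \<nat> \<and> path_length ?w Q \<le> of_nat (length Q * M)"
    if "set (vwalk_arcs Q) \<subseteq> parcs ?G" for Q
    using that
  proof (induction Q rule: vwalk_arcs.induct)
    case (3 x y Q)
    then have 1: "of_nat m * ?w (x, y) \<in> \<nat>" "?w (x, y) \<le> of_nat M"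
        "of_nat m * path_length ?w (y # Q) \<in> \<nat>" "path_length ?w (y # Q) \<le> of_nat (length (y # Q) * M)"
      using w[of "(x, y)"] by simp_all
    have "of_nat m * path_length ?w (x # y # Q) = of_nat m * ?w (x, y) + of_nat m * path_length ?w (y # Q)"
      by (simp add: algebra_simps)
    then show ?case using 1 by (auto simp: algebra_simps)
  qed auto
  have P': "path_between ?G s t P" using P by (simp add: shortest_path_def)
  define B where "B = path_length ?w P"
  define \<pi> where "\<pi> = cut_dist ?G ?w s B"
  have ends: "parcs ?G \<subseteq> pverts ?G \<times> pverts ?G"
    using D(2) by (force simp: image_iff)
  note c = cut_dist_props[of ?G ?w s t P B, OF _ _ ends P B_def, folded \<pi>_def]
  have c1: "\<pi> v = B \<or> (\<exists>Q. path_between ?G s v Q \<and> \<pi> v = path_length ?w Q)" for v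
    using c(1) w by simp
  have c2: "\<pi> v \<le> B" for v using c(2) w by simp
  have c3: "\<pi> v \<le> \<pi> u + ?w (u, v)" if "(u, v) \<in> parcs ?G" for u v
    using c(3)[OF _ _ that] w by simp
  have c4: "\<pi> v = \<pi> u + ?w (u, v)" if "(u, v) \<in> set (vwalk_arcs P)" for u v
    using c(4)[OF _ _ that] w by simp
  have PG: "set (vwalk_arcs P) \<subseteq> parcs ?G" using P' by (simp add: path_between_iff)
  have "of_nat m * \<pi> v \<in> \<nat>" for v
    using c1[of v] len[OF PG] len unfolding B_def path_between_iff by auto
  then have "\<forall>v. \<exists>k. of_nat m * \<pi> v = of_nat k" by (auto elim: Nats_cases)
  from choice[OF this] obtain f where f: "\<And>v. of_nat m * \<pi> v = of_nat (f v)" by blast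
  define a where "a = map f [0..<?n]"
  have a: "nth_or 0 a v = f v" if "v < ?n" for v
    using that by (simp add: a_def nth_or_def)
  have fr: "of_nat (f v * d) = of_nat (m * d) * \<pi> v"
    "of_nat (f v * d + k * m) = of_nat (m * d) * (\<pi> v + of_nat k / of_nat d)" if "0 < d" for v d k
    using f[of v] that by (simp_all add: field_simps)
  have le: "f v * d \<le> f u * d + k * m" if kd: "((u, v), (k, d)) \<in> set (arc_list X)" for u v k d
  proof -
    have d: "0 < d" using D(2)[OF kd] by simp
    have "(u, v) \<in> parcs ?G" using kd by force
    from c3[OF this] have "\<pi> v \<le> \<pi> u + of_nat k / of_nat d"
      using weight_of_arc[OF D(1) kd] by simp
    then have "of_nat (f v * d) \<le> (of_nat (f u * d + k * m) :: rat)"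
      unfolding fr[OF d] by (intro mult_left_mono) auto
    then show ?thesis by (simp only: of_nat_le_iff)
  qed
  have eq: "f v * d = f u * d + k * m"
    if kd: "((u, v), (k, d)) \<in> set (arc_list X)" and uv: "(u, v) \<in> set (vwalk_arcs P)" for u v k d
  proof -
    have d: "0 < d" using D(2)[OF kd] by simp
    from c4[OF uv] have "\<pi> v = \<pi> u + of_nat k / of_nat d"
      using weight_of_arc[OF D(1) kd] by simp
    then have "of_nat (f v * d) = (of_nat (f u * d + k * m) :: rat)"
      unfolding fr[OF d] by simp
    then show ?thesis by (simp only: of_nat_eq_iff)
  qed
  have nP: "length P \<le> ?n"
  proof -
    have "length P = card (set P)" using P' by (simp add: path_between_iff distinct_card)
    also have "\<dots> \<le> card {..<?n}" using P' by (intro card_mono) (auto simp: path_between_iff)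
    finally show ?thesis by simp
  qed
  show thesis
  proof (rule that[of a])
    show "length a = ?n" by (simp add: a_def)
    fix k assume "k \<in> set a"
    then obtain v where v: "k = f v" by (auto simp: a_def)
    have "\<pi> v \<le> of_nat (length P * M)"
      using c2[of v] len[OF PG] unfolding B_def by linarith
    then have "of_nat m * \<pi> v \<le> of_nat (m * (length P * M))"
      using mult_left_mono[of "\<pi> v" "of_nat (length P * M)" "of_nat m"] by simp
    then have "k \<le> m * (length P * M)" unfolding f v by (simp only: of_nat_le_iff)
    also have "\<dots> \<le> m * (?n * M)" using nP by (intro mult_le_mono2 mult_le_mono1)
    finally show "k \<le> m * (?n * M)" .
  next
    have 1: "nth_or 0 a (snd (fst e)) * snd (snd e) \<le>
        nth_or 0 a (fst (fst e)) * snd (snd e) + fst (snd e) * m" if e: "e \<in> set (arc_list X)" for e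
      using D(2)[OF e] le[of "fst (fst e)" "snd (fst e)" "fst (snd e)" "snd (snd e)"] e
      by (simp add: a)
    have 2: "\<exists>e\<in>set (arc_list X). fst e = q \<and>
        nth_or 0 a (snd q) * snd (snd e) = nth_or 0 a (fst q) * snd (snd e) + fst (snd e) * m"
      if q: "q \<in> set (vwalk_arcs P)" for q
    proof -
      have "q \<in> parcs ?G" using PG q by blast
      then obtain k d where kd: "(q, (k, d)) \<in> set (arc_list X)" by auto
      then show ?thesis
        using D(2)[OF kd] eq[of "fst q" "snd q" k d] q
        by (intro bexI[of _ "(q, (k, d))"]) (auto simp: a)
    qed
    show "path_ok (directed X) (edges X) P m a"
      using P' m0 1 2 by (auto simp: path_ok_def path_between_iff V arc_list_arcs vwalk_arcs_zip)
  qed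
qed


section \<open>Decoding, the verifier and the length of certificates\<close>

section \<open>The verifier\<close>

definition inst_nats :: "bool \<Rightarrow> nat \<Rightarrow> nat \<Rightarrow> edge list \<Rightarrow> nat list" where
  "inst_nats d n \<alpha> es = [of_bool d, n, \<alpha>] @
     concat (map (\<lambda>e. [fst (fst e), snd (fst e), fst (snd e), snd (snd e)]) es)"

lemma encode_inst_nats: "encode X \<alpha> = encode_nats (inst_nats (directed X) (num_verts X) \<alpha> (edges X))"
proof -
  have "(\<lambda>((u, v), (a, b)). [u, v, a, b]) =
      (\<lambda>e :: edge. [fst (fst e), snd (fst e), fst (snd e), snd (snd e)])"
    by (auto simp: fun_eq_iff)
  then show ?thesis by (simp only: encode_def inst_nats_def)
qed

text \<open>The first component holds the entries of the current quadruple read so far, latest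
  first.\<close>

definition chunk_step :: "nat \<Rightarrow> nat list \<times> edge list \<Rightarrow> nat list \<times> edge list" where
  "chunk_step e s = (if length (fst s) = 3
     then ([], ((hd (tl (tl (fst s))), hd (tl (fst s))), (hd (fst s), e)) # snd s)
     else (e # fst s, snd s))"

definition chunk :: "nat list \<Rightarrow> edge list" where
  "chunk ns = rev (snd (fold chunk_step ns ([], [])))"

lemma chunk_fold:
  "fold chunk_step (concat (map (\<lambda>e. [fst (fst e), snd (fst e), fst (snd e), snd (snd e)]) es)) ([], fs)
    = ([], rev es @ fs)"
  by (induction es arbitrary: fs) (auto simp: chunk_step_def)

lemma chunk_inst_nats: "chunk (tl (tl (tl (inst_nats d n \<alpha> es)))) = es"
  unfolding inst_nats_def chunk_def append.simps list.sel chunk_fold by simp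

lemma PT_chunk [pt]:
  assumes "PT f"
  shows "PT (\<lambda>x. chunk (f x))"
proof -
  have "PT (\<lambda>x. fold chunk_step (f x) ([], []))"
    unfolding chunk_step_def
  proof (rule PT_fold_inc)
    show "bnd (\<lambda>x. 4 + sz (f x))" by (intro bnd_intros bnd_sz assms)
    show "sz (if length (fst s) = 3
       then ([], ((hd (tl (tl (fst s))), hd (tl (fst s))), (hd (fst s), e)) # snd s)
       else (e # fst s, snd s)) \<le> sz s + (4 + sz (f x))" if "e \<in> set (f x)" for x e s
      using sz_mem[OF that] by (cases s) (auto simp: numeral_3_eq_3 length_Suc_conv)
  qed (intro pt assms)+
  then show ?thesis unfolding chunk_def by (intro pt)
qed

definition nats_of :: "bool list \<Rightarrow> nat list" where
  "nats_of x = map val (tokens x)"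

lemma nats_of_encode_nats [simp]: "nats_of (encode_nats ns) = ns"
proof -
  have "encode_nats ns = concat (map delimit (map bits ns))"
    by (simp add: encode_nats_def comp_def)
  then show ?thesis
    by (simp only: nats_of_def tokens_concat_delimit) (simp add: comp_def)
qed

text \<open>The first conjunct encodes the decoded data again and compares with the input. Decoders
  may therefore return anything on malformed words, such as the head of an empty list: such an input
  is rejected.\<close>

definition check_inst :: "bool list \<Rightarrow> bool \<Rightarrow> nat \<Rightarrow> nat \<Rightarrow> edge list \<Rightarrow> nat list \<Rightarrow> nat list \<Rightarrow> nat list \<Rightarrow> bool"
  where
  "check_inst x d n \<alpha> es P a l \<longleftrightarrow> encode_nats (inst_nats d n \<alpha> es) = x \<and> 0 < \<alpha> \<and>
     graph_ok d n es \<and> levels_ok es l \<and> path_ok d es P (hd a) (tl a) \<and>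
     \<alpha> < length (neighbour_list d es P)"

definition check :: "bool list list \<Rightarrow> bool" where
  "check ts \<longleftrightarrow> check_inst (hd ts) (hd (nats_of (hd ts)) = 1) (hd (tl (nats_of (hd ts))))
     (hd (tl (tl (nats_of (hd ts))))) (chunk (tl (tl (tl (nats_of (hd ts))))))
     (nats_of (hd (tl ts))) (nats_of (hd (tl (tl ts)))) (nats_of (hd (tl (tl (tl ts)))))"

definition verifier :: "bool list \<Rightarrow> bool list" where
  "verifier w = [check (tokens w)]"

lemma polytime_verifier: "polytime verifier"
proof (rule polytime_PT)
  show "PT verifier"
    unfolding verifier_def check_def check_inst_def inst_nats_def graph_ok_def levels_ok_def path_ok_def
      neighbour_list_def arcs_of_def vert_list_def nats_of_def
    by (intro pt)
qed

lemma verifier_sound: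
  assumes "verifier (pair_word x u) = [True]"
  shows "x \<in> MDCWSP_D"
proof -
  have "check (x # tokens u)"
    using assms by (simp add: verifier_def pair_word_def tokens_delimit)
  then obtain d n \<alpha> es P a l where c: "check_inst x d n \<alpha> es P a l"
    unfolding check_def list.sel by blast
  define X where "X = \<lparr>directed = d, num_verts = n, edges = es\<rparr>"
  have X [simp]: "directed X = d" "num_verts X = n" "edges X = es"
    by (simp_all add: X_def)
  have wf: "wf_wgraph X"
    using c by (intro wf_wgraphI) (auto simp: check_inst_def)
  have V: "set (vert_list (edges X)) = {..<num_verts X}"
    using c graph_ok_verts by (auto simp: check_inst_def)
  have "shortest_path (graph_of X) (weight_of X) (hd P) (last P) P"
    using c wf V by (intro path_ok_shortest) (auto simp: check_inst_def)
  moreover have "degree_centrality (graph_of X) P > \<alpha>"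
    using degree_centrality_neighbour_list[OF V wf] c by (simp add: check_inst_def)
  moreover have "x = encode X \<alpha>" "0 < \<alpha>"
    using c by (auto simp: encode_inst_nats check_inst_def)
  ultimately show ?thesis
    unfolding MDCWSP_D_def using wf by blast
qed

lemma length_delimit: "length (delimit x) = 2 * length x + 1"
  by (simp add: delimit_def length_concat comp_def sum_list_triv)

lemma length_encode_nats: "length (encode_nats ns) = (\<Sum>n\<leftarrow>ns. 2 * length (bits n) + 1)"
  by (simp add: encode_nats_def length_concat comp_def length_delimit)

lemma length_encode_nats_ge:
  "n \<in> set ns \<Longrightarrow> n < 2 ^ length (encode_nats ns)" "length ns \<le> length (encode_nats ns)"
proof -
  assume "n \<in> set ns"
  then have "2 * length (bits n) + 1 \<le> length (encode_nats ns)"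
    unfolding length_encode_nats by (intro member_le_sum_list) auto
  then have "(2::nat) ^ length (bits n) \<le> 2 ^ length (encode_nats ns)"
    by (intro power_increasing) auto
  with length_bits_bound[of n] show "n < 2 ^ length (encode_nats ns)" by linarith
next
  show "length ns \<le> length (encode_nats ns)"
    unfolding length_encode_nats by (induction ns) auto
qed

lemma length_encode_nats_le:
  "(\<And>n. n \<in> set ns \<Longrightarrow> n < 2 ^ k) \<Longrightarrow> length (encode_nats ns) \<le> length ns * (2 * k + 1)"
proof (induction ns)
  case (Cons n ns)
  then have "length (bits n) \<le> k" by (intro length_bits_le) simp
  with Cons show ?case by (simp add: length_encode_nats)
qed (simp add: length_encode_nats)

lemma prod_list_bound: "(\<forall>n\<in>set ns. 0 < n) \<Longrightarrow> prod_list ns \<le> 2 ^ (\<Sum>n\<leftarrow>ns. length (bits n))"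
proof (induction ns)
  case (Cons n ns)
  then show ?case
    using length_bits_bound[of n] by (simp add: power_add mult_le_mono)
qed simp

text \<open>The certificate consists of three delimited words: the path, \<open>m\<close> with the
  potentials, and the levels. Each lists at most \<open>length x + 1\<close> numbers below
  \<open>2 ^ (3 * length x)\<close>, hence at most \<open>6 * length x + 1\<close> bits per number;
  \<open>delimit\<close> doubles a word and adds one bit.\<close>

lemma verifier_complete:
  assumes "x \<in> MDCWSP_D"
  shows "\<exists>u. length u \<le> 3 * (2 * ((length x + 1) * (6 * length x + 1)) + 1) \<and>
    verifier (pair_word x u) = [True]"
proof -
  from assms obtain X \<alpha> s t P where X: "x = encode X \<alpha>" "wf_wgraph X" "0 < \<alpha>"
    "shortest_path (graph_of X) (weight_of X) s t P" "degree_centrality (graph_of X) P > \<alpha>"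
    unfolding MDCWSP_D_def by blast
  define ns where "ns = inst_nats (directed X) (num_verts X) \<alpha> (edges X)"
  have x: "x = encode_nats ns" by (simp add: X(1) encode_inst_nats ns_def)
  let ?S = "length x" and ?n = "num_verts X" and ?es = "edges X"
  have S: "k < 2 ^ ?S" if "k \<in> set ns" for k
    unfolding x by (rule length_encode_nats_ge(1)[OF that])
  obtain l where l: "length l = ?n" "\<And>k. k \<in> set l \<Longrightarrow> k \<le> ?n" "levels_ok ?es l"
    "graph_ok (directed X) ?n ?es"
    using wf_wgraph_levels[OF X(2)] by blast
  note V = graph_ok_verts[OF l(4)]
  define M where "M = (2::nat) ^ ?S"
  have M: "fst (snd e) \<le> M" if "e \<in> set ?es" for e
    unfolding M_def by (rule less_imp_le[OF S]) (use that in \<open>auto simp: ns_def inst_nats_def\<close>)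
  define m where "m = prod_list (map (\<lambda>e. snd (snd e)) ?es)"
  obtain a where a: "path_ok (directed X) ?es P m a" "length a = ?n"
    "\<And>k. k \<in> set a \<Longrightarrow> k \<le> m * (?n * M)"
    using path_ok_exists[OF X(2,4) V M m_def] by blast
  have m: "m \<le> 2 ^ ?S" and nS: "?n \<le> ?S"
  proof -
    have "m \<le> 2 ^ (\<Sum>e\<leftarrow>?es. length (bits (snd (snd e))))"
      using l(4) prod_list_bound[of "map (\<lambda>e. snd (snd e)) ?es"]
      by (simp add: m_def graph_ok_def comp_def)
    also have "(\<Sum>e\<leftarrow>?es. length (bits (snd (snd e)))) \<le> ?S"
    proof -
      have "(\<Sum>e\<leftarrow>es. length (bits (snd (snd e)))) \<le> (\<Sum>n\<leftarrow>concat (map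
          (\<lambda>e. [fst (fst e), snd (fst e), fst (snd e), snd (snd e)]) es). 2 * length (bits n) + 1)"
        for es :: "edge list" by (induction es) auto
      from this[of ?es] show ?thesis
        unfolding x ns_def inst_nats_def length_encode_nats by simp
    qed
    finally show "m \<le> 2 ^ ?S" by simp
    have "?n = card (set (vert_list ?es))" by (simp add: V)
    also have "\<dots> \<le> length (0 # map (\<lambda>e. fst (fst e)) ?es @ map (\<lambda>e. snd (fst e)) ?es)"
      unfolding vert_list_def set_dedup by (rule card_length)
    also have "\<dots> \<le> length ns"
      by (simp add: ns_def inst_nats_def length_concat comp_def sum_list_triv)
    also have "\<dots> \<le> ?S" unfolding x by (rule length_encode_nats_ge(2))
    finally show "?n \<le> ?S" .
  qed
  have n2: "?n < 2 ^ ?S" by (rule S) (simp add: ns_def inst_nats_def)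
  have up: "k < 2 ^ (3 * ?S)" if "k < 2 ^ ?S" for k :: nat
  proof -
    have "(2::nat) ^ ?S \<le> 2 ^ (3 * ?S)" by (intro power_increasing) auto
    with that show ?thesis by linarith
  qed
  define u where "u = delimit (encode_nats P) @ delimit (encode_nats (m # a)) @ delimit (encode_nats l)"
  have P: "distinct P" "set P \<subseteq> {..<?n}"
    using a(1) V by (auto simp: path_ok_def)
  then have nP: "length P \<le> ?n"
    using card_mono[of "{..<?n}" "set P"] by (simp add: distinct_card)
  define Y where "Y = (?S + 1) * (2 * (3 * ?S) + 1)"
  have bound: "length (encode_nats ks) \<le> Y"
    if "length ks \<le> ?S + 1" "\<And>k. k \<in> set ks \<Longrightarrow> k < 2 ^ (3 * ?S)" for ks
  proof -
    have "length (encode_nats ks) \<le> length ks * (2 * (3 * ?S) + 1)"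
      using that(2) by (rule length_encode_nats_le)
    also have "\<dots> \<le> Y" unfolding Y_def using that(1) by (intro mult_le_mono1)
    finally show ?thesis .
  qed
  have "0 < ?S" using x by (simp add: length_encode_nats ns_def inst_nats_def)
  have 1: "length (encode_nats P) \<le> Y"
    using nP nS P(2) n2 by (intro bound up) auto
  have 2: "length (encode_nats l) \<le> Y"
    using l(1,2) nS n2 by (intro bound up) (auto intro: le_less_trans)
  have 3: "length (encode_nats (m # a)) \<le> Y"
  proof (rule bound)
    \<comment> \<open>The exponent 3 comes from here: \<open>m\<close>, the number of vertices and
      \<open>M\<close> are each at most \<open>2 ^ length x\<close>.\<close>
    have big: "m * (?n * M) < 2 ^ (3 * ?S)"
    proof -
      have "m * (?n * M) \<le> 2 ^ ?S * (?n * 2 ^ ?S)"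
        unfolding M_def using m by (intro mult_le_mono1)
      also have "\<dots> < 2 ^ ?S * (2 ^ ?S * 2 ^ ?S)"
        using n2 by simp
      also have "\<dots> = 2 ^ (3 * ?S)" by (simp flip: power_add)
      finally show ?thesis .
    qed
    have "m < 2 ^ (3 * ?S)"
    proof -
      have "(2::nat) ^ ?S < 2 ^ (3 * ?S)" using \<open>0 < ?S\<close> by (intro power_strict_increasing) auto
      with m show ?thesis by linarith
    qed
    then show "k < 2 ^ (3 * ?S)" if "k \<in> set (m # a)" for k
      using that a(3) big by (auto intro: le_less_trans)
  qed (use a(2) nS in auto)
  have "length u = (2 * length (encode_nats P) + 1) + (2 * length (encode_nats (m # a)) + 1)
      + (2 * length (encode_nats l) + 1)"
    by (simp add: u_def length_delimit)
  also have "\<dots> \<le> 3 * (2 * Y + 1)"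
    using 1 2 3 by simp
  finally have "length u \<le> 3 * (2 * Y + 1)" .
  moreover have "verifier (pair_word x u) = [True]"
  proof -
    have "tokens (pair_word x u) = [x, encode_nats P, encode_nats (m # a), encode_nats l]"
      using tokens_delimit[of "encode_nats l" "[]"]
      by (simp add: pair_word_def u_def tokens_delimit)
    moreover have "nats_of x = ns" by (simp add: x)
    moreover have "hd ns = 1 \<longleftrightarrow> directed X" "hd (tl ns) = ?n" "hd (tl (tl ns)) = \<alpha>"
      "chunk (tl (tl (tl ns))) = ?es"
      by (simp_all only: ns_def chunk_inst_nats) (simp_all add: inst_nats_def)
    moreover have "check_inst x (directed X) ?n \<alpha> ?es P (m # a) l"
      unfolding check_inst_def
      using X(3,5) l(3,4) a(1) degree_centrality_neighbour_list[OF V X(2)] by (simp add: x ns_def)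
    ultimately show ?thesis
      by (simp add: verifier_def check_def)
  qed
  ultimately show ?thesis by (intro exI[of _ u]) (simp add: Y_def)
qed

theorem MDCWSP_D_in_NP: "MDCWSP_D \<in> NP"
proof -
  let ?T = "\<lambda>n. 3 * (2 * ((n + 1) * (6 * n + 1)) + 1) :: nat"
  have "pbound ?T" by (intro pbound_intros)
  then obtain p where p: "?T = poly p" unfolding pbound_def by blast
  show ?thesis
    unfolding NP_def
    using polytime_verifier verifier_sound verifier_complete
    by (intro CollectI exI[of _ verifier] exI[of _ p]) (auto simp flip: p)
qed

section \<open>Choices as paths through layers\<close>

section \<open>Choice problems\<close>

text \<open>A clause is a disjunction of literals \<open>(j, a)\<close>, read as: choice
  \<open>j\<close> is \<open>a\<close>.\<close>

definition choice_sat :: "nat \<Rightarrow> nat \<Rightarrow> (nat \<times> nat) list list \<Rightarrow> bool" where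
  "choice_sat L g cs \<longleftrightarrow> (\<exists>ch. (\<forall>j<L. ch j < g) \<and> (\<forall>c\<in>set cs. \<exists>j<L. (j, ch j) \<in> set c))"

text \<open>Number 0 is left to the sink. The options follow layer by layer from 1 to
  \<open>L * g\<close>, then the clause vertices in blocks of \<open>K\<close>.\<close>

definition option_vertex :: "nat \<Rightarrow> nat \<Rightarrow> nat \<Rightarrow> nat" where
  "option_vertex g j a = Suc (j * g + a)"

definition clause_vertex :: "nat \<Rightarrow> nat \<Rightarrow> nat \<Rightarrow> nat \<Rightarrow> nat \<Rightarrow> nat" where
  "clause_vertex L g K c i = Suc (L * g + c * K + i)"

text \<open>
  Vertex \<open>0\<close> is a sink that makes the graph weakly connected. A path can visit only one option of
  each of the \<open>L\<close> layers. Each clause has \<open>K\<close> vertices, more than the sink and all options together,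
  so that a clause that is missed cannot be compensated.
\<close>

definition choice_arcs ::
    "nat \<Rightarrow> nat \<Rightarrow> nat \<Rightarrow> nat list \<Rightarrow> nat list \<Rightarrow> nat list \<Rightarrow> (nat \<times> nat) list list \<Rightarrow> (nat \<times> nat) list"
  where
  "choice_arcs L g K js as ks cs =
     concat (map (\<lambda>j. map (\<lambda>a. (option_vertex g j a, 0)) as) js) @
     concat (map (\<lambda>c. map (\<lambda>i. (clause_vertex L g K c i, 0)) ks) [0..<length cs]) @
     concat (map (\<lambda>j. if Suc j < L then concat (map (\<lambda>a. map (\<lambda>b.
       (option_vertex g j a, option_vertex g (Suc j) b)) as) as) else []) js) @
     concat (map (\<lambda>p. concat (map (\<lambda>q. if fst q < L \<and> snd q < g then map (\<lambda>i.
       (option_vertex g (fst q) (snd q), clause_vertex L g K (fst p) i)) ks else []) (snd p)))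
       (zip [0..<length cs] cs))"

lemma PT_option_vertex [pt]:
  "PT g \<Longrightarrow> PT j \<Longrightarrow> PT a \<Longrightarrow> PT (\<lambda>x. option_vertex (g x) (j x) (a x))"
  unfolding option_vertex_def by (intro pt)

lemma PT_clause_vertex [pt]:
  "PT L \<Longrightarrow> PT g \<Longrightarrow> PT K \<Longrightarrow> PT c \<Longrightarrow> PT i \<Longrightarrow>
     PT (\<lambda>x. clause_vertex (L x) (g x) (K x) (c x) (i x))"
  unfolding clause_vertex_def by (intro pt)

lemma PT_choice_arcs [pt]:
  assumes "PT L" "PT g" "PT K" "PT js" "PT as" "PT ks" "PT cs"
  shows "PT (\<lambda>x. choice_arcs (L x) (g x) (K x) (js x) (as x) (ks x) (cs x))"
  unfolding choice_arcs_def
  by (intro pt assms PT_comp[OF assms(1)] PT_comp[OF assms(2)] PT_comp[OF assms(3)] PT_comp[OF assms(4)]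
      PT_comp[OF assms(5)] PT_comp[OF assms(6)] PT_comp[OF assms(7)])

lemma set_concat_map: "x \<in> set (concat (map f xs)) \<longleftrightarrow> (\<exists>y\<in>set xs. x \<in> set (f y))"
  by auto

lemma set_vwalk_arcs:
  "set (vwalk_arcs P) = {(P ! i, P ! Suc i) |i. Suc i < length P}"
  unfolding vwalk_arcs_zip set_zip by (intro Collect_cong iff_exI) (auto simp: nth_tl)

lemma mult_add_less:
  fixes j a n g :: nat
  assumes "j < n" "a < g"
  shows "j * g + a < n * g"
proof -
  have "j * g + a < Suc j * g" using assms by simp
  also have "\<dots> \<le> n * g" using assms(1) by (intro mult_le_mono1) simp
  finally show ?thesis .
qed

lemma mult_add_inj:
  fixes j a k b g :: nat
  assumes "a < g" "b < g"
  shows "j * g + a = k * g + b \<longleftrightarrow> j = k \<and> a = b"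
proof
  assume eq: "j * g + a = k * g + b"
  have "(j * g + a) div g = j" "(k * g + b) div g = k" using assms by simp_all
  then have "j = k" unfolding eq by simp
  then show "j = k \<and> a = b" using eq by simp
qed simp

locale choice_graph =
  fixes L g :: nat and cs :: "(nat \<times> nat) list list" and K :: nat
  assumes cs: "cs \<noteq> []" and L: "0 < L"
  defines "K \<equiv> L * g + 2"
begin

abbreviation "ov \<equiv> option_vertex g"
abbreviation "cv \<equiv> clause_vertex L g K"

definition "arc_pairs = choice_arcs L g K [0..<L] [0..<g] [0..<K] cs"

definition X :: wgraph where
  "X = \<lparr>directed = True, num_verts = Suc (L * g + length cs * K),
     edges = map (\<lambda>q. (q, (1, 1))) (dedup arc_pairs)\<rparr>"

text \<open>The most that a path missing a clause can reach: all vertices of the other clauses, all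
  options and the sink. A path meeting every clause has \<open>length cs * K\<close> clause
  neighbours, which is more because \<open>K\<close> exceeds \<open>L * g + 1\<close>.\<close>

definition "bound = length (tl cs) * K + Suc (L * g)"

lemma ov_inj: "a < g \<Longrightarrow> b < g \<Longrightarrow> ov j a = ov k b \<longleftrightarrow> j = k \<and> a = b"
  by (simp add: option_vertex_def mult_add_inj)

lemma cv_inj: "i < K \<Longrightarrow> j < K \<Longrightarrow> cv c i = cv d j \<longleftrightarrow> c = d \<and> i = j"
  by (simp add: clause_vertex_def mult_add_inj add.assoc)

lemma ov_range: "j < L \<Longrightarrow> a < g \<Longrightarrow> 0 < ov j a \<and> ov j a \<le> L * g"
  using mult_add_less[of j L a g] by (simp add: option_vertex_def)

lemma cv_range: "c < length cs \<Longrightarrow> i < K \<Longrightarrow> L * g < cv c i \<and> cv c i \<le> L * g + length cs * K"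
  using mult_add_less[of c "length cs" i K] by (simp add: clause_vertex_def)

lemma ov_cv: "j < L \<Longrightarrow> a < g \<Longrightarrow> ov j a \<noteq> cv c i"
  using ov_range[of j a] by (auto simp: clause_vertex_def)

inductive_set E where
  sink_option: "j < L \<Longrightarrow> a < g \<Longrightarrow> (ov j a, 0) \<in> E"
| sink_clause: "c < length cs \<Longrightarrow> i < K \<Longrightarrow> (cv c i, 0) \<in> E"
| succ: "Suc j < L \<Longrightarrow> a < g \<Longrightarrow> b < g \<Longrightarrow> (ov j a, ov (Suc j) b) \<in> E"
| clause: "c < length cs \<Longrightarrow> (j, a) \<in> set (cs ! c) \<Longrightarrow> j < L \<Longrightarrow> a < g \<Longrightarrow> i < K \<Longrightarrow> (ov j a, cv c i) \<in> E"

lemma set_arc_pairs: "set arc_pairs = E"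
proof
  show "set arc_pairs \<subseteq> E"
  proof
    fix q assume "q \<in> set arc_pairs"
    then show "q \<in> E"
      unfolding arc_pairs_def choice_arcs_def set_append Un_iff
    proof (elim disjE, goal_cases)
      case 1
      then obtain j a where "j < L" "a < g" "q = (ov j a, 0)" by auto
      then show ?case using E.sink_option by blast
    next
      case 2
      then obtain c i where "c < length cs" "i < K" "q = (cv c i, 0)" by auto
      then show ?case using E.sink_clause by blast
    next
      case 3
      then obtain j a b where "Suc j < L" "a < g" "b < g" "q = (ov j a, ov (Suc j) b)"
        by (auto split: if_splits)
      then show ?case using E.succ by blast
    next
      case 4
      then obtain p ja where p: "p \<in> set (zip [0..<length cs] cs)" "ja \<in> set (snd p)"
        "q \<in> set (if fst ja < L \<and> snd ja < g then map (\<lambda>i.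
          (ov (fst ja) (snd ja), cv (fst p) i)) [0..<K] else [])"
        unfolding set_concat_map by blast
      from p(1) obtain c where c: "c < length cs" "p = (c, cs ! c)"
        by (auto simp: set_zip)
      from p(3) obtain i where "fst ja < L" "snd ja < g" "i < K" "q = (ov (fst ja) (snd ja), cv c i)"
        using c(2) by (auto split: if_splits)
      then show ?case
        using E.clause[of c "fst ja" "snd ja" i] c p(2) by simp
    qed
  qed
  show "E \<subseteq> set arc_pairs"
  proof
    fix q assume "q \<in> E"
    then obtain u v where q: "q = (u, v)" "(u, v) \<in> E" by (cases q) auto
    from q(2) have "(u, v) \<in> set arc_pairs"
    proof (cases rule: E.cases)
      case (sink_option j a)
      then have "(u, v) \<in> set (concat (map (\<lambda>j. map (\<lambda>a. (ov j a, 0)) [0..<g]) [0..<L]))"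
        unfolding set_concat_map by (intro bexI[of _ j]) auto
      then show ?thesis unfolding arc_pairs_def choice_arcs_def set_append by blast
    next
      case (sink_clause c i)
      then have "(u, v) \<in> set (concat (map (\<lambda>c. map (\<lambda>i. (cv c i, 0)) [0..<K]) [0..<length cs]))"
        unfolding set_concat_map by (intro bexI[of _ c]) auto
      then show ?thesis unfolding arc_pairs_def choice_arcs_def set_append by blast
    next
      case (succ j a b)
      then have "(u, v) \<in> set (concat (map (\<lambda>a. map (\<lambda>b. (ov j a, ov (Suc j) b)) [0..<g]) [0..<g]))"
        unfolding set_concat_map by (intro bexI[of _ a]) auto
      then have "(u, v) \<in> set (concat (map (\<lambda>j. if Suc j < L then concat (map (\<lambda>a. map (\<lambda>b.
          (ov j a, ov (Suc j) b)) [0..<g]) [0..<g]) else []) [0..<L]))"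
        unfolding set_concat_map[of _ _ "[0..<L]"] using succ by (intro bexI[of _ j]) (simp_all only: if_True, simp)
      then show ?thesis unfolding arc_pairs_def choice_arcs_def set_append by blast
    next
      case (clause c j a i)
      let ?f = "\<lambda>p. concat (map (\<lambda>q. if fst q < L \<and> snd q < g then map (\<lambda>i.
       (ov (fst q) (snd q), cv (fst p) i)) [0..<K] else []) (snd p))"
      have "(c, cs ! c) \<in> set (zip [0..<length cs] cs)"
        unfolding set_zip using clause by (auto intro!: exI[of _ c])
      moreover have "(u, v) \<in> set (?f (c, cs ! c))"
        unfolding set_concat_map fst_conv snd_conv
        by (intro bexI[of _ "(j, a)"]) (use clause in simp_all)
      ultimately have "(u, v) \<in> set (concat (map ?f (zip [0..<length cs] cs)))"
        unfolding set_concat_map[of _ ?f] by (rule bexI[rotated])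
      then show ?thesis unfolding arc_pairs_def choice_arcs_def set_append by blast
    qed
    then show "q \<in> set arc_pairs" by (simp add: q(1))
  qed
qed

lemma arc_list_X: "arc_list X = map (\<lambda>q. (q, (1, 1))) (dedup arc_pairs)"
  by (simp add: arc_list_def X_def)

lemma parcs_X: "parcs (graph_of X) = E"
  by (simp add: arc_list_X image_image set_arc_pairs)

lemma pverts_X: "pverts (graph_of X) = {..L * g + length cs * K}"
  by (auto simp: X_def)

lemma distinct_X: "distinct (map fst (arc_list X))"
  by (simp add: arc_list_X comp_def)

lemma weight_X: "q \<in> E \<Longrightarrow> weight_of X q = 1"
  using weight_of_arc[OF distinct_X, of q 1 1] by (simp add: arc_list_X set_arc_pairs)

lemma E_verts: "(u, v) \<in> E \<Longrightarrow> u \<le> L * g + length cs * K \<and> v \<le> L * g + length cs * K \<and> u \<noteq> v"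
proof (induction rule: E.cases)
  case (succ j a b)
  then show ?case using ov_range[of j a] ov_range[of "Suc j" b] ov_inj[of a b j "Suc j"] by auto
next
  case (clause c j a i)
  then show ?case using ov_range[of j a] cv_range[of c i] by auto
next
  case (sink_option j a)
  then show ?case using ov_range[of j a] by auto
next
  case (sink_clause c i)
  then show ?case using cv_range[of c i] by auto
qed

lemma vertex_cases:
  assumes "v \<le> L * g + length cs * K"
  obtains "v = 0" | j a where "j < L" "a < g" "v = ov j a"
    | c i where "c < length cs" "i < K" "v = cv c i"
proof (cases "v = 0")
  case False
  show thesis
  proof (cases "v \<le> L * g")
    case True
    have g: "0 < g" using True False by (cases g) auto
    have "(v - 1) div g < L" using True False g by (simp add: less_mult_imp_div_less)
    moreover have "v = ov ((v - 1) div g) ((v - 1) mod g)"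
      using False by (simp add: option_vertex_def)
    ultimately show thesis using that(2) g by (meson mod_less_divisor)
  next
    case v: False
    define r where "r = v - Suc (L * g)"
    have K: "0 < K" by (simp add: K_def)
    have "r < length cs * K" using v assms by (simp add: r_def)
    then have "r div K < length cs" by (simp add: less_mult_imp_div_less)
    moreover have "v = cv (r div K) (r mod K)"
      using v by (simp add: clause_vertex_def r_def)
    ultimately show thesis using K by (intro that(3)) auto
  qed
qed (use that in blast)

lemma wf_X: "wf_wgraph X"
proof -
  have 1: "\<forall>(e, (a, b))\<in>set (edges X). 0 < b"
    by (auto simp: X_def)
  have 2: "pair_digraph (graph_of X)"
  proof -
    have "finite E" using set_arc_pairs by (metis List.finite_set)
    then show ?thesis
      unfolding pair_digraph_iff parcs_X pverts_X using E_verts by auto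
  qed
  have 3: "Digraph_Component.connected (with_proj (graph_of X))"
  \<comment> \<open>Every other vertex has an arc to the sink, so two levels are enough.\<close>
  proof (rule connected_of_levels[where r = 0 and lev = "\<lambda>v. of_bool (v \<noteq> 0)"])
    show "0 \<in> pverts (graph_of X)" by (simp add: pverts_X del: graph_of_simps)
    fix v assume v: "v \<in> pverts (graph_of X)" "v \<noteq> 0"
    have "(v, 0) \<in> E"
    proof (rule vertex_cases[of v])
      show "v \<le> L * g + length cs * K" using v(1) unfolding pverts_X by simp
    qed (use v(2) in \<open>auto intro: E.intros\<close>)
    then show "\<exists>u\<in>pverts (graph_of X). (u, v) \<in> parcs (graph_of X) \<union> (parcs (graph_of X))\<inverse> \<and>
        of_bool (u \<noteq> 0) < (of_bool (v \<noteq> 0) :: nat)"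
      unfolding parcs_X pverts_X using v(2) by (intro bexI[of _ 0]) auto
  qed
  have 4: "\<forall>e\<in>parcs (graph_of X). 0 < weight_of X e"
    unfolding parcs_X using weight_X by simp
  show ?thesis
    unfolding wf_wgraph_def weighted_graph_def using distinct_X 1 2 3 4 by blast
qed

text \<open>The layer of an option, and 0 elsewhere. It rises by at most one along every arc, so
  with unit weights it is a potential.\<close>

definition rank :: "nat \<Rightarrow> nat" where
  "rank v = (if 0 < v \<and> v \<le> L * g then (v - 1) div g else 0)"

lemma rank_ov: "j < L \<Longrightarrow> a < g \<Longrightarrow> rank (ov j a) = j"
  using ov_range[of j a] by (simp add: rank_def option_vertex_def)

lemma rank_cv: "rank (cv c i) = 0"
  by (simp add: rank_def clause_vertex_def)

lemma rank_E: "(u, v) \<in> E \<Longrightarrow> rank v \<le> Suc (rank u)"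
  by (erule E.cases) (auto simp: rank_ov rank_cv, auto simp: rank_def)

definition is_option :: "nat \<Rightarrow> bool" where
  "is_option v \<longleftrightarrow> (\<exists>j<L. \<exists>a<g. v = ov j a)"

lemma is_optionI: "j < L \<Longrightarrow> a < g \<Longrightarrow> is_option (ov j a)"
  unfolding is_option_def by blast

lemma E_into_option: "(u, v) \<in> E \<Longrightarrow> is_option v \<Longrightarrow> is_option u \<and> rank u < rank v"
proof (erule E.cases, goal_cases)
  case (3 j a b)
  then show ?case unfolding is_option_def by (auto simp: rank_ov dest: Suc_lessD)
qed (auto simp: is_option_def ov_cv[symmetric], auto simp: option_vertex_def)

text \<open>An option is entered only from an option of the previous layer. Everything before it on
  a walk thus consists of options of lower layers, whence a path has at most one option per
  layer.\<close>

lemma walk_rank_less: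
  "set (vwalk_arcs (u # P)) \<subseteq> E \<Longrightarrow> v \<in> set P \<Longrightarrow> is_option v \<Longrightarrow> is_option u \<and> rank u < rank v"
proof (induction P arbitrary: u)
  case (Cons y P)
  then have "(u, y) \<in> E" "set (vwalk_arcs (y # P)) \<subseteq> E" by auto
  show ?case
  proof (cases "v = y")
    case True
    then show ?thesis using E_into_option[OF \<open>(u, y) \<in> E\<close>] Cons.prems(3) by simp
  next
    case False
    then have "is_option y \<and> rank y < rank v"
      using Cons.IH[OF \<open>set (vwalk_arcs (y # P)) \<subseteq> E\<close>] Cons.prems(2,3) by simp
    then show ?thesis using E_into_option[OF \<open>(u, y) \<in> E\<close>] by simp
  qed
qed simp

lemma walk_rank_inj:
  "set (vwalk_arcs P) \<subseteq> E \<Longrightarrow> u \<in> set P \<Longrightarrow> v \<in> set P \<Longrightarrow> is_option u \<Longrightarrow> is_option v \<Longrightarrow>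
     rank u = rank v \<Longrightarrow> u = v"
proof (induction P)
  case (Cons y P)
  have sub: "set (vwalk_arcs P) \<subseteq> E" using Cons.prems(1) by (cases P) auto
  have less: "rank y < rank w" if "w \<in> set P" "is_option w" for w
    using walk_rank_less[OF Cons.prems(1) that] by simp
  consider "u = v" | "u = y" "v \<in> set P" | "v = y" "u \<in> set P" | "u \<in> set P" "v \<in> set P"
    using Cons.prems(2,3) by auto
  then show ?case
  proof cases
    case 4
    then show ?thesis using Cons.IH[OF sub] Cons.prems(4-6) by blast
  qed (use less Cons.prems(4-6) in force)+
qed simp

text \<open>The chosen options form a path along which \<open>rank\<close> rises by exactly one per
  arc, so it is shortest, and all vertices of all clauses are its neighbours.\<close>

lemma sat_imp:
  assumes "choice_sat L g cs"
  shows "\<exists>s t P. shortest_path (graph_of X) (weight_of X) s t P \<and> degree_centrality (graph_of X) P > bound"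
proof -
  obtain ch where ch: "\<And>j. j < L \<Longrightarrow> ch j < g" "\<And>c. c \<in> set cs \<Longrightarrow> \<exists>j<L. (j, ch j) \<in> set c"
    using assms unfolding choice_sat_def by blast
  define P where "P = map (\<lambda>j. ov j (ch j)) [0..<L]"
  have arcs: "set (vwalk_arcs P) = {(ov j (ch j), ov (Suc j) (ch (Suc j))) |j. Suc j < L}"
    unfolding set_vwalk_arcs P_def by (intro Collect_cong iff_exI) auto
  have sp: "shortest_path (graph_of X) (weight_of X) (hd P) (last P) P"
  proof (rule shortest_of_potential[where \<pi> = "\<lambda>v. of_nat (rank v)"])
    have "inj_on (\<lambda>j. ov j (ch j)) {0..<L}"
      by (auto simp: inj_on_def ov_inj ch)
    then have "distinct P" by (simp add: P_def distinct_map)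
    moreover have "set P \<subseteq> pverts (graph_of X)"
      unfolding pverts_X P_def using ov_range ch(1) by (auto intro: le_trans trans_le_add1)
    moreover have "set (vwalk_arcs P) \<subseteq> E"
      unfolding arcs using ch(1) by (auto intro: E.succ)
    ultimately show "path_between (graph_of X) (hd P) (last P) P"
      unfolding path_between_iff parcs_X using L by (simp add: P_def)
    show "of_nat (rank v) \<le> (of_nat (rank u) + weight_of X (u, v) :: rat)"
      if "(u, v) \<in> parcs (graph_of X)" for u v
    proof -
      have "(u, v) \<in> E" using that unfolding parcs_X .
      from rank_E[OF this] weight_X[OF this] show ?thesis
        by (simp flip: of_nat_Suc add: add.commute[of _ 1])
    qed
    show "of_nat (rank v) = (of_nat (rank u) + weight_of X (u, v) :: rat)"
      if uv: "(u, v) \<in> set (vwalk_arcs P)" for u v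
    proof -
      obtain j where j: "u = ov j (ch j)" "v = ov (Suc j) (ch (Suc j))" "Suc j < L"
        using uv unfolding arcs by blast
      then have "(u, v) \<in> E" using ch(1) by (auto intro: E.succ)
      then show ?thesis using weight_X j ch(1) by (simp add: rank_ov)
    qed
  qed
  let ?C = "(\<lambda>(c, i). cv c i) ` ({..<length cs} \<times> {..<K})"
  have "?C \<subseteq> neighbourhood (graph_of X) P"
  proof
    fix v assume "v \<in> ?C"
    then obtain c i where v: "c < length cs" "i < K" "v = cv c i" by auto
    obtain j where j: "j < L" "(j, ch j) \<in> set (cs ! c)" using ch(2)[of "cs ! c"] v(1) by auto
    have "ov j (ch j) \<in> set P" using j(1) by (auto simp: P_def)
    moreover have "(ov j (ch j), v) \<in> E" unfolding v(3) using v j ch(1) by (intro E.clause) auto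
    moreover have "v \<notin> set P"
    proof
      assume "v \<in> set P"
      then obtain k where "k < L" "cv c i = ov k (ch k)" unfolding v(3) P_def by auto
      then show False using ov_cv[of k "ch k" c i] ch(1) by simp
    qed
    ultimately show "v \<in> neighbourhood (graph_of X) P"
      unfolding neighbourhood_def parcs_X by blast
  qed
  moreover have "finite (neighbourhood (graph_of X) P)"
  proof (rule finite_subset)
    show "neighbourhood (graph_of X) P \<subseteq> {..L * g + length cs * K}"
      unfolding neighbourhood_def parcs_X using E_verts by auto
  qed simp
  ultimately have "card ?C \<le> degree_centrality (graph_of X) P"
    unfolding degree_centrality_def by (intro card_mono)
  moreover have "card ?C = length cs * K"
  proof -
    have "inj_on (\<lambda>(c, i). cv c i) ({..<length cs} \<times> {..<K})"
      by (auto simp: inj_on_def cv_inj)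
    then show ?thesis by (simp add: card_image card_cartesian_product)
  qed
  moreover have "bound < length cs * K"
  proof -
    have len: "length cs = Suc (length (tl cs))" using cs by (cases cs) auto
    have "Suc (L * g) < K" by (simp add: K_def)
    then show ?thesis unfolding bound_def len mult_Suc by linarith
  qed
  ultimately show ?thesis using sp by (metis less_le_trans)
qed

text \<open>Any path, shortest or not, visits at most one option per layer and so defines a choice.
  If the choice missed a clause, none of the vertices of that clause would be neighbours.\<close>

lemma imp_sat:
  assumes P: "path_between (graph_of X) s t P" and dc: "degree_centrality (graph_of X) P > bound"
  shows "choice_sat L g cs"
proof (rule ccontr)
  assume unsat: "\<not> choice_sat L g cs"
  have PE: "set (vwalk_arcs P) \<subseteq> E" using P unfolding path_between_iff parcs_X by blast
  \<comment> \<open>Without options there is no choice to define, so this case comes first: the sink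
    is then the only possible neighbour, and \<open>bound\<close> is at least 1.\<close>
  have g: "0 < g"
  proof (rule ccontr)
    assume "\<not> 0 < g"
    then have no: "\<not> a < g" for a by simp
    have "neighbourhood (graph_of X) P \<subseteq> {0}"
    proof
      fix v assume "v \<in> neighbourhood (graph_of X) P"
      then obtain u where "(u, v) \<in> E" unfolding neighbourhood_def parcs_X by blast
      then show "v \<in> {0}" using no by (cases rule: E.cases) auto
    qed
    then have "degree_centrality (graph_of X) P \<le> card {0::nat}"
      unfolding degree_centrality_def by (intro card_mono) auto
    then show False using dc by (simp add: bound_def)
  qed
  \<comment> \<open>The option of layer \<open>j\<close> that lies on the path if there is one, and
    any option otherwise.\<close>
  have "\<forall>j. \<exists>a. a < g \<and> (\<forall>b<g. ov j b \<in> set P \<longrightarrow> ov j a \<in> set P)"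
  proof
    fix j
    show "\<exists>a. a < g \<and> (\<forall>b<g. ov j b \<in> set P \<longrightarrow> ov j a \<in> set P)"
    proof (cases "\<exists>b<g. ov j b \<in> set P")
      case True
      then obtain b where "b < g" "ov j b \<in> set P" by blast
      then show ?thesis by (intro exI[of _ b]) simp
    next
      case False
      then show ?thesis by (intro exI[of _ 0]) (simp add: g)
    qed
  qed
  from choice[OF this] obtain ch where
    ch: "\<forall>j. ch j < g \<and> (\<forall>b<g. ov j b \<in> set P \<longrightarrow> ov j (ch j) \<in> set P)" by (rule exE)
  have ch': "ch j < g" "b < g \<Longrightarrow> ov j b \<in> set P \<Longrightarrow> ov j (ch j) \<in> set P" for j b
    using spec[OF ch, of j] by simp_all
  have ch: "ch j = a" if a: "j < L" "a < g" "ov j a \<in> set P" for j a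
  proof -
    have 1: "ch j < g" by (rule ch'(1))
    have "ov j (ch j) = ov j a"
    proof (rule walk_rank_inj[OF PE])
      show "ov j (ch j) \<in> set P" by (rule ch'(2)[OF a(2,3)])
      show "is_option (ov j (ch j))" "is_option (ov j a)"
        by (rule is_optionI[OF a(1) 1], rule is_optionI[OF a(1,2)])
      show "rank (ov j (ch j)) = rank (ov j a)"
        by (simp only: rank_ov[OF a(1) 1] rank_ov[OF a(1,2)])
    qed (rule a(3))
    then show ?thesis by (simp only: ov_inj[OF 1 a(2)])
  qed
  obtain c where c: "c < length cs" "\<And>j. j < L \<Longrightarrow> (j, ch j) \<notin> set (cs ! c)"
  proof -
    have "\<not> (\<forall>c\<in>set cs. \<exists>j<L. (j, ch j) \<in> set c)"
    proof
      assume "\<forall>c\<in>set cs. \<exists>j<L. (j, ch j) \<in> set c"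
      then have "choice_sat L g cs"
        unfolding choice_sat_def using ch'(1) by (intro exI[of _ ch] conjI) simp_all
      with unsat show False ..
    qed
    then obtain d where d: "d \<in> set cs" "\<And>j. j < L \<Longrightarrow> (j, ch j) \<notin> set d" by blast
    from d(1) obtain c where "c < length cs" "cs ! c = d" by (auto simp: in_set_conv_nth)
    with d(2) show thesis using that by blast
  qed
  let ?C = "(\<lambda>(d, i). cv d i) ` (({..<length cs} - {c}) \<times> {..<K})"
  have "neighbourhood (graph_of X) P \<subseteq> {..L * g} \<union> ?C"
  proof
    fix v assume "v \<in> neighbourhood (graph_of X) P"
    then obtain u where u: "u \<in> set P" "(u, v) \<in> E" unfolding neighbourhood_def parcs_X by blast
    from u(2) show "v \<in> {..L * g} \<union> ?C"
    proof (cases rule: E.cases)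
      case (succ j a b)
      then show ?thesis using ov_range[of "Suc j" b] by auto
    next
      case (clause d j a i)
      have "d \<noteq> c"
        using c(2) ch[of j a] clause u(1) by auto
      then show ?thesis using clause by (auto intro!: image_eqI[of _ _ "(d, i)"])
    qed auto
  qed
  then have "degree_centrality (graph_of X) P \<le> card ({..L * g} \<union> ?C)"
    unfolding degree_centrality_def by (intro card_mono) auto
  also have "\<dots> \<le> card {..L * g} + card ?C" by (rule card_Un_le)
  also have "card ?C \<le> card (({..<length cs} - {c}) \<times> {..<K})" by (intro card_image_le) auto
  also have "\<dots> = (length cs - 1) * K" using c(1) by (simp add: card_cartesian_product)
  finally show False using dc by (simp add: bound_def)
qed

theorem choice_graph_correct: "encode X bound \<in> MDCWSP_D \<longleftrightarrow> choice_sat L g cs"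
proof
  assume "encode X bound \<in> MDCWSP_D"
  then obtain Y \<beta> s t P where Y: "encode X bound = encode Y \<beta>"
    "shortest_path (graph_of Y) (weight_of Y) s t P" "degree_centrality (graph_of Y) P > \<beta>"
    unfolding MDCWSP_D_def by blast
  from encode_inject[OF Y(1)] have "Y = X" "\<beta> = bound" by simp_all
  with Y(2,3) show "choice_sat L g cs"
    unfolding shortest_path_def by (intro imp_sat[of s t P]) simp_all
next
  assume "choice_sat L g cs"
  from sat_imp[OF this] show "encode X bound \<in> MDCWSP_D"
    unfolding MDCWSP_D_def using wf_X by (intro CollectI exI[of _ X] exI[of _ bound]) (simp add: bound_def)
qed

end

section \<open>Local description of a computation\<close>

section \<open>Tableaux of Turing machines\<close>

text \<open>
  The entry of a tableau at time \<open>t\<close> and position \<open>i\<close> consists of the state, of the symbols under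
  the heads, and, for each tape, of the symbol in cell \<open>i\<close> and of the difference between \<open>i\<close> and the
  head position, clamped to \<open>-2, \<dots>, 2\<close>. Storing the difference determines the whole row of
  differences from its value at one entry near the head, so that constraints between horizontally or
  vertically adjacent entries suffice.
\<close>

type_synonym cell = "nat \<times> nat list \<times> (nat \<times> int) list"

definition clamp :: "int \<Rightarrow> int" where
  "clamp d = max (-2) (min 2 d)"

definition clamp_succ :: "(int \<times> int) set" where
  "clamp_succ = {(-2, -2), (-2, -1), (-1, 0), (0, 1), (1, 2), (2, 2)}"

lemma clamp_succ: "(clamp d, clamp (d + 1)) \<in> clamp_succ"
proof -
  consider "d \<le> -3" | "d = -2" | "d = -1" | "d = 0" | "d = 1" | "2 \<le> d" by linarith
  then show ?thesis by cases (auto simp: clamp_def clamp_succ_def)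
qed

text \<open>The relation is ambiguous only to the right of -2 and to the left of 2. An anchor
  between -1 and 1 is exact, and moving away from it one never leaves an extreme value. Clamping at
  1 would not do, since after a move the anchor may be 1 or -1.\<close>

lemma clamp_row:
  assumes "\<And>i. Suc i < W \<Longrightarrow> (F i, F (Suc i)) \<in> clamp_succ"
    and "j < W" "F j = int j - int h" "\<bar>int j - int h\<bar> \<le> 1" "i < W"
  shows "F i = clamp (int i - int h)"
proof (cases "j \<le> i")
  case True
  then show ?thesis using assms(5)
  proof (induction i rule: dec_induct)
    case base
    then show ?case using assms(3,4) by (simp add: clamp_def)
  next
    case (step i)
    have "(F i, F (Suc i)) \<in> clamp_succ" by (rule assms(1)) (rule step.prems)
    moreover have "F i = clamp (int i - int h)" using step.IH step.prems by simp
    moreover have "int i - int h \<ge> -1" using assms(4) step.hyps by linarith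
    ultimately show ?case by (auto simp: clamp_succ_def clamp_def)
  qed
next
  case False
  then have "i \<le> j" by simp
  then show ?thesis
  proof (induction rule: inc_induct)
    case base
    then show ?case using assms(3,4) by (simp add: clamp_def)
  next
    case (step i)
    have "(F i, F (Suc i)) \<in> clamp_succ" by (rule assms(1)) (use assms(2) step.hyps in simp)
    moreover have "int (Suc i) - int h \<le> 1" using assms(4) step.hyps by linarith
    ultimately show ?case using step.IH by (auto simp: clamp_succ_def clamp_def)
  qed
qed

text \<open>The old head position minus the new one; \<open>b\<close> marks cell 0, where a left
  move has no effect.\<close>

definition shift :: "bool \<Rightarrow> dir \<Rightarrow> int" where
  "shift b d = (case d of Move_Left \<Rightarrow> if b then 0 else 1 | Stay \<Rightarrow> 0 | Move_Right \<Rightarrow> -1)"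

lemma shift_move_head: "int i - int (move_head d i) = shift (i = 0) d"
  by (cases d) (auto simp: shift_def)

lemma shift_bound: "\<bar>shift b d\<bar> \<le> 1"
  by (cases d) (auto simp: shift_def)

lemma move_head_le: "move_head d h \<le> Suc h"
  by (cases d) auto

lemma map2_act_stay: "map2 act (map (\<lambda>t. (head_symbol t, Stay)) ts) ts = ts"
  by (induction ts) (auto simp: act_stay)

locale machine =
  fixes M :: tm
  assumes wf: "wf_tm M"
begin

abbreviation "k \<equiv> tapes M"

text \<open>Also defined in the halting state, where nothing changes, so that a tableau can continue
  to any prescribed time.\<close>

definition transition :: "nat \<Rightarrow> nat list \<Rightarrow> nat \<times> (nat \<times> dir) list" where
  "transition q rs = (if q = halt M then (q, map (\<lambda>r. (r, Stay)) rs) else delta M q rs)"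

lemma k2: "2 \<le> k" and symbols4: "4 \<le> symbols M"
  using wf by (auto simp: wf_tm_def)

lemma step_transition: "step M (q, ts) = (fst (transition q (map head_symbol ts)), map2 act (snd (transition q (map head_symbol ts))) ts)"
  by (simp add: transition_def comp_def map2_act_stay case_prod_beta step.simps)

lemma transition_wf:
  assumes "q \<le> halt M" "length rs = k" "set rs \<subseteq> {..<symbols M}"
  shows "fst (transition q rs) \<le> halt M" "length (snd (transition q rs)) = k"
    "fst ` set (snd (transition q rs)) \<subseteq> {..<symbols M}"
proof -
  have "case transition q rs of (q', bs) \<Rightarrow> q' \<le> halt M \<and> length bs = k \<and> fst ` set bs \<subseteq> {..<symbols M}"
  proof (cases "q = halt M")
    case True
    then show ?thesis using assms by (auto simp: transition_def)
  next
    case False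
    then have "q < halt M" using assms(1) by simp
    moreover have "\<forall>q as. q < halt M \<and> length as = k \<and> set as \<subseteq> {..<symbols M} \<longrightarrow>
        (case delta M q as of (q', bs) \<Rightarrow> q' \<le> halt M \<and> length bs = k \<and> fst ` set bs \<subseteq> {..<symbols M})"
      using wf unfolding wf_tm_def by (elim conjE)
    ultimately have "case delta M q rs of (q', bs) \<Rightarrow> q' \<le> halt M \<and> length bs = k \<and> fst ` set bs \<subseteq> {..<symbols M}"
      using assms(2,3) by (elim allE[of _ q] allE[of _ rs] impE) (intro conjI)
    then show ?thesis using False by (simp add: transition_def)
  qed
  then show "fst (transition q rs) \<le> halt M" "length (snd (transition q rs)) = k"
    "fst ` set (snd (transition q rs)) \<subseteq> {..<symbols M}"
    by (simp_all add: case_prod_beta)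
qed

text \<open>A head moves at most one cell per step. Hence at time \<open>t\<close> all heads are at
  most \<open>t\<close>, within the width of the tableau.\<close>

definition bounded :: "nat \<Rightarrow> config \<Rightarrow> bool" where
  "bounded n c \<longleftrightarrow> fst c \<le> halt M \<and> length (snd c) = k \<and>
     (\<forall>j<k. (\<forall>i. fst (snd c ! j) i < symbols M) \<and> snd (snd c ! j) \<le> n)"

lemma bounded_heads:
  assumes "bounded n c"
  shows "length (map head_symbol (snd c)) = k" "set (map head_symbol (snd c)) \<subseteq> {..<symbols M}"
proof -
  show "set (map head_symbol (snd c)) \<subseteq> {..<symbols M}"
  proof
    fix x assume "x \<in> set (map head_symbol (snd c))"
    then obtain j where j: "j < k" "x = head_symbol (snd c ! j)"
      using assms by (auto simp: bounded_def in_set_conv_nth)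
    then show "x \<in> {..<symbols M}"
      using assms by (cases "snd c ! j") (auto simp: bounded_def)
  qed
qed (use assms in \<open>simp add: bounded_def\<close>)

lemma step_nth:
  assumes "bounded n c" "j < k"
  shows "snd (step M c) ! j = act (snd (transition (fst c) (map head_symbol (snd c))) ! j) (snd c ! j)"
proof -
  have "fst c \<le> halt M" "length (snd c) = k" using assms(1) by (auto simp: bounded_def)
  then show ?thesis
    using transition_wf(2)[OF _ bounded_heads[OF assms(1)]] assms(2)
    by (cases c) (simp add: step_transition)
qed

lemma bounded_step:
  assumes "bounded n c"
  shows "bounded (Suc n) (step M c)"
proof -
  obtain q ts where c: "c = (q, ts)" by (cases c)
  let ?t = "transition q (map head_symbol ts)"
  have q: "q \<le> halt M" "length ts = k" using assms by (auto simp: bounded_def c)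
  note tw = transition_wf[OF q(1) bounded_heads[OF assms, unfolded c snd_conv]]
  have "(\<forall>i. fst (snd (step M c) ! j) i < symbols M) \<and> snd (snd (step M c) ! j) \<le> Suc n" if j: "j < k" for j
  proof -
    obtain f h where fh: "ts ! j = (f, h)" by (cases "ts ! j")
    obtain b d where bd: "snd ?t ! j = (b, d)" by (cases "snd ?t ! j")
    have "snd ?t ! j \<in> set (snd ?t)" using j tw(2) by simp
    then have "b < symbols M" using tw(3) bd by force
    moreover have "\<forall>i. f i < symbols M" "h \<le> n"
      using assms j fh by (auto simp: bounded_def c)
    moreover have "snd (step M c) ! j = (f(h := b), move_head d h)"
      using step_nth[OF assms j] by (simp add: c fh bd)
    ultimately show ?thesis
      using move_head_le[of d h] by auto
  qed
  moreover have "fst (step M c) \<le> halt M" "length (snd (step M c)) = k"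
    using tw q by (simp_all add: c step_transition)
  ultimately show ?thesis unfolding bounded_def by blast
qed

lemma bounded_start: "bounded 0 (start_config M w)"
  using k2 symbols4 by (auto simp: bounded_def start_config_def nth_Cons' word_cells_def)

lemma bounded_steps: "bounded t ((step M ^^ t) (start_config M w))"
  by (induction t) (auto simp: bounded_start bounded_step)

definition cell_at :: "config \<Rightarrow> nat \<Rightarrow> cell" where
  "cell_at c i = (fst c, map head_symbol (snd c), map (\<lambda>(f, h). (f i, clamp (int i - int h))) (snd c))"

text \<open>The last condition ties the recorded head symbols to the tape: at distance 0 the symbol
  of the entry is the one under the head.\<close>

definition cells :: "cell set" where
  "cells = {(q, rs, ts). q \<le> halt M \<and> length rs = k \<and> set rs \<subseteq> {..<symbols M} \<and> length ts = k \<and>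
     set ts \<subseteq> {..<symbols M} \<times> {-2..2} \<and> (\<forall>j<k. snd (ts ! j) = 0 \<longrightarrow> fst (ts ! j) = rs ! j)}"

lemma finite_cells: "finite cells"
proof (rule finite_subset)
  show "cells \<subseteq> {..halt M} \<times> {rs. set rs \<subseteq> {..<symbols M} \<and> length rs = k} \<times>
      {ts. set ts \<subseteq> {..<symbols M} \<times> {-2..2} \<and> length ts = k}"
    by (auto simp: cells_def)
qed (intro finite_cartesian_product finite_lists_length_eq; simp)

definition horizontal :: "cell \<Rightarrow> cell \<Rightarrow> bool" where
  "horizontal x y \<longleftrightarrow> fst x = fst y \<and> fst (snd x) = fst (snd y) \<and>
     (\<forall>j<k. (snd (snd (snd x) ! j), snd (snd (snd y) ! j)) \<in> clamp_succ)"

text \<open>Only the entry under a head prescribes a new distance. The other distances and the new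
  head symbols are left to \<open>horizontal\<close> and \<open>cells\<close>.\<close>

definition vertical :: "bool \<Rightarrow> cell \<Rightarrow> cell \<Rightarrow> bool" where
  "vertical b x y \<longleftrightarrow> (let t = transition (fst x) (fst (snd x)) in fst y = fst t \<and>
     (\<forall>j<k. if snd (snd (snd x) ! j) = 0
        then snd (snd y) ! j = (fst (snd t ! j), shift b (snd (snd t ! j)))
        else fst (snd (snd y) ! j) = fst (snd (snd x) ! j)))"

lemma cell_at_nth:
  "j < length (snd c) \<Longrightarrow> snd (snd (cell_at c i)) ! j
     = (fst (snd c ! j) i, clamp (int i - int (snd (snd c ! j))))"
  by (simp add: cell_at_def case_prod_beta)

lemma clamp_eq_0: "clamp d = 0 \<longleftrightarrow> d = 0"
  by (auto simp: clamp_def)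

lemma cell_at_in_cells:
  assumes "bounded n c"
  shows "cell_at c i \<in> cells"
proof -
  have len: "length (snd c) = k" and q: "fst c \<le> halt M" using assms by (auto simp: bounded_def)
  have "(f i, clamp (int i - int h)) \<in> {..<symbols M} \<times> {-2..2}" if fh: "(f, h) \<in> set (snd c)" for f h
  proof -
    obtain j where "j < k" "snd c ! j = (f, h)" using fh len by (auto simp: in_set_conv_nth)
    then have "f i < symbols M" using assms by (auto simp: bounded_def)
    then show ?thesis by (simp add: clamp_def)
  qed
  then have ts: "set (snd (snd (cell_at c i))) \<subseteq> {..<symbols M} \<times> {-2..2}"
    by (auto simp: cell_at_def)
  have "fst (snd (snd (cell_at c i)) ! j) = fst (snd (cell_at c i)) ! j"
    if "j < k" "snd (snd (snd (cell_at c i)) ! j) = 0" for j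
  proof -
    have "int i - int (snd (snd c ! j)) = 0"
      using that cell_at_nth[of j c i] len by (simp add: clamp_eq_0)
    then have "i = snd (snd c ! j)" by simp
    then show ?thesis
      using that cell_at_nth[of j c i] len by (cases "snd c ! j") (simp add: cell_at_def)
  qed
  then show ?thesis
    using ts q len bounded_heads[OF assms] unfolding cells_def by (simp add: cell_at_def case_prod_beta)
qed

lemma horizontal_cell_at:
  assumes "bounded n c"
  shows "horizontal (cell_at c i) (cell_at c (Suc i))"
proof -
  have len: "length (snd c) = k" using assms by (simp add: bounded_def)
  have "(clamp (int i - h), clamp (int (Suc i) - h)) \<in> clamp_succ" for h
    using clamp_succ[of "int i - h"] by (simp add: algebra_simps)
  then show ?thesis
    unfolding horizontal_def using len by (simp add: cell_at_nth) (simp add: cell_at_def)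
qed

lemma vertical_cell_at:
  assumes "bounded n c"
  shows "vertical (i = 0) (cell_at c i) (cell_at (step M c) i)"
proof -
  obtain q ts where c: "c = (q, ts)" by (cases c)
  let ?t = "transition q (map head_symbol ts)"
  have len: "length ts = k" "length (snd (step M c)) = k"
    using assms bounded_step[OF assms] by (auto simp: bounded_def c)
  have 1: "fst (cell_at (step M c) i) = fst ?t"
    by (simp add: cell_at_def c step_transition)
  have 2: "if snd (snd (snd (cell_at c i)) ! j) = 0
        then snd (snd (cell_at (step M c) i)) ! j = (fst (snd ?t ! j), shift (i = 0) (snd (snd ?t ! j)))
        else fst (snd (snd (cell_at (step M c) i)) ! j) = fst (snd (snd (cell_at c i)) ! j)"
    if j: "j < k" for j
  proof -
    obtain f h where fh: "ts ! j = (f, h)" by (cases "ts ! j")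
    obtain b d where bd: "snd ?t ! j = (b, d)" by (cases "snd ?t ! j")
    have s: "snd (step M c) ! j = (f(h := b), move_head d h)"
      using step_nth[OF assms j] by (simp add: c fh bd)
    have x: "snd (snd (cell_at c i)) ! j = (f i, clamp (int i - int h))"
      using cell_at_nth[of j c i] len j by (simp add: c fh)
    have y: "snd (snd (cell_at (step M c) i)) ! j = ((f(h := b)) i, clamp (int i - int (move_head d h)))"
      using cell_at_nth[of j "step M c" i] len j by (simp only: s fst_conv snd_conv)
    show ?thesis
    proof (cases "i = h")
      case True
      have "clamp (shift b' d) = shift b' d" for b'
        using shift_bound[of b' d] by (simp add: clamp_def)
      then show ?thesis
        unfolding x y bd using True shift_move_head[of i d] by (simp add: clamp_eq_0)
    next
      case False
      then show ?thesis unfolding x y by (simp add: clamp_eq_0)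
    qed
  qed
  have 3: "fst (cell_at c i) = q" "fst (snd (cell_at c i)) = map head_symbol ts"
    by (simp_all add: cell_at_def c)
  show ?thesis
    unfolding vertical_def Let_def 3 using 1 2 by blast
qed

text \<open>At the old head position \<open>vertical\<close> gives the exact new distance, between
  -1 and 1, and \<open>clamp_row\<close> spreads it over the row. The new head is at most at
  \<open>Suc t\<close>, inside the row; there distance 0 and \<open>cells\<close> fix the head
  symbol, which \<open>horizontal\<close> copies to all entries.\<close>

lemma tableau_row:
  assumes c: "bounded t c" "Suc t < W"
    and cells: "\<And>i. i < W \<Longrightarrow> C i \<in> cells"
    and hor: "\<And>i. Suc i < W \<Longrightarrow> horizontal (C i) (C (Suc i))"
    and ver: "\<And>i. i < W \<Longrightarrow> vertical (i = 0) (cell_at c i) (C i)"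
    and i: "i < W"
  shows "C i = cell_at (step M c) i"
proof -
  obtain q ts where cq: "c = (q, ts)" by (cases c)
  let ?t = "transition q (map head_symbol ts)"
  have len: "length ts = k" "length (snd (step M c)) = k"
    using c(1) bounded_step[OF c(1)] by (auto simp: bounded_def cq)
  have len_C: "length (fst (snd (C i))) = k" "length (snd (snd (C i))) = k" if "i < W" for i
    using cells[OF that] by (auto simp: cells_def)
  have st: "fst (C i) = fst (step M c)" if "i < W" for i
    using ver[OF that] by (simp add: vertical_def Let_def cell_at_def cq step_transition)
  have tape: "snd (snd (C i)) ! j = (fst (snd (step M c) ! j) i, clamp (int i - int (snd (snd (step M c) ! j))))"
    if j: "j < k" and i: "i < W" for i j
  proof -
    obtain f h where fh: "ts ! j = (f, h)" by (cases "ts ! j")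
    obtain b d where bd: "snd ?t ! j = (b, d)" by (cases "snd ?t ! j")
    have s: "snd (step M c) ! j = (f(h := b), move_head d h)"
      using step_nth[OF c(1) j] by (simp add: cq fh bd)
    have x: "snd (snd (cell_at c i)) ! j = (f i, clamp (int i - int h))" for i
      using cell_at_nth[of j c i] len j by (simp add: cq fh)
    have h: "h < W" using c j fh by (auto simp: bounded_def cq)
    have v: "if i = h then snd (snd (C i)) ! j = (b, shift (i = 0) d) else fst (snd (snd (C i)) ! j) = f i"
      if "i < W" for i
    proof -
      have "if snd (snd (snd (cell_at c i)) ! j) = 0
        then snd (snd (C i)) ! j = (fst (snd ?t ! j), shift (i = 0) (snd (snd ?t ! j)))
        else fst (snd (snd (C i)) ! j) = fst (snd (snd (cell_at c i)) ! j)"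
        using ver[OF that] j unfolding vertical_def Let_def by (simp add: cell_at_def cq)
      then show ?thesis unfolding x bd by (simp add: clamp_eq_0 split: if_splits)
    qed
    have "snd (snd (snd (C i)) ! j) = clamp (int i - int (move_head d h))"
    proof (rule clamp_row[where W = W and j = h and F = "\<lambda>i. snd (snd (snd (C i)) ! j)"])
      show "(snd (snd (snd (C i)) ! j), snd (snd (snd (C (Suc i))) ! j)) \<in> clamp_succ"
        if "Suc i < W" for i
        using hor[OF that] j by (simp add: horizontal_def)
      show "snd (snd (snd (C h)) ! j) = int h - int (move_head d h)"
        using v[OF h] by (simp add: shift_move_head)
      show "\<bar>int h - int (move_head d h)\<bar> \<le> 1"
        unfolding shift_move_head by (rule shift_bound)
    qed (use h i in auto)
    moreover have "fst (snd (snd (C i)) ! j) = (f(h := b)) i"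
      using v[OF i] by (auto split: if_splits)
    ultimately show ?thesis unfolding s by (simp add: prod_eq_iff)
  qed
  have same: "fst (snd (C i)) = fst (snd (C 0))" if "i < W" for i
    using that
  proof (induction i)
    case (Suc i)
    then show ?case using hor[of i] by (simp add: horizontal_def)
  qed simp
  have rs: "fst (snd (C i)) = map head_symbol (snd (step M c))"
  proof (rule nth_equalityI)
    show "length (fst (snd (C i))) = length (map head_symbol (snd (step M c)))"
      using len_C[OF i] len by simp
    fix j assume "j < length (fst (snd (C i)))"
    then have j: "j < k" using len_C[OF i] by simp
    obtain f h where fh: "snd (step M c) ! j = (f, h)" by (cases "snd (step M c) ! j")
    have h: "h < W" using bounded_step[OF c(1)] c(2) j fh by (force simp: bounded_def)
    have "snd (snd (C h)) ! j = (f h, 0)"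
      using tape[OF j h] by (simp add: fh clamp_def)
    then have "f h = fst (snd (C h)) ! j"
      using cells[OF h] j by (auto simp: cells_def)
    then show "fst (snd (C i)) ! j = map head_symbol (snd (step M c)) ! j"
      using same[OF h] same[OF i] len j by (simp add: fh)
  qed
  have "snd (snd (C i)) = map (\<lambda>(f, h). (f i, clamp (int i - int h))) (snd (step M c))"
    by (rule nth_equalityI) (use len_C[OF i] len tape i in \<open>simp_all add: case_prod_beta\<close>)
  then show ?thesis
    using st[OF i] rs by (simp add: cell_at_def prod_eq_iff)
qed

lemma tableau:
  assumes c0: "bounded 0 c0" "T < W" "\<And>i. i < W \<Longrightarrow> C 0 i = cell_at c0 i"
    and cells: "\<And>t i. t \<le> T \<Longrightarrow> i < W \<Longrightarrow> C t i \<in> cells"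
    and hor: "\<And>t i. t \<le> T \<Longrightarrow> Suc i < W \<Longrightarrow> horizontal (C t i) (C t (Suc i))"
    and ver: "\<And>t i. t < T \<Longrightarrow> i < W \<Longrightarrow> vertical (i = 0) (C t i) (C (Suc t) i)"
  shows "t \<le> T \<Longrightarrow> i < W \<Longrightarrow> C t i = cell_at ((step M ^^ t) c0) i"
proof (induction t arbitrary: i)
  case 0
  then show ?case using c0(3) by simp
next
  case (Suc t)
  have b: "bounded t ((step M ^^ t) c0)"
    using c0(1) by (induction t) (auto simp: bounded_step)
  have "C (Suc t) i = cell_at (step M ((step M ^^ t) c0)) i"
  proof (rule tableau_row[OF b, where W = W])
    fix i assume i: "i < W"
    then show "vertical (i = 0) (cell_at ((step M ^^ t) c0) i) (C (Suc t) i)"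
      using ver[of t i] Suc.IH[of i] Suc.prems(1) by simp
  qed (use Suc.prems c0(2) cells hor in auto)
  then show ?case by simp
qed


section \<open>Clauses that express a correct tableau\<close>

section \<open>Tableaux as choice problems\<close>

lemma Ball_concat_map: "(\<forall>c\<in>set (concat (map f xs)). P c) \<longleftrightarrow> (\<forall>y\<in>set xs. \<forall>c\<in>set (f y). P c)"
  by auto

lemma Ball_if_Nil: "(\<forall>c\<in>set (if b then xs else []). P c) \<longleftrightarrow> (b \<longrightarrow> (\<forall>c\<in>set xs. P c))"
  by auto

text \<open>Depends on the machine only. In the reduction it is a constant, so
  \<open>PT_const\<close> covers its tables and any enumeration will do.\<close>

definition cell_list :: "cell list" where
  "cell_list = (SOME xs. set xs = cells)"

definition option_count :: nat where
  "option_count = length cell_list"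

lemma set_of_cell_list: "set cell_list = cells"
  unfolding cell_list_def using finite_list[OF finite_cells] by (rule someI_ex)

lemma option_in_cells: "a < option_count \<Longrightarrow> cell_list ! a \<in> cells"
  using set_of_cell_list unfolding option_count_def by (metis nth_mem)

lemma option_of_cell: "x \<in> cells \<Longrightarrow> \<exists>a<option_count. cell_list ! a = x"
  using set_of_cell_list unfolding option_count_def by (metis in_set_conv_nth)

definition satisfying :: "(cell \<Rightarrow> bool) \<Rightarrow> nat list" where
  "satisfying R = filter (\<lambda>a. R (cell_list ! a)) [0..<option_count]"

text \<open>The constraint \<open>R\<close> as positive clauses, one for each option
  \<open>a\<close>: the first entry is something other than \<open>a\<close>, or the second is
  related to \<open>a\<close>.\<close>

definition table :: "(cell \<Rightarrow> cell \<Rightarrow> bool) \<Rightarrow> (nat list \<times> nat list) list" where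
  "table R = map (\<lambda>a. (filter (\<lambda>b. b \<noteq> a) [0..<option_count], satisfying (R (cell_list ! a)))) [0..<option_count]"

definition pair_clauses :: "(nat list \<times> nat list) list \<Rightarrow> nat \<Rightarrow> nat \<Rightarrow> (nat \<times> nat) list list" where
  "pair_clauses tb j l = map (\<lambda>p. map (\<lambda>a. (j, a)) (fst p) @ map (\<lambda>b. (l, b)) (snd p)) tb"

definition covered :: "nat \<Rightarrow> (nat \<Rightarrow> nat) \<Rightarrow> (nat \<times> nat) list \<Rightarrow> bool" where
  "covered L ch c \<longleftrightarrow> (\<exists>j<L. (j, ch j) \<in> set c)"

lemma covered_unit: "j < L \<Longrightarrow> covered L ch (map (\<lambda>a. (j, a)) xs) \<longleftrightarrow> ch j \<in> set xs"
  by (auto simp: covered_def)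

lemma mem_satisfying: "a < option_count \<Longrightarrow> a \<in> set (satisfying R) \<longleftrightarrow> R (cell_list ! a)"
  by (simp add: satisfying_def)

lemma covered_pair_clauses:
  assumes "j < L" "l < L" "ch j < option_count" "ch l < option_count"
  shows "(\<forall>c\<in>set (pair_clauses (table R) j l). covered L ch c) \<longleftrightarrow> R (cell_list ! ch j) (cell_list ! ch l)"
proof -
  have "covered L ch (map (\<lambda>a. (j, a)) xs @ map (\<lambda>b. (l, b)) ys) \<longleftrightarrow> ch j \<in> set xs \<or> ch l \<in> set ys" for xs ys
    using assms(1,2) by (auto simp: covered_def)
  then have "(\<forall>c\<in>set (pair_clauses (table R) j l). covered L ch c) \<longleftrightarrow>
      (\<forall>a<option_count. ch j \<noteq> a \<or> R (cell_list ! a) (cell_list ! ch l))"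
    using assms(3,4) by (auto simp: pair_clauses_def table_def mem_satisfying)
  then show ?thesis using assms(3) by blast
qed

definition init_cell :: "nat \<Rightarrow> nat \<Rightarrow> cell" where
  "init_cell s i = (0, replicate k 1, (s, clamp (int i)) # replicate (k - 1) (of_bool (i = 0), clamp (int i)))"

lemma cell_at_start: "cell_at (start_config M w) i = init_cell (word_cells w i) i"
proof -
  have "replicate k (1::nat) = 1 # replicate (k - 1) 1"
    using k2 by (cases k) auto
  then show ?thesis
    by (simp add: cell_at_def start_config_def init_cell_def map_replicate_const word_cells_def)
qed

text \<open>From cell 2 on the clamped distance is constant, so three tables cover all initial
  cells.\<close>

lemma init_cell_2: "2 \<le> i \<Longrightarrow> init_cell s i = init_cell s 2"
  by (simp add: init_cell_def clamp_def)

definition init_table :: "nat \<Rightarrow> nat list list" where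
  "init_table i = map (\<lambda>s. satisfying (\<lambda>x. x = init_cell s i)) [0..<4]"

definition init_clause :: "nat \<Rightarrow> nat list \<Rightarrow> (nat \<times> nat) list" where
  "init_clause i sl = map (\<lambda>a. (i, a)) (concat (map (\<lambda>s. nth_or []
     (if i = 0 then init_table 0 else if i = 1 then init_table 1 else init_table 2) s) sl))"

lemma covered_init_clause:
  assumes "i < L" "ch i < option_count" "\<forall>s\<in>set sl. s < 4"
  shows "covered L ch (init_clause i sl) \<longleftrightarrow> (\<exists>s\<in>set sl. cell_list ! ch i = init_cell s i)"
proof -
  have "nth_or [] (if i = 0 then init_table 0 else if i = 1 then init_table 1 else init_table 2) s
      = satisfying (\<lambda>x. x = init_cell s i)" if "s < 4" for s
    using that init_cell_2[of i s] by (auto simp: nth_or_def init_table_def)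
  then have "set (concat (map (\<lambda>s. nth_or []
     (if i = 0 then init_table 0 else if i = 1 then init_table 1 else init_table 2) s) sl))
     = (\<Union>s\<in>set sl. set (satisfying (\<lambda>x. x = init_cell s i)))"
    using assms(3) by simp
  then show ?thesis
    unfolding init_clause_def covered_unit[OF assms(1)] using mem_satisfying[OF assms(2)] by auto
qed

text \<open>The certificate on the input tape is followed by blanks only.\<close>

definition blank_mono :: "cell \<Rightarrow> cell \<Rightarrow> bool" where
  "blank_mono x y \<longleftrightarrow> (fst (snd (snd x) ! 0) = 0 \<longrightarrow> fst (snd (snd y) ! 0) = 0)"

text \<open>Symbol 3 in cell 1 and a blank in cell 2 of the output tape mean the output
  \<open>[True]\<close>.\<close>

definition final :: "nat \<Rightarrow> cell \<Rightarrow> bool" where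
  "final s x \<longleftrightarrow> fst x = halt M \<and> fst (snd (snd x) ! 1) = s"

text \<open>The entry at time \<open>t\<close> and position \<open>i\<close> has number
  \<open>t * W + i\<close>. The ranges \<open>ts\<close> and \<open>ws\<close> are arguments, since
  they cannot be produced in polynomial time from binary \<open>T\<close> and
  \<open>W\<close>.\<close>

definition tableau_clauses :: "nat \<Rightarrow> nat \<Rightarrow> nat list \<Rightarrow> nat list \<Rightarrow> nat list list \<Rightarrow> (nat \<times> nat) list list" where
  "tableau_clauses T W ts ws ss =
     map (\<lambda>a. (T * W + 1, a)) (satisfying (final 3)) # map (\<lambda>a. (T * W + 2, a)) (satisfying (final 0)) #
     map (\<lambda>p. init_clause (fst p) (snd p)) (zip ws ss) @
     concat (map (\<lambda>i. if Suc i < W then pair_clauses (table blank_mono) i (Suc i) else []) ws) @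
     concat (map (\<lambda>t. concat (map (\<lambda>i. if Suc i < W
       then pair_clauses (table horizontal) (t * W + i) (t * W + Suc i) else []) ws)) (ts @ [T])) @
     concat (map (\<lambda>t. concat (map (\<lambda>i.
       pair_clauses (if i = 0 then table (vertical True) else table (vertical False))
         (t * W + i) (Suc t * W + i)) ws)) ts)"

lemma PT_tableau_clauses [pt]:
  assumes "PT T" "PT W" "PT ts" "PT ws" "PT ss"
  shows "PT (\<lambda>x. tableau_clauses (T x) (W x) (ts x) (ws x) (ss x))"
  unfolding tableau_clauses_def init_clause_def pair_clauses_def
  by (intro pt assms PT_comp[OF assms(1)] PT_comp[OF assms(2)] PT_comp[OF assms(3)] PT_comp[OF assms(4)]
      PT_comp[OF assms(5)])

lemma tableau_clauses_iff:
  assumes ch: "\<forall>j<Suc T * W. ch j < option_count" and W: "2 < W" "length ss = W"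
    and ss: "\<forall>sl\<in>set ss. \<forall>s\<in>set sl. s < 4"
  defines "C \<equiv> \<lambda>t i. cell_list ! ch (t * W + i)"
  shows "(\<forall>c\<in>set (tableau_clauses T W [0..<T] [0..<W] ss). covered (Suc T * W) ch c) \<longleftrightarrow>
     final 3 (C T 1) \<and> final 0 (C T 2) \<and>
     (\<forall>i<W. \<exists>s\<in>set (ss ! i). C 0 i = init_cell s i) \<and>
     (\<forall>i. Suc i < W \<longrightarrow> blank_mono (C 0 i) (C 0 (Suc i))) \<and>
     (\<forall>t\<le>T. \<forall>i. Suc i < W \<longrightarrow> horizontal (C t i) (C t (Suc i))) \<and>
     (\<forall>t<T. \<forall>i<W. vertical (i = 0) (C t i) (C (Suc t) i))"
proof -
  let ?L = "Suc T * W"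
  have idx: "t * W + i < ?L" if "t \<le> T" "i < W" for t i
    using mult_add_less[of t "Suc T" i W] that by simp
  have g: "ch (t * W + i) < option_count" if "t \<le> T" "i < W" for t i
    using ch idx[OF that] by blast
  have g0: "ch i < option_count" "i < ?L" if "i < W" for i
    using g[of 0 i] idx[of 0 i] that by simp_all
  have 1: "covered ?L ch (map (\<lambda>a. (T * W + i, a)) (satisfying R)) \<longleftrightarrow> R (C T i)" if "i < W" for i R
    using covered_unit[OF idx[OF le_refl that]] mem_satisfying[OF g[OF le_refl that]] by (simp add: C_def)
  have 2: "(\<forall>c\<in>set (map (\<lambda>p. init_clause (fst p) (snd p)) (zip [0..<W] ss)). covered ?L ch c) \<longleftrightarrow>
      (\<forall>i<W. \<exists>s\<in>set (ss ! i). C 0 i = init_cell s i)"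
  proof -
    have "(\<forall>c\<in>set (map (\<lambda>p. init_clause (fst p) (snd p)) (zip [0..<W] ss)). covered ?L ch c) \<longleftrightarrow>
        (\<forall>i<W. covered ?L ch (init_clause i (ss ! i)))"
    proof -
      have "zip [0..<W] ss = map (\<lambda>i. (i, ss ! i)) [0..<W]"
        by (rule nth_equalityI) (use W(2) in auto)
      then show ?thesis by auto
    qed
    also have "\<dots> \<longleftrightarrow> (\<forall>i<W. \<exists>s\<in>set (ss ! i). cell_list ! ch i = init_cell s i)"
    proof (intro all_cong)
      fix i assume i: "i < W"
      then have "\<forall>s\<in>set (ss ! i). s < 4" using bspec[OF ss nth_mem[of i ss]] W(2) by simp
      from covered_init_clause[of i ?L ch, OF g0(2,1)[OF i] this]
      show "covered ?L ch (init_clause i (ss ! i)) \<longleftrightarrow> (\<exists>s\<in>set (ss ! i). cell_list ! ch i = init_cell s i)" .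
    qed
    finally show ?thesis by (simp add: C_def)
  qed
  have p: "(\<forall>c\<in>set (pair_clauses (table R) (t * W + i) (u * W + l)). covered ?L ch c) \<longleftrightarrow> R (C t i) (C u l)"
    if "t \<le> T" "u \<le> T" "i < W" "l < W" for R t u i l
    unfolding C_def using that by (intro covered_pair_clauses idx g)
  have 3: "(\<forall>c\<in>set (concat (map (\<lambda>i. if Suc i < W then pair_clauses (table blank_mono) i (Suc i) else []) [0..<W])).
      covered ?L ch c) \<longleftrightarrow> (\<forall>i. Suc i < W \<longrightarrow> blank_mono (C 0 i) (C 0 (Suc i)))"
  proof -
    have "(\<forall>c\<in>set (pair_clauses (table blank_mono) i (Suc i)). covered ?L ch c) \<longleftrightarrow>
        blank_mono (C 0 i) (C 0 (Suc i))" if "Suc i < W" for i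
      using p[of 0 0 i "Suc i"] that by simp
    then show ?thesis unfolding Ball_concat_map Ball_if_Nil by auto
  qed
  have 4: "(\<forall>c\<in>set (concat (map (\<lambda>t. concat (map (\<lambda>i. if Suc i < W
       then pair_clauses (table horizontal) (t * W + i) (t * W + Suc i) else []) [0..<W])) ([0..<T] @ [T]))).
      covered ?L ch c) \<longleftrightarrow> (\<forall>t\<le>T. \<forall>i. Suc i < W \<longrightarrow> horizontal (C t i) (C t (Suc i)))"
  proof -
    have "(\<forall>c\<in>set (concat (map (\<lambda>i. if Suc i < W
       then pair_clauses (table horizontal) (t * W + i) (t * W + Suc i) else []) [0..<W])). covered ?L ch c) \<longleftrightarrow>
       (\<forall>i. Suc i < W \<longrightarrow> horizontal (C t i) (C t (Suc i)))" if t: "t \<le> T" for t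
    proof -
      have "(\<forall>c\<in>set (pair_clauses (table horizontal) (t * W + i) (t * W + Suc i)). covered ?L ch c) \<longleftrightarrow>
        horizontal (C t i) (C t (Suc i))" if "Suc i < W" for i
        using p[of t t i "Suc i"] that t by simp
      then show ?thesis unfolding Ball_concat_map Ball_if_Nil by auto
    qed
    moreover have "set ([0..<T] @ [T]) = {..T}" by auto
    ultimately show ?thesis unfolding Ball_concat_map[where xs = "[0..<T] @ [T]"] by auto
  qed
  have 5: "(\<forall>c\<in>set (concat (map (\<lambda>t. concat (map (\<lambda>i.
       pair_clauses (if i = 0 then table (vertical True) else table (vertical False))
         (t * W + i) (Suc t * W + i)) [0..<W])) [0..<T])). covered ?L ch c) \<longleftrightarrow>
     (\<forall>t<T. \<forall>i<W. vertical (i = 0) (C t i) (C (Suc t) i))"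
  proof -
    have "(\<forall>c\<in>set (pair_clauses (if i = 0 then table (vertical True) else table (vertical False))
         (t * W + i) (Suc t * W + i)). covered ?L ch c) \<longleftrightarrow> vertical (i = 0) (C t i) (C (Suc t) i)"
      if "t < T" "i < W" for t i
      using p[of t "Suc t" i i] that by (cases "i = 0") simp_all
    then show ?thesis unfolding Ball_concat_map by auto
  qed
  show ?thesis
    unfolding tableau_clauses_def list.set set_append ball_Un ball_simps 1[of 1 "final 3"] 2 3 4 5
    using 1[of 1] 1[of 2] W(1) by simp
qed

definition input_symbols :: "bool list \<Rightarrow> nat \<Rightarrow> nat \<Rightarrow> nat list list" where
  "input_symbols y Q R = [1] # map (\<lambda>b. [if b then 3 else 2]) y @ replicate Q [0, 2, 3] @ replicate R [0]"

lemma length_input_symbols: "length (input_symbols y Q R) = Suc (length y + Q + R)"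
  by (simp add: input_symbols_def)

lemma input_symbols_nth:
  "input_symbols y Q R ! 0 = [1]"
  "i < length y \<Longrightarrow> input_symbols y Q R ! Suc i = [if y ! i then 3 else 2]"
  "i < Q \<Longrightarrow> input_symbols y Q R ! Suc (length y + i) = [0, 2, 3]"
  "i < R \<Longrightarrow> input_symbols y Q R ! Suc (length y + Q + i) = [0]"
  by (simp_all add: input_symbols_def nth_append)

lemma input_symbols_cases:
  assumes "i < length (input_symbols y Q R)"
  obtains "i = 0" | j where "i = Suc j" "j < length y" | j where "i = Suc (length y + j)" "j < Q"
    | j where "i = Suc (length y + Q + j)" "j < R"
proof -
  consider "i = 0" | "0 < i" "i \<le> length y" | "length y < i" "i \<le> length y + Q" | "length y + Q < i"
    by linarith
  then show thesis
  proof cases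
    case 1
    then show thesis using that(1) by simp
  next
    case 2
    then show thesis using that(2)[of "i - 1"] by simp
  next
    case 3
    then show thesis using that(3)[of "i - Suc (length y)"] by simp
  next
    case 4
    then show thesis using that(4)[of "i - Suc (length y + Q)"] assms by (simp add: length_input_symbols)
  qed
qed

lemma input_symbols_less: "sl \<in> set (input_symbols y Q R) \<Longrightarrow> s \<in> set sl \<Longrightarrow> s < 4"
  by (auto simp: input_symbols_def split: if_splits)

lemma word_cells_mono: "word_cells w i = 0 \<Longrightarrow> word_cells w (Suc i) = 0"
  by (auto simp: word_cells_def split: if_splits)

lemma word_cells_in_input_symbols:
  assumes "length u \<le> Q" "i < length (input_symbols y Q R)"
  shows "word_cells (y @ u) i \<in> set (input_symbols y Q R ! i)"
  using assms(2)
proof (cases rule: input_symbols_cases)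
  case (2 j)
  then show ?thesis by (simp add: input_symbols_nth word_cells_def nth_append)
next
  case (3 j)
  then show ?thesis by (simp add: input_symbols_nth word_cells_def)
next
  case (4 j)
  then show ?thesis using assms(1) by (simp add: input_symbols_nth word_cells_def)
qed (simp add: input_symbols_nth word_cells_def)

text \<open>The certificate ends at the first blank after \<open>y\<close>. There is one at offset
  \<open>Q\<close>, because the closing cells are blank, and by monotonicity everything after the
  first one is blank too.\<close>

lemma word_of_input_symbols:
  assumes f: "\<And>i. i < W \<Longrightarrow> f i \<in> set (input_symbols y Q R ! i)"
    and mono: "\<And>i. Suc i < W \<Longrightarrow> f i = 0 \<Longrightarrow> f (Suc i) = 0"
    and W: "W = length (input_symbols y Q R)" and R: "0 < R"
  shows "\<exists>u. length u \<le> Q \<and> (\<forall>i<W. f i = word_cells (y @ u) i)"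
proof -
  let ?n = "Suc (length y)"
  have Wn: "W = ?n + Q + R" using W by (simp add: length_input_symbols)
  have f0: "f (?n + Q) = 0"
    using f[of "?n + Q"] input_symbols_nth(4)[of 0 R y Q] R Wn by simp
  define r where "r = (LEAST r. f (?n + r) = 0)"
  have r: "f (?n + r) = 0" "r \<le> Q" "j < r \<Longrightarrow> f (?n + j) \<noteq> 0" for j
    unfolding r_def using f0 by (rule LeastI, rule Least_le, blast dest: not_less_Least)
  define u where "u = map (\<lambda>j. f (?n + j) = 3) [0..<r]"
  have later: "f i = 0" if "?n + r \<le> i" "i < W" for i
    using that
  proof (induction i rule: dec_induct)
    case base
    show ?case by (rule r(1))
  next
    case (step i)
    then show ?case using mono[of i] by simp
  qed
  have "f i = word_cells (y @ u) i" if i: "i < W" for i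
    using i[unfolded W]
  proof (cases rule: input_symbols_cases)
    case 1
    then show ?thesis using f[OF i] by (simp add: input_symbols_nth word_cells_def)
  next
    case (2 j)
    then show ?thesis using f[OF i] by (simp add: input_symbols_nth word_cells_def nth_append)
  next
    case (3 j)
    show ?thesis
    proof (cases "j < r")
      case True
      then have "f i \<in> {2, 3}" using f[OF i] r(3)[of j] 3 by (auto simp: input_symbols_nth)
      then show ?thesis using True 3 by (auto simp: word_cells_def nth_append u_def)
    next
      case False
      then have "f i = 0" using later[of i] 3 i by simp
      then show ?thesis using False 3 by (simp add: word_cells_def u_def)
    qed
  next
    case (4 j)
    then have "f i = 0" using later[of i] r(2) i by simp
    then show ?thesis using 4 r(2) by (simp add: word_cells_def u_def)
  qed
  then show ?thesis using r(2) by (intro exI[of _ u]) (simp add: u_def)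
qed

lemma final_cell_at:
  "bounded n c \<Longrightarrow> final s (cell_at c i) \<longleftrightarrow> fst c = halt M \<and> fst (snd c ! 1) i = s"
  using k2 by (simp add: final_def cell_at_nth bounded_def) (simp add: cell_at_def)

lemma blank_mono_init_cell: "blank_mono (init_cell s i) (init_cell s' j) \<longleftrightarrow> (s = 0 \<longrightarrow> s' = 0)"
  by (simp add: blank_mono_def init_cell_def)

lemma tableau_sat_iff:
  assumes W: "W = length (input_symbols y Q R)" and T: "T < W" "2 < W" and R: "0 < R"
  shows "choice_sat (Suc T * W) option_count (tableau_clauses T W [0..<T] [0..<W] (input_symbols y Q R)) \<longleftrightarrow>
    (\<exists>u. length u \<le> Q \<and> (let c = (step M ^^ T) (start_config M (y @ u)) in
       fst c = halt M \<and> fst (snd c ! 1) 1 = 3 \<and> fst (snd c ! 1) 2 = 0))" (is "?L \<longleftrightarrow> ?R")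
proof -
  let ?ss = "input_symbols y Q R" and ?conf = "\<lambda>u t. (step M ^^ t) (start_config M (y @ u))"
  have ss: "\<forall>sl\<in>set ?ss. \<forall>s\<in>set sl. s < 4" using input_symbols_less by blast
  note iff = tableau_clauses_iff[OF _ T(2) W[symmetric] ss, of T]
  show ?thesis
  proof
    assume ?L
    then obtain ch where ch: "\<forall>j<Suc T * W. ch j < option_count"
      "\<forall>c\<in>set (tableau_clauses T W [0..<T] [0..<W] ?ss). covered (Suc T * W) ch c"
      unfolding choice_sat_def covered_def by blast
    define C where "C = (\<lambda>t i. cell_list ! ch (t * W + i))"
    have C: "final 3 (C T 1)" "final 0 (C T 2)"
      "\<And>i. i < W \<Longrightarrow> \<exists>s\<in>set (?ss ! i). C 0 i = init_cell s i"
      "\<And>i. Suc i < W \<Longrightarrow> blank_mono (C 0 i) (C 0 (Suc i))"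
      "\<And>t i. t \<le> T \<Longrightarrow> Suc i < W \<Longrightarrow> horizontal (C t i) (C t (Suc i))"
      "\<And>t i. t < T \<Longrightarrow> i < W \<Longrightarrow> vertical (i = 0) (C t i) (C (Suc t) i)"
      using iff[OF ch(1)] ch(2) unfolding C_def by simp_all
    have cells: "C t i \<in> cells" if "t \<le> T" "i < W" for t i
      using mult_add_less[of t "Suc T" i W] that ch(1) unfolding C_def by (intro option_in_cells) simp
    from C(3) obtain f where f: "\<And>i. i < W \<Longrightarrow> f i \<in> set (?ss ! i)" "\<And>i. i < W \<Longrightarrow> C 0 i = init_cell (f i) i"
      by metis
    have "\<exists>u. length u \<le> Q \<and> (\<forall>i<W. f i = word_cells (y @ u) i)"
    proof (rule word_of_input_symbols[OF f(1) _ W R])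
      show "f (Suc i) = 0" if "Suc i < W" "f i = 0" for i
        using C(4)[OF that(1)] f(2)[of i] f(2)[of "Suc i"] that by (simp add: blank_mono_init_cell)
    qed
    then obtain u where u: "length u \<le> Q" "\<And>i. i < W \<Longrightarrow> f i = word_cells (y @ u) i" by blast
    have "C t i = cell_at (?conf u t) i" if "t \<le> T" "i < W" for t i
    proof (rule tableau[where C = C and W = W, OF bounded_start T(1)])
      show "C 0 i = cell_at (start_config M (y @ u)) i" if "i < W" for i
        by (simp only: f(2)[OF that] u(2)[OF that] cell_at_start)
    qed (use cells C(5,6) that in auto)
    then have "final 3 (cell_at (?conf u T) 1)" "final 0 (cell_at (?conf u T) 2)"
      using C(1,2) T(2) by simp_all
    then show ?R
      unfolding final_cell_at[OF bounded_steps] Let_def using u(1) by blast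
  next
    assume ?R
    then obtain u where u: "length u \<le> Q" "fst (?conf u T) = halt M" "fst (snd (?conf u T) ! 1) 1 = 3"
      "fst (snd (?conf u T) ! 1) 2 = 0" unfolding Let_def by blast
    define C where "C = (\<lambda>t i. cell_at (?conf u t) i)"
    have "\<forall>j. \<exists>a. a < option_count \<and> cell_list ! a = C (j div W) (j mod W)"
      unfolding C_def using option_of_cell[OF cell_at_in_cells[OF bounded_steps]] by blast
    from choice[OF this] obtain ch where ch: "\<forall>j. ch j < option_count \<and> cell_list ! ch j = C (j div W) (j mod W)"
      by (rule exE)
    have o: "cell_list ! ch (t * W + i) = C t i" if "i < W" for t i
    proof -
      have "(t * W + i) div W = t" "(t * W + i) mod W = i" using that by simp_all
      then show ?thesis using spec[OF ch, of "t * W + i"] by simp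
    qed
    have "\<forall>c\<in>set (tableau_clauses T W [0..<T] [0..<W] ?ss). covered (Suc T * W) ch c"
    proof (subst iff, intro allI impI)
      show "ch j < option_count" for j using ch by blast
      have 1: "final 3 (C T 1)" "final 0 (C T 2)"
        unfolding C_def final_cell_at[OF bounded_steps] using u by simp_all
      have 2: "C 0 i = init_cell (word_cells (y @ u) i) i" for i
        by (simp add: C_def cell_at_start)
      have 3: "horizontal (C t i) (C t (Suc i))" for t i
        unfolding C_def by (rule horizontal_cell_at[OF bounded_steps])
      have 4: "vertical (i = 0) (C t i) (C (Suc t) i)" for t i
        unfolding C_def using vertical_cell_at[OF bounded_steps] by simp
      have 5: "cell_list ! ch (T * W + 1) = C T 1" "cell_list ! ch (T * W + 2) = C T 2"
        using T(2) by (simp_all only: o)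
      show "final 3 (cell_list ! ch (T * W + 1)) \<and> final 0 (cell_list ! ch (T * W + 2)) \<and>
          (\<forall>i<W. \<exists>s\<in>set (?ss ! i). cell_list ! ch (0 * W + i) = init_cell s i) \<and>
          (\<forall>i. Suc i < W \<longrightarrow> blank_mono (cell_list ! ch (0 * W + i)) (cell_list ! ch (0 * W + Suc i))) \<and>
          (\<forall>t\<le>T. \<forall>i. Suc i < W \<longrightarrow> horizontal (cell_list ! ch (t * W + i)) (cell_list ! ch (t * W + Suc i))) \<and>
          (\<forall>t<T. \<forall>i<W. vertical (i = 0) (cell_list ! ch (t * W + i)) (cell_list ! ch (Suc t * W + i)))"
      proof (intro conjI allI impI)
        show "\<exists>s\<in>set (?ss ! i). cell_list ! ch (0 * W + i) = init_cell s i" if "i < W" for i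
          unfolding o[OF that] 2 using word_cells_in_input_symbols[OF u(1)] that W by blast
        show "blank_mono (cell_list ! ch (0 * W + i)) (cell_list ! ch (0 * W + Suc i))" if "Suc i < W" for i
          unfolding o[OF that] o[OF Suc_lessD[OF that]] 2 blank_mono_init_cell
          using word_cells_mono by blast
        show "horizontal (cell_list ! ch (t * W + i)) (cell_list ! ch (t * W + Suc i))" if "Suc i < W" for t i
          unfolding o[OF that] o[OF Suc_lessD[OF that]] by (rule 3)
        show "vertical (i = 0) (cell_list ! ch (t * W + i)) (cell_list ! ch (Suc t * W + i))" if "i < W" for t i
          unfolding o[OF that] by (rule 4)
      qed (simp_all only: 5 1)
    qed
    then show ?L
      unfolding choice_sat_def covered_def using ch by blast
  qed
qed

lemma steps_halted: "fst c = halt M \<Longrightarrow> (step M ^^ t) c = c"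
proof (induction t)
  case (Suc t)
  then show ?case by (cases c) (simp add: step.simps)
qed simp

end

lemma output_is_True:
  assumes "output_is c z"
  shows "z = [True] \<longleftrightarrow> fst (snd c ! 1) 1 = 3 \<and> fst (snd c ! 1) 2 = 0"
proof -
  have z: "fst (snd c ! 1) i = word_cells z i" if "1 \<le> i" "i \<le> Suc (length z)" for i
    using assms that by (simp add: output_is_def)
  show ?thesis
  proof (cases z)
    case Nil
    then show ?thesis using z[of 1] by (simp add: word_cells_def)
  next
    case (Cons a z')
    then have "fst (snd c ! 1) 1 = word_cells z 1" "fst (snd c ! 1) 2 = word_cells z 2"
      using z[of 1] z[of 2] by simp_all
    then show ?thesis
      using Cons by (cases z') (auto simp: word_cells_def)
  qed
qed

text \<open>Polynomial quantities in unary: the lists bound the certificates and the running time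
  and supply the ranges. The recursion over the coefficients is Horner's scheme.\<close>

lemma PT_poly_list:
  fixes f :: "'a::enc \<Rightarrow> 'b::enc list"
  assumes "PT f"
  shows "\<exists>g :: 'a \<Rightarrow> bool list. PT g \<and> (\<forall>x. length (g x) = poly p (length (f x)))"
proof (induction p)
  case 0
  show ?case by (intro exI[of _ "\<lambda>x. []"]) (simp add: PT_const)
next
  case (pCons a p)
  then obtain g :: "'a \<Rightarrow> bool list" where g: "PT g" "\<And>x. length (g x) = poly p (length (f x))" by blast
  have "PT (\<lambda>x. replicate a False @ concat (map (\<lambda>_. g x) (f x)))"
    by (intro pt assms PT_comp[OF g(1)])
  moreover have "length (replicate a False @ concat (map (\<lambda>_. g x) (f x))) = poly (pCons a p) (length (f x))" for x
    by (simp add: length_concat comp_def sum_list_triv g(2))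
  ultimately show ?case by blast
qed

theorem NP_hard_MDCWSP_D: "NP_hard MDCWSP_D"
  unfolding NP_hard_def
proof
  fix A assume "A \<in> NP"
  then obtain V and q :: "nat poly" where V: "polytime V" and q: "\<And>x. x \<in> A \<longleftrightarrow>
      (\<exists>u. length u \<le> poly q (length x) \<and> V (pair_word x u) = [True])"
    unfolding NP_def by blast
  from V obtain M and p :: "nat poly" where M: "wf_tm M" "computes_in_time M V (poly p)"
    unfolding polytime_def by blast
  interpret machine M by (standard) (rule M(1))
  obtain ql :: "bool list \<Rightarrow> bool list" where ql: "PT ql" "\<And>x. length (ql x) = poly q (length x)"
    using PT_poly_list[OF PT_id, of q] by blast
  \<comment> \<open>The clock covers every certificate: \<open>pair_word x u\<close> has length
    \<open>2 * n + 1 + length u\<close> for \<open>n = length x\<close>, and \<open>length u\<close>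
    is at most \<open>poly q n\<close>.\<close>
  obtain tl' :: "bool list \<Rightarrow> bool list" where tl: "PT tl'"
    "\<And>x. length (tl' x) = poly (pcompose p ([:1, 2:] + q)) (length x)"
    using PT_poly_list[OF PT_id, of "pcompose p ([:1, 2:] + q)"] by blast
  \<comment> \<open>The \<open>3 + T x\<close> closing blanks make a row longer than
    \<open>T x\<close> and longer than 2.\<close>
  define ss :: "bool list \<Rightarrow> nat list list" where "ss x = [1] # map (\<lambda>b. [if b then 3 else 2]) (delimit x) @
      map (\<lambda>_. [0, 2, 3]) (ql x) @ map (\<lambda>_. [0]) ([False, False, False] @ tl' x)" for x
  define T where "T x = length (tl' x)" for x
  define W where "W x = length (ss x)" for x
  define L where "L x = Suc (T x) * W x" for x
  define cs where "cs x = tableau_clauses (T x) (W x) [0..<length (tl' x)] [0..<length (ss x)] (ss x)" for x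
  \<comment> \<open>Ranges come from lengths of lists: \<open>Suc (T x)\<close> copies of a row of
    length \<open>W x\<close> give \<open>L x\<close>, and for \<open>ks\<close> the options
    repeated \<open>L x\<close> times with two further entries give \<open>K x\<close>.\<close>
  define js where "js x = [0..<length (concat (map (\<lambda>_. ss x) (False # tl' x)))]" for x
  define K where "K x = L x * option_count + 2" for x
  define ks where "ks x = [0..<length (concat (map (\<lambda>_. [0..<option_count]) (js x)) @ [0, 0])]" for x
  define es :: "bool list \<Rightarrow> edge list" where "es x = map (\<lambda>q. (q, (1, 1)))
      (dedup (choice_arcs (L x) option_count (K x) (js x) [0..<option_count] (ks x) (cs x)))" for x
  define red where "red x = encode_nats (inst_nats True (Suc (L x * option_count + length (cs x) * K x))
      (length (tl (cs x)) * K x + Suc (L x * option_count)) (es x))" for x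
  have ss_eq: "ss x = input_symbols (delimit x) (poly q (length x)) (3 + T x)" for x
    by (simp add: ss_def input_symbols_def T_def ql(2) map_replicate_const numeral_3_eq_3)
  have "PT red"
  proof -
    have 1: "PT ss" unfolding ss_def by (intro pt ql(1) tl(1))
    have 2: "PT T" unfolding T_def by (intro pt tl(1))
    have 3: "PT W" unfolding W_def by (intro pt 1)
    have 4: "PT L" unfolding L_def by (intro pt 2 3)
    have 5: "PT cs" unfolding cs_def by (intro pt 1 2 3 tl(1))
    have 6: "PT js" unfolding js_def by (intro pt 1 tl(1) PT_comp[OF 1])
    have 7: "PT K" unfolding K_def by (intro pt 4)
    have 8: "PT ks" unfolding ks_def by (intro pt 6)
    have 9: "PT es" unfolding es_def by (intro pt 4 5 6 7 8)
    show ?thesis unfolding red_def inst_nats_def by (intro pt 4 5 7 9)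
  qed
  then have "polytime red" by (rule polytime_PT)
  moreover have "x \<in> A \<longleftrightarrow> red x \<in> MDCWSP_D" for x
  proof -
    have W: "T x < W x" "2 < W x"
      unfolding W_def ss_eq length_input_symbols by simp_all
    have cs0: "cs x \<noteq> []" by (simp add: cs_def tableau_clauses_def)
    have L0: "0 < L x" using W by (simp add: L_def)
    have js: "js x = [0..<L x]"
      by (simp add: js_def L_def W_def T_def length_concat comp_def sum_list_triv)
    have ks: "ks x = [0..<K x]"
      by (simp add: ks_def K_def js length_concat comp_def sum_list_triv)
    interpret G: choice_graph "L x" option_count "cs x" "K x"
      by unfold_locales (simp_all add: cs0 L0 K_def)
    have "red x = encode G.X G.bound"
      unfolding encode_inst_nats red_def
      by (simp add: G.X_def G.bound_def G.arc_pairs_def es_def js ks)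
    then have "red x \<in> MDCWSP_D \<longleftrightarrow> choice_sat (L x) option_count (cs x)"
      using G.choice_graph_correct by simp
    also have "\<dots> \<longleftrightarrow> (\<exists>u. length u \<le> poly q (length x) \<and>
        (let c = (step M ^^ T x) (start_config M (pair_word x u)) in
         fst c = halt M \<and> fst (snd c ! 1) 1 = 3 \<and> fst (snd c ! 1) 2 = 0))"
      using tableau_sat_iff[of "W x" "delimit x" "poly q (length x)" "3 + T x" "T x"] W
      by (simp only: L_def cs_def ss_eq[symmetric] W_def[symmetric] T_def[symmetric] pair_word_def)
    also have "\<dots> \<longleftrightarrow> x \<in> A"
    proof -
      have "(let c = (step M ^^ T x) (start_config M (pair_word x u)) in
         fst c = halt M \<and> fst (snd c ! 1) 1 = 3 \<and> fst (snd c ! 1) 2 = 0) \<longleftrightarrow> V (pair_word x u) = [True]"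
        if u: "length u \<le> poly q (length x)" for u
      proof -
        let ?w = "pair_word x u"
        obtain t where t: "t \<le> poly p (length ?w)" "fst ((step M ^^ t) (start_config M ?w)) = halt M"
          "output_is ((step M ^^ t) (start_config M ?w)) (V ?w)"
          using M(2) unfolding computes_in_time_def Let_def by blast
        \<comment> \<open>The run halts within the clock, and a halted configuration repeats, so all
          runs can be judged at the common time \<open>T x\<close>.\<close>
        have "poly p (length ?w) \<le> T x"
          unfolding T_def tl(2) poly_pcompose pair_word_def
          by (rule poly_nat_mono) (use u in \<open>simp add: length_delimit\<close>)
        then have "(step M ^^ T x) (start_config M ?w) = (step M ^^ (T x - t)) ((step M ^^ t) (start_config M ?w))"
          using t(1) by (simp flip: funpow_add comp_apply[of "step M ^^ (T x - t)"])
        then have "(step M ^^ T x) (start_config M ?w) = (step M ^^ t) (start_config M ?w)"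
          using steps_halted[OF t(2)] by simp
        then show ?thesis
          using t(2) output_is_True[OF t(3)] by (simp add: Let_def)
      qed
      then show ?thesis unfolding q by blast
    qed
    finally show ?thesis by simp
  qed
  ultimately show "A \<le>\<^sub>p MDCWSP_D" unfolding poly_reducible_def by blast
qed

theorem theorem2:
  shows "NP_complete MDCWSP_D"
  unfolding NP_complete_def using MDCWSP_D_in_NP NP_hard_MDCWSP_D ..

end
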